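(* Let $W:\mathbb{R}\to\mathbb{R}$ be a $C^3$ function that is even, satisfies $0=W(1)<W(s)$ for all $s\geq0$, $s\neq 1$, $W''(1)>0$, and $W'(s)\geq 0$ for $s\geq M$ for some $M>0$. Let $\Omega\subset\mathbb{R}^2$ be a domain with nonempty boundary which is symmetric ($x\in\Omega\Rightarrow\hat x\in\Omega$), with $\partial\Omega$ of class $C^{2+\alpha}$, satisfying (if unbounded) a uniform interior sphere condition with curvature of $\partial\Omega$ bounded in the $C^\alpha$ sense, and which is convex in $x_1$: $(x_1,x_2)\in\Omega\Rightarrow(tx_1,x_2)\in\Omega$ for all $|t|\leq 1$. Let $g:\partial\Omega\to\mathbb{R}$ be symmetric ($g(\hat x)=-g(x)$), bounded in $C^{2,\alpha}(\partial\Omega)$, with $g\geq 0$ on $(\partial\Omega)^+$, and let $u$ be the symmetric solution of $\Delta u=W'(u)$ in $\Omega$, $u=g$ on $\partial\Omega$, constructed as described in the context. Let $\bar u:\mathbb{R}\to\mathbb{R}$ be the odd solution of $v''=W'(v)$ on $\mathbb{R}$ with $\lim_{s\to+\infty}v(s)=1$. Then there exists a continuous decreasing map $R\mapsto q(R)$ with $\lim_{R\to+\infty}q(R)=0$ such that $$|u(x_1,x_2)-\bar u(x_1)|\leq q\big(d(x,\partial\Omega)\big)\quad\text{for all }x\in\Omega.$$ The map $q$ depends only on $W$, $n=2$ and the $C^1(\overline\Omega;\mathbb{R})$ norm of $u$.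
   Context: $\hat x=(-x_1,x_2)$; for a symmetric set $S$, $S^+=\{x\in S:x_1>0\}$. For a bounded domain $A$ and $w\in W^{1,2}(A)$, $J_A(w)=\int_A(\frac12|\nabla w|^2+W(w))\,dx$. The solution $u$ is the one produced as follows: if $\Omega$ is bounded, $u$ is a minimizer of $J_\Omega$ over the symmetric (odd in $x_1$) functions in $g+W^{1,2}_0(\Omega)$ (with $g$ extended to $\Omega$ as a symmetric $C^{2,\alpha}$ function), chosen with $|u|\leq\max\{M,\max_{(\partial\Omega)^+}g\}$ and $u\geq0$ on $\Omega^+$; if $\Omega$ is unbounded, $u$ is the limit, locally in $C^2$ along a subsequence, of such minimizers $u_j$ on an increasing sequence of bounded symmetric domains $\Omega_j$ with $C^{2,\alpha}$ boundaries satisfying a uniform interior sphere condition and $\bigcup_j\Omega_j=\Omega$. This $u$ is a symmetric classical solution with $u\ge0$ on $\Omega^+$ and $|u(x)-1|\le Ke^{-k d(x,\partial(\Omega^+))}$ on $\Omega^+$. *)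

theory Defs
  imports "HOL-Analysis.Analysis"
begin

type_synonym pt = "real \<times> real"

definition refl1 :: "pt \<Rightarrow> pt" where "refl1 x = (- fst x, snd x)"
definition plus_part :: "pt set \<Rightarrow> pt set" where "plus_part S = {x \<in> S. fst x > 0}"

definition sym_set :: "pt set \<Rightarrow> bool" where
  "sym_set S \<longleftrightarrow> (\<forall>x\<in>S. refl1 x \<in> S)"

definition convex_in_x1 :: "pt set \<Rightarrow> bool" where
  "convex_in_x1 S \<longleftrightarrow> (\<forall>a b t. (a, b) \<in> S \<and> \<bar>t\<bar> \<le> 1 \<longrightarrow> (t * a, b) \<in> S)"

definition domain :: "pt set \<Rightarrow> bool" where
  "domain S \<longleftrightarrow> open S \<and> connected S \<and> S \<noteq> {}"

definition evec :: "nat \<Rightarrow> pt" where "evec i = (if i = 1 then (1, 0) else (0, 1))"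
definition pd :: "(pt \<Rightarrow> real) \<Rightarrow> nat \<Rightarrow> pt \<Rightarrow> real" where
  "pd f i x = frechet_derivative f (at x) (evec i)"

definition C1_on :: "pt set \<Rightarrow> (pt \<Rightarrow> real) \<Rightarrow> bool" where
  "C1_on U f \<longleftrightarrow> (\<forall>x\<in>U. f differentiable (at x)) \<and> (\<forall>i\<in>{1,2}. continuous_on U (pd f i))"

definition C2_on :: "pt set \<Rightarrow> (pt \<Rightarrow> real) \<Rightarrow> bool" where
  "C2_on U f \<longleftrightarrow> C1_on U f \<and> (\<forall>i\<in>{1,2}. C1_on U (pd f i))"

definition laplacian :: "(pt \<Rightarrow> real) \<Rightarrow> pt \<Rightarrow> real" where
  "laplacian f x = pd (pd f 1) 1 x + pd (pd f 2) 2 x"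

definition C2a_bounded_on :: "real \<Rightarrow> pt set \<Rightarrow> (pt \<Rightarrow> real) \<Rightarrow> bool" where
  "C2a_bounded_on \<alpha> U f \<longleftrightarrow> C2_on U f \<and>
     (\<exists>K. \<forall>x\<in>U. \<bar>f x\<bar> \<le> K \<and> (\<forall>i\<in>{1,2}. \<bar>pd f i x\<bar> \<le> K \<and>
        (\<forall>j\<in>{1,2}. \<bar>pd (pd f i) j x\<bar> \<le> K \<and>
           (\<forall>y\<in>U. \<bar>pd (pd f i) j x - pd (pd f i) j y\<bar> \<le> K * dist x y powr \<alpha>))))"

definition C3_real :: "(real \<Rightarrow> real) \<Rightarrow> bool" where
  "C3_real f \<longleftrightarrow> (\<forall>k<3. \<forall>s. ((deriv ^^ k) f) differentiable (at s)) \<and> continuous_on UNIV ((deriv ^^ 3) f)"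

definition rot :: "real \<Rightarrow> pt \<Rightarrow> pt" where
  "rot \<theta> z = (cos \<theta> * fst z - sin \<theta> * snd z, sin \<theta> * fst z + cos \<theta> * snd z)"

definition c2a_graph_nbhd :: "real \<Rightarrow> real \<Rightarrow> pt set \<Rightarrow> pt \<Rightarrow> real \<Rightarrow> bool" where
  "c2a_graph_nbhd \<alpha> K S p r \<longleftrightarrow> (\<exists>\<theta> h.
      (\<forall>s. (h has_real_derivative deriv h s) (at s)) \<and>
      (\<forall>s. (deriv h has_real_derivative deriv (deriv h) s) (at s)) \<and>
      (\<forall>s. \<bar>deriv h s\<bar> \<le> K \<and> \<bar>deriv (deriv h) s\<bar> \<le> K) \<and>
      (\<forall>s t. \<bar>deriv (deriv h) s - deriv (deriv h) t\<bar> \<le> K * \<bar>s - t\<bar> powr \<alpha>) \<and>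
      S \<inter> ball p r = {y \<in> ball p r. snd (rot \<theta> (y - p)) > h (fst (rot \<theta> (y - p)))})"

definition c2a_boundary :: "real \<Rightarrow> pt set \<Rightarrow> bool" where
  "c2a_boundary \<alpha> S \<longleftrightarrow> (\<forall>p\<in>frontier S. \<exists>r>0. \<exists>K. c2a_graph_nbhd \<alpha> K S p r)"

text \<open>Uniform version (C^alpha-bounded curvature, uniform chart size).\<close>
definition uniform_c2a_boundary :: "real \<Rightarrow> pt set \<Rightarrow> bool" where
  "uniform_c2a_boundary \<alpha> S \<longleftrightarrow> (\<exists>r>0. \<exists>K. \<forall>p\<in>frontier S. c2a_graph_nbhd \<alpha> K S p r)"

definition interior_sphere :: "real \<Rightarrow> pt set \<Rightarrow> bool" where
  "interior_sphere \<rho> S \<longleftrightarrow> \<rho> > 0 \<and> (\<forall>p\<in>frontier S. \<exists>c. ball c \<rho> \<subseteq> S \<and> dist c p = \<rho>)"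

definition test_fun :: "pt set \<Rightarrow> (pt \<Rightarrow> real) \<Rightarrow> bool" where
  "test_fun A \<phi> \<longleftrightarrow> C1_on UNIV \<phi> \<and> (\<exists>K. compact K \<and> K \<subseteq> A \<and> (\<forall>x. x \<notin> K \<longrightarrow> \<phi> x = 0))"

definition L2_on :: "pt set \<Rightarrow> (pt \<Rightarrow> real) \<Rightarrow> bool" where
  "L2_on A f \<longleftrightarrow> f \<in> borel_measurable (lebesgue_on A) \<and> integrable (lebesgue_on A) (\<lambda>x. (f x)\<^sup>2)"

definition weak_grad :: "pt set \<Rightarrow> (pt \<Rightarrow> real) \<Rightarrow> (pt \<Rightarrow> real) \<Rightarrow> (pt \<Rightarrow> real) \<Rightarrow> bool" where
  "weak_grad A w G1 G2 \<longleftrightarrow> L2_on A w \<and> L2_on A G1 \<and> L2_on A G2 \<and>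
     (\<forall>\<phi>. test_fun A \<phi> \<longrightarrow>
        (\<integral>x. w x * pd \<phi> 1 x \<partial>lebesgue_on A) = - (\<integral>x. G1 x * \<phi> x \<partial>lebesgue_on A) \<and>
        (\<integral>x. w x * pd \<phi> 2 x \<partial>lebesgue_on A) = - (\<integral>x. G2 x * \<phi> x \<partial>lebesgue_on A))"

definition W12 :: "pt set \<Rightarrow> (pt \<Rightarrow> real) \<Rightarrow> bool" where
  "W12 A w \<longleftrightarrow> (\<exists>G1 G2. weak_grad A w G1 G2)"

definition W120 :: "pt set \<Rightarrow> (pt \<Rightarrow> real) \<Rightarrow> bool" where
  "W120 A w \<longleftrightarrow> (\<exists>G1 G2 \<phi>. weak_grad A w G1 G2 \<and> (\<forall>k. test_fun A (\<phi> k)) \<and>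
     ((\<lambda>k. \<integral>x. (w x - \<phi> k x)\<^sup>2 + (G1 x - pd (\<phi> k) 1 x)\<^sup>2 + (G2 x - pd (\<phi> k) 2 x)\<^sup>2
          \<partial>lebesgue_on A) \<longlonglongrightarrow> 0))"

definition J :: "(real \<Rightarrow> real) \<Rightarrow> pt set \<Rightarrow> (pt \<Rightarrow> real) \<Rightarrow> ennreal" where
  "J W A w = (INF G \<in> {(G1, G2). weak_grad A w G1 G2}.
      \<integral>\<^sup>+ x. ennreal (((fst G x)\<^sup>2 + (snd G x)\<^sup>2) / 2 + W (w x)) \<partial>lebesgue_on A)"

definition admissible :: "pt set \<Rightarrow> (pt \<Rightarrow> real) \<Rightarrow> (pt \<Rightarrow> real) \<Rightarrow> bool" where
  "admissible A g w \<longleftrightarrow> W12 A w \<and> W120 A (\<lambda>x. w x - g x) \<and> (\<forall>x\<in>A. w (refl1 x) = - w x)"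

text \<open>The minimizer used on bounded domains (g: the symmetric C^{2,alpha} extension).\<close>
definition bdd_minimizer :: "(real \<Rightarrow> real) \<Rightarrow> real \<Rightarrow> pt set \<Rightarrow> (pt \<Rightarrow> real) \<Rightarrow> (pt \<Rightarrow> real) \<Rightarrow> bool" where
  "bdd_minimizer W M A g u \<longleftrightarrow> admissible A g u \<and> (\<forall>v. admissible A g v \<longrightarrow> J W A u \<le> J W A v) \<and>
     (\<forall>x\<in>A. \<bar>u x\<bar> \<le> max M (Sup (g ` plus_part (frontier A)))) \<and>
     (\<forall>x\<in>plus_part A. u x \<ge> 0)"

definition loc_C2_conv :: "pt set \<Rightarrow> (nat \<Rightarrow> pt \<Rightarrow> real) \<Rightarrow> (pt \<Rightarrow> real) \<Rightarrow> bool" where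
  "loc_C2_conv S us u \<longleftrightarrow> (\<forall>K. compact K \<and> K \<subseteq> S \<longrightarrow> (\<forall>\<epsilon>>0. \<forall>\<^sub>F j in sequentially. \<forall>x\<in>K.
      \<bar>us j x - u x\<bar> < \<epsilon> \<and>
      (\<forall>i\<in>{1,2}. \<bar>pd (us j) i x - pd u i x\<bar> < \<epsilon> \<and>
         (\<forall>l\<in>{1,2}. \<bar>pd (pd (us j) i) l x - pd (pd u i) l x\<bar> < \<epsilon>))))"

definition constructed_solution ::
  "(real \<Rightarrow> real) \<Rightarrow> real \<Rightarrow> real \<Rightarrow> pt set \<Rightarrow> (pt \<Rightarrow> real) \<Rightarrow> (pt \<Rightarrow> real) \<Rightarrow> bool" where
  "constructed_solution W M \<alpha> S g u \<longleftrightarrow>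
     C2_on S u \<and> (\<forall>x\<in>S. laplacian u x = deriv W (u x)) \<and>
     (if bounded S then bdd_minimizer W M S g u
      else (\<exists>Ss us \<sigma> \<rho>. (\<forall>j. domain (Ss j) \<and> bounded (Ss j) \<and> sym_set (Ss j) \<and>
                c2a_boundary \<alpha> (Ss j) \<and> interior_sphere \<rho> (Ss j) \<and>
                bdd_minimizer W M (Ss j) g (us j) \<and> C2_on (Ss j) (us j)) \<and>
             incseq Ss \<and> (\<Union>j. Ss j) = S \<and> strict_mono \<sigma> \<and>
             loc_C2_conv S (\<lambda>j. us (\<sigma> j)) u))"

end

(*
  Let p be the square root of 2 W with the sign of 1 - |s|, so that the profile v solves v' = p(v).
  Write w = u - v(x_1).  Adding to the energy density the x_1-derivatives of -G(u), G' = p, and of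
  -(c/4) exp(-l v(x_1)) w^2 turns it, on x_1 >= 0, into a density that is bounded above and below
  by multiples of w^2 + |grad w|^2.  The added terms integrate to the same value for u and for every
  odd competitor with the same boundary values, since odd functions vanish on the axis.  The
  competitor that interpolates between u and v in a layer of width one (cut off evenly in x_1, hence
  odd) therefore gives a hole-filling inequality
    I(s) <= theta I(s+1),   I(s) = integral of w^2 + |grad w|^2 over the square of radius s,
  with theta < 1 depending only on W and the C^1 bound.  Convexity in x_1 keeps the reflected
  rectangles inside the domain.  So I(1) decays exponentially in the distance to the boundary, and
  the Lipschitz bound on w turns this into a pointwise bound for w.
*)
theory Submission
  imports Defs
begin

text \<open>Differentiating -G(u) along x_1 alone completes a square: the density becomes half of
  (d_2 w)^2 plus half of (d_1 w - (p(v + w) - p(v)))^2. This is nonnegative but degenerate, since it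
  vanishes at every translate of the profile in x_1. Oddness pins w to 0 on the axis and so forbids
  translates; the second added term turns this pinning into a bound on w^2. Its exponential weight
  comes from the shape of p: the difference p(v + w) - p(v) contracts at a definite rate only where
  v is near the well and is merely Lipschitz elsewhere. There p(v) = v' is bounded below, so
  differentiating exp(-l v) yields a term in p(v) w^2 that pays for the loss once l is large. These
  estimates need 0 <= u <= B, hence the restriction to x_1 >= 0. Variations are C^2 and vanish off a
  box in the domain. Their partial derivatives are then test functions, which ties any weak gradient
  to the classical one, and minimality becomes an inequality on a compact box, stable under the
  limit from bounded domains.\<close>

section \<open>Partial derivatives in the plane\<close>

lemma pd_eq: "(f has_derivative D) (at x) \<Longrightarrow> pd f i x = D (evec i)"
  unfolding pd_def using frechet_derivative_at by metis

lemma has_derivative_frechet: "f differentiable (at x) \<Longrightarrow> (f has_derivative frechet_derivative f (at x)) (at x)"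
  by (simp add: frechet_derivative_works)

lemma pd_add:
  "f differentiable (at x) \<Longrightarrow> g differentiable (at x) \<Longrightarrow> pd (\<lambda>x. f x + g x) i x = pd f i x + pd g i x"
  using pd_eq[OF has_derivative_add[OF has_derivative_frechet has_derivative_frechet]]
  by (simp add: pd_def)

lemma pd_diff:
  "f differentiable (at x) \<Longrightarrow> g differentiable (at x) \<Longrightarrow> pd (\<lambda>x. f x - g x) i x = pd f i x - pd g i x"
  using pd_eq[OF has_derivative_diff[OF has_derivative_frechet has_derivative_frechet]]
  by (simp add: pd_def)

lemma pd_minus: "f differentiable (at x) \<Longrightarrow> pd (\<lambda>x. - f x) i x = - pd f i x"
  using pd_eq[OF has_derivative_minus[OF has_derivative_frechet]] by (simp add: pd_def)

lemma pd_mult: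
  "f differentiable (at x) \<Longrightarrow> g differentiable (at x) \<Longrightarrow>
    pd (\<lambda>x. f x * g x) i x = f x * pd g i x + pd f i x * g x"
  using pd_eq[OF has_derivative_mult[OF has_derivative_frechet has_derivative_frechet]]
  by (simp add: pd_def)

lemma pd_const [simp]: "pd (\<lambda>x. c) i x = 0"
  using pd_eq[OF has_derivative_const] by simp

lemma has_derivative_compose_real:
  assumes "(F has_real_derivative F') (at (f x))" "f differentiable (at x)"
  shows "((\<lambda>x. F (f x)) has_derivative (\<lambda>h. F' * frechet_derivative f (at x) h)) (at x)"
  using DERIV_compose_FDERIV[OF assms(1) has_derivative_frechet[OF assms(2)]]
  by (simp add: mult.commute)

lemma pd_compose:
  assumes "(F has_real_derivative F') (at (f x))" "f differentiable (at x)"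
  shows "pd (\<lambda>x. F (f x)) i x = F' * pd f i x"
  using pd_eq[OF has_derivative_compose_real[OF assms]] by (simp add: pd_def)

lemma differentiable_compose_real:
  assumes "(F has_real_derivative F') (at (f x))" "f differentiable (at x)"
  shows "(\<lambda>x. F (f x)) differentiable (at x)"
  using has_derivative_compose_real[OF assms] by (auto simp: differentiable_def)

lemma pd_fst: "pd fst i x = fst (evec i)" 
  using pd_eq[OF has_derivative_fst[OF has_derivative_ident]] by simp

lemma pd_snd: "pd snd i x = snd (evec i)" 
  using pd_eq[OF has_derivative_snd[OF has_derivative_ident]] by simp

lemma evec_1 [simp]: "evec 1 = (1, 0)" "evec (Suc 0) = (1, 0)" and evec_2 [simp]: "evec 2 = (0, 1)"
  by (auto simp: evec_def)

text \<open>\<open>pd\<close> rests on a choice of derivative, so locality is proved for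
  \<open>has_derivative\<close> and then inherited by the chosen derivative.\<close>

lemma has_derivative_cong_open:
  assumes "open U" "x \<in> U" "\<And>y. y \<in> U \<Longrightarrow> f y = g y"
  shows "(f has_derivative D) (at x) \<longleftrightarrow> (g has_derivative D) (at x)"
  using has_derivative_transform_within_open[OF _ assms(1,2), of f D UNIV g]
    has_derivative_transform_within_open[OF _ assms(1,2), of g D UNIV f] assms(3) by auto

lemma pd_cong_open:
  assumes "open U" "x \<in> U" "\<And>y. y \<in> U \<Longrightarrow> f y = g y"
  shows "pd f i x = pd g i x"
  unfolding pd_def frechet_derivative_def using has_derivative_cong_open[OF assms] by simp

lemma differentiable_cong_open:
  assumes "open U" "x \<in> U" "\<And>y. y \<in> U \<Longrightarrow> f y = g y"
  shows "f differentiable (at x) \<longleftrightarrow> g differentiable (at x)"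
  unfolding differentiable_def using has_derivative_cong_open[OF assms] by simp

text \<open>Restriction to coordinate lines opens the way to one-variable tools: the fundamental
  theorem of calculus for integration by parts, mean value bounds for Lipschitz estimates, and the
  local extremum test for cutoffs.\<close>

lemma pd_slice:
  assumes "f differentiable (at (a, b))"
  shows "((\<lambda>t. f (t, b)) has_real_derivative pd f 1 (a, b)) (at a)"
    and "((\<lambda>t. f (a, t)) has_real_derivative pd f 2 (a, b)) (at b)"
proof -
  let ?D = "frechet_derivative f (at (a, b))"
  have D: "(f has_derivative ?D) (at (a, b))" by (rule has_derivative_frechet[OF assms])
  interpret bounded_linear ?D using D by (rule has_derivative_bounded_linear)
  have "((\<lambda>t. f (t, b)) has_derivative (\<lambda>h. ?D (h, 0))) (at a)"
    by (rule has_derivative_compose[of "\<lambda>t. (t, b)" "\<lambda>h. (h, 0)" a UNIV f, OF _ D])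
       (auto intro!: derivative_eq_intros)
  moreover have "(\<lambda>h. ?D (h, 0)) = (*) (pd f 1 (a, b))"
  proof
    fix h
    have "?D (h, 0) = ?D (h *\<^sub>R (1, 0))" by simp
    then show "?D (h, 0) = pd f 1 (a, b) * h" by (simp only: scale pd_def evec_1 real_scaleR_def mult.commute)
  qed
  ultimately show "((\<lambda>t. f (t, b)) has_real_derivative pd f 1 (a, b)) (at a)"
    by (simp add: has_field_derivative_def)
  have "((\<lambda>t. f (a, t)) has_derivative (\<lambda>h. ?D (0, h))) (at b)"
    by (rule has_derivative_compose[of "\<lambda>t. (a, t)" "\<lambda>h. (0, h)" b UNIV f, OF _ D])
       (auto intro!: derivative_eq_intros)
  moreover have "(\<lambda>h. ?D (0, h)) = (*) (pd f 2 (a, b))"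
  proof
    fix h
    have "?D (0, h) = ?D (h *\<^sub>R (0, 1))" by simp
    then show "?D (0, h) = pd f 2 (a, b) * h" by (simp only: scale pd_def evec_2 real_scaleR_def mult.commute)
  qed
  ultimately show "((\<lambda>t. f (a, t)) has_real_derivative pd f 2 (a, b)) (at b)"
    by (simp add: has_field_derivative_def)
qed

section \<open>Functions of class C^1 and C^2: locality, algebra, chain rule, extension by
  zero\<close>

lemma C1_onD:
  assumes "C1_on U f"
  shows "x \<in> U \<Longrightarrow> f differentiable (at x)" "i \<in> {1, 2} \<Longrightarrow> continuous_on U (pd f i)" "continuous_on U f"
proof -
  show 1: "x \<in> U \<Longrightarrow> f differentiable (at x)" for x using assms by (simp add: C1_on_def)
  show "i \<in> {1, 2} \<Longrightarrow> continuous_on U (pd f i)" using assms unfolding C1_on_def by blast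
  show "continuous_on U f"
    using 1 differentiable_imp_continuous_within continuous_at_imp_continuous_on by blast
qed

lemma C2_onD:
  assumes "C2_on U f"
  shows "C1_on U f" "i \<in> {1, 2} \<Longrightarrow> C1_on U (pd f i)"
  using assms by (auto simp: C2_on_def)

text \<open>The derivative at each point is that of the whole plane, so the smaller set may be
  closed; it is often a box.\<close>

lemma C1_on_subset: "C1_on U f \<Longrightarrow> V \<subseteq> U \<Longrightarrow> C1_on V f"
  unfolding C1_on_def by (auto intro: continuous_on_subset)

lemma C2_on_subset: "C2_on U f \<Longrightarrow> V \<subseteq> U \<Longrightarrow> C2_on V f"
  unfolding C2_on_def by (auto intro: C1_on_subset)

lemma C1_on_cong_open:
  assumes "open U" "\<And>y. y \<in> U \<Longrightarrow> f y = g y" "C1_on U g"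
  shows "C1_on U f"
  unfolding C1_on_def
proof (intro conjI ballI)
  fix x assume x: "x \<in> U"
  show "f differentiable (at x)"
    by (rule differentiable_cong_open[OF assms(1) x assms(2), THEN iffD2, OF _ C1_onD(1)[OF assms(3) x]])
next
  fix i :: nat assume "i \<in> {1, 2}"
  then have *: "continuous_on U (pd g i)" by (rule C1_onD(2)[OF assms(3)])
  show "continuous_on U (pd f i)"
    by (rule continuous_on_eq[OF *]) (rule pd_cong_open[OF assms(1) _ assms(2), symmetric])
qed

lemma C2_on_cong_open:
  assumes "open U" "\<And>y. y \<in> U \<Longrightarrow> f y = g y" "C2_on U g"
  shows "C2_on U f"
  unfolding C2_on_def
proof (intro conjI ballI)
  show "C1_on U f" by (rule C1_on_cong_open[OF assms(1,2) C2_onD(1)[OF assms(3)]])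
  fix i :: nat assume "i \<in> {1, 2}"
  then show "C1_on U (pd f i)"
    by (intro C1_on_cong_open[OF assms(1) pd_cong_open[OF assms(1) _ assms(2)] C2_onD(2)[OF assms(3)]])
qed

lemma C1_on_Un_open:
  assumes "open U" "open V" "C1_on U f" "C1_on V f" shows "C1_on (U \<union> V) f"
  using assms unfolding C1_on_def by (blast intro: continuous_on_open_Un)

lemma C2_on_Un_open:
  assumes "open U" "open V" "C2_on U f" "C2_on V f" shows "C2_on (U \<union> V) f"
  using assms unfolding C2_on_def by (blast intro: C1_on_Un_open)

lemma C1_on_const [simp]: "C1_on U (\<lambda>x. c)"
  by (simp add: C1_on_def)

lemma pd_const_fun: "pd (\<lambda>x. c) i = (\<lambda>x. 0)"
  by (simp add: fun_eq_iff)

lemma C2_on_const [simp]: "C2_on U (\<lambda>x. c)"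
  by (simp add: C2_on_def pd_const_fun)

lemma C1_on_add: "C1_on U f \<Longrightarrow> C1_on U g \<Longrightarrow> C1_on U (\<lambda>x. f x + g x)"
proof -
  assume f: "C1_on U f" and g: "C1_on U g"
  have "continuous_on U (pd (\<lambda>x. f x + g x) i)" if i: "i \<in> {1, 2}" for i
    by (rule continuous_on_eq[OF continuous_on_add[OF C1_onD(2)[OF f i] C1_onD(2)[OF g i]]])
       (simp add: pd_add C1_onD(1)[OF f] C1_onD(1)[OF g])
  then show ?thesis
    unfolding C1_on_def using C1_onD(1)[OF f] C1_onD(1)[OF g] differentiable_add by blast
qed

lemma C1_on_diff: "C1_on U f \<Longrightarrow> C1_on U g \<Longrightarrow> C1_on U (\<lambda>x. f x - g x)"
proof -
  assume f: "C1_on U f" and g: "C1_on U g"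
  have "continuous_on U (pd (\<lambda>x. f x - g x) i)" if i: "i \<in> {1, 2}" for i
    by (rule continuous_on_eq[OF continuous_on_diff[OF C1_onD(2)[OF f i] C1_onD(2)[OF g i]]])
       (simp add: pd_diff C1_onD(1)[OF f] C1_onD(1)[OF g])
  then show ?thesis
    unfolding C1_on_def using C1_onD(1)[OF f] C1_onD(1)[OF g] differentiable_diff by blast
qed

lemma C1_on_mult:
  assumes f: "C1_on U f" and g: "C1_on U g" shows "C1_on U (\<lambda>x. f x * g x)"
proof -
  have *: "continuous_on U (\<lambda>x. f x * pd g i x + pd f i x * g x)" if "i \<in> {1, 2}" for i
    using C1_onD[OF f] C1_onD[OF g] that by (intro continuous_intros) auto
  have "continuous_on U (pd (\<lambda>x. f x * g x) i)" if "i \<in> {1, 2}" for i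
    by (rule continuous_on_eq[OF *[OF that]]) (simp add: pd_mult C1_onD(1)[OF f] C1_onD(1)[OF g])
  then show ?thesis
    unfolding C1_on_def using C1_onD(1)[OF f] C1_onD(1)[OF g] differentiable_mult by blast
qed

lemma C1_on_compose:
  assumes f: "C1_on U f" and F: "\<And>s. (F has_real_derivative F' s) (at s)" and F': "continuous_on UNIV F'"
  shows "C1_on U (\<lambda>x. F (f x))"
proof -
  have *: "continuous_on U (\<lambda>x. F' (f x) * pd f i x)" if "i \<in> {1, 2}" for i
    using C1_onD[OF f] that by (intro continuous_intros continuous_on_compose2[OF F']) auto
  have "continuous_on U (pd (\<lambda>x. F (f x)) i)" if "i \<in> {1, 2}" for i
    by (rule continuous_on_eq[OF *[OF that]]) (simp add: pd_compose[OF F C1_onD(1)[OF f]])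
  then show ?thesis
    unfolding C1_on_def using C1_onD(1)[OF f] differentiable_compose_real[OF F] by blast
qed

text \<open>A second derivative at a point sees the first derivative nearby, hence
  \<open>open U\<close>: the formula for \<open>pd\<close> of the sum must hold on a neighbourhood
  before it is differentiated again.\<close>

lemma C2_on_add: 
  assumes "open U" "C2_on U f" "C2_on U g" shows "C2_on U (\<lambda>x. f x + g x)"
  unfolding C2_on_def
proof (intro conjI ballI)
  fix i :: nat assume "i \<in> {1, 2}"
  then have "C1_on U (\<lambda>x. pd f i x + pd g i x)" using C1_on_add C2_onD(2) assms by blast
  then show "C1_on U (pd (\<lambda>x. f x + g x) i)"
    by (rule C1_on_cong_open[OF assms(1), rotated]) (simp add: pd_add C1_onD(1)[OF C2_onD(1)[OF assms(2)]] C1_onD(1)[OF C2_onD(1)[OF assms(3)]])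
qed (use C1_on_add C2_onD(1) assms in blast)

lemma C2_on_diff: 
  assumes "open U" "C2_on U f" "C2_on U g" shows "C2_on U (\<lambda>x. f x - g x)"
  unfolding C2_on_def
proof (intro conjI ballI)
  fix i :: nat assume "i \<in> {1, 2}"
  then have "C1_on U (\<lambda>x. pd f i x - pd g i x)" using C1_on_diff C2_onD(2) assms by blast
  then show "C1_on U (pd (\<lambda>x. f x - g x) i)"
    by (rule C1_on_cong_open[OF assms(1), rotated]) (simp add: pd_diff C1_onD(1)[OF C2_onD(1)[OF assms(2)]] C1_onD(1)[OF C2_onD(1)[OF assms(3)]])
qed (use C1_on_diff C2_onD(1) assms in blast)

lemma C2_on_mult: 
  assumes "open U" "C2_on U f" "C2_on U g" shows "C2_on U (\<lambda>x. f x * g x)"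
  unfolding C2_on_def
proof (intro conjI ballI)
  fix i :: nat assume "i \<in> {1, 2}"
  then have "C1_on U (\<lambda>x. f x * pd g i x + pd f i x * g x)"
    using C1_on_add C1_on_mult C2_onD assms by meson
  then show "C1_on U (pd (\<lambda>x. f x * g x) i)"
    by (rule C1_on_cong_open[OF assms(1), rotated]) (simp add: pd_mult C1_onD(1)[OF C2_onD(1)[OF assms(2)]] C1_onD(1)[OF C2_onD(1)[OF assms(3)]])
qed (use C1_on_mult C2_onD(1) assms in blast)

lemma C2_on_compose:
  assumes "open U" and f: "C2_on U f"
    and F: "\<And>s. (F has_real_derivative F' s) (at s)" and F': "\<And>s. (F' has_real_derivative F'' s) (at s)"
    and F'': "continuous_on UNIV F''"
  shows "C2_on U (\<lambda>x. F (f x))"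
  unfolding C2_on_def
proof (intro conjI ballI)
  have "continuous_on UNIV F'"
    using F' DERIV_isCont continuous_at_imp_continuous_on by blast
  then show "C1_on U (\<lambda>x. F (f x))" by (rule C1_on_compose[OF C2_onD(1)[OF f] F])
  fix i :: nat assume "i \<in> {1, 2}"
  then have "C1_on U (\<lambda>x. F' (f x) * pd f i x)"
    by (intro C1_on_mult C1_on_compose[OF C2_onD(1)[OF f] F' F''] C2_onD(2)[OF f])
  then show "C1_on U (pd (\<lambda>x. F (f x)) i)"
    by (rule C1_on_cong_open[OF assms(1), rotated]) (simp add: pd_compose[OF F] C1_onD(1)[OF C2_onD(1)[OF f]])
qed

lemma C2_on_fst [simp]: "C2_on U fst" and C2_on_snd [simp]: "C2_on U snd"
proof -
  have "pd fst i = (\<lambda>x. fst (evec i))" "pd snd i = (\<lambda>x. snd (evec i))" for i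
    by (simp_all add: fun_eq_iff pd_fst pd_snd)
  then show "C2_on U fst" "C2_on U snd"
    by (auto simp: C2_on_def C1_on_def pd_const_fun intro!: bounded_linear_imp_differentiable bounded_linear_fst bounded_linear_snd)
qed

text \<open>\<open>U\<close> and the complement of \<open>K\<close> form an open cover of the plane,
  and on the complement the function is locally zero.\<close>

lemma C1_on_UNIV_zero_extension:
  assumes "open U" "closed K" "K \<subseteq> U" "C1_on U f" "\<And>x. x \<notin> K \<Longrightarrow> f x = 0"
  shows "C1_on UNIV f"
proof -
  have "C1_on (- K) f"
    by (rule C1_on_cong_open[of _ _ "\<lambda>x. 0"]) (use assms in auto)
  then have "C1_on (U \<union> - K) f" using assms by (intro C1_on_Un_open) auto
  moreover have "U \<union> - K = UNIV" using assms by auto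
  ultimately show ?thesis by simp
qed

lemma C2_on_UNIV_zero_extension:
  assumes "open U" "closed K" "K \<subseteq> U" "C2_on U f" "\<And>x. x \<notin> K \<Longrightarrow> f x = 0"
  shows "C2_on UNIV f"
proof -
  have "C2_on (- K) f"
    by (rule C2_on_cong_open[of _ _ "\<lambda>x. 0"]) (use assms in auto)
  then have "C2_on (U \<union> - K) f" using assms by (intro C2_on_Un_open) auto
  moreover have "U \<union> - K = UNIV" using assms by auto
  ultimately show ?thesis by simp
qed

lemma pd_zero_outside:
  assumes "closed K" "\<And>x. x \<notin> K \<Longrightarrow> f x = 0" "x \<notin> K"
  shows "pd f i x = 0"
  using pd_cong_open[of "- K" x f "\<lambda>x. 0" i] assms by auto

section \<open>The signed square root of the potential\<close>

text \<open>The sign change at the well removes the corner that \<open>sqrt (2 * W s)\<close> has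
  there and makes 1 an attracting rest point of v' = p(v).\<close>

definition well_root :: "(real \<Rightarrow> real) \<Rightarrow> real \<Rightarrow> real" where
  "well_root W s = sgn (1 - \<bar>s\<bar>) * sqrt (2 * W s)"

lemma C3_real_derivs:
  assumes "C3_real W"
  shows "(W has_real_derivative deriv W s) (at s)"
    and "(deriv W has_real_derivative deriv (deriv W) s) (at s)"
    and "isCont (deriv (deriv W)) s"
proof -
  have 0: "((deriv ^^ k) W) differentiable (at s)" if "k < 3" for k
    using assms that by (auto simp: C3_real_def)
  show "(W has_real_derivative deriv W s) (at s)"
    using 0[of 0] by (simp add: DERIV_deriv_iff_real_differentiable)
  show "(deriv W has_real_derivative deriv (deriv W) s) (at s)"
    using 0[of 1] by (simp add: DERIV_deriv_iff_real_differentiable)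
  have "(deriv (deriv W)) differentiable (at s)"
    using 0[of 2] by (simp add: numeral_2_eq_2)
  then show "isCont (deriv (deriv W)) s"
    by (rule differentiable_imp_continuous_within)
qed

locale double_well =
  fixes W :: "real \<Rightarrow> real"
  assumes W_C3: "C3_real W"
    and W_even: "W (- s) = W s"
    and W_one: "W 1 = 0"
    and W_pos: "s \<ge> 0 \<Longrightarrow> s \<noteq> 1 \<Longrightarrow> W s > 0"
    and W_nondeg: "deriv (deriv W) 1 > 0"
begin

lemmas W_deriv = C3_real_derivs(1)[OF W_C3]
lemmas W'_deriv = C3_real_derivs(2)[OF W_C3]
lemmas W''_cont = C3_real_derivs(3)[OF W_C3]

abbreviation "W' \<equiv> deriv W"
abbreviation "W'' \<equiv> deriv (deriv W)"
abbreviation "p \<equiv> well_root W"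

lemma W_nonneg: "W s \<ge> 0"
proof (cases "s \<ge> 0")
  case True then show ?thesis using W_pos[of s] W_one by (cases "s = 1") auto
next
  case False then show ?thesis using W_pos[of "-s"] W_one W_even[of s] by (cases "s = -1") auto
qed

lemma isCont_W: "isCont W s"
  using W_deriv DERIV_isCont by blast

lemma isCont_W': "isCont W' s"
  using W'_deriv DERIV_isCont by blast

lemma continuous_on_W: "continuous_on S W"
  using isCont_W continuous_at_imp_continuous_on by blast

lemma continuous_on_W': "continuous_on S W'"
  using isCont_W' continuous_at_imp_continuous_on by blast

lemma W'_one: "W' 1 = 0"
proof (rule DERIV_local_min[OF W_deriv, of 1])
  show "\<forall>y. \<bar>1 - y\<bar> < 1 \<longrightarrow> W 1 \<le> W y"
    using W_nonneg W_one by auto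
qed simp

lemma p_sq: "(p s)\<^sup>2 = 2 * W s"
proof (cases "\<bar>s\<bar> = 1")
  case True
  then have "W s = 0" using W_one W_even[of 1] by (auto simp: abs_if split: if_splits)
  then show ?thesis by (simp add: well_root_def)
next
  case False
  then have "(sgn (1 - \<bar>s\<bar>))\<^sup>2 = (1::real)"
    by (auto simp: sgn_if)
  then show ?thesis using W_nonneg[of s] by (simp add: well_root_def power_mult_distrib)
qed

lemma p_one [simp]: "p 1 = 0"
  by (simp add: well_root_def)

lemma abs_p: "\<bar>p s\<bar> = sqrt (2 * W s)"
  by (metis p_sq real_sqrt_abs)

lemma isCont_p: "isCont p s"
proof (cases "\<bar>s\<bar> = 1")
  case True
  then have 0: "W s = 0" using W_one W_even[of 1] by (auto simp: abs_if split: if_splits)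
  \<comment> \<open>At the wells the sign jumps, but the absolute value of \<open>p\<close> tends to
    0, so the jump is harmless.\<close>
  have "((\<lambda>t. sqrt (2 * W t)) \<longlongrightarrow> sqrt (2 * W s)) (at s)"
    using isCont_W[of s] by (intro tendsto_intros) (auto simp: isCont_def)
  then have "((\<lambda>t. \<bar>p t\<bar>) \<longlongrightarrow> 0) (at s)"
    using 0 by (simp add: abs_p)
  then have "(p \<longlongrightarrow> 0) (at s)" by (rule tendsto_rabs_zero_cancel)
  moreover have "p s = 0" using 0 by (simp add: well_root_def)
  ultimately show ?thesis by (simp add: isCont_def)
next
  case False
  then have "isCont (\<lambda>t. sgn (1 - \<bar>t\<bar>) * sqrt (2 * W t)) s"
    using isCont_W[of s] by (intro continuous_intros continuous_sgn) auto
  then show ?thesis by (simp add: well_root_def[abs_def])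
qed

lemma continuous_on_p: "continuous_on S p"
  using isCont_p continuous_at_imp_continuous_on by blast

text \<open>Differentiation of p^2 = 2 W, with the sign locally constant off the well. Later
  estimates work on one side of 1 at a time and are joined through the value at 1.\<close>

lemma p_deriv:
  assumes "s \<ge> 0" "s \<noteq> 1"
  shows "(p has_real_derivative W' s / p s) (at s)"
proof -
  have pos: "W s > 0" using assms W_pos by blast
  have 1: "((\<lambda>t. sgn (1 - \<bar>s\<bar>) * sqrt (2 * W t)) has_real_derivative W' s / p s) (at s)"
    using pos assms
    by (auto intro!: derivative_eq_intros W_deriv simp: well_root_def sgn_if field_simps)
  have ev: "\<forall>\<^sub>F t in nhds s. sgn (1 - \<bar>t\<bar>) = sgn (1 - \<bar>s\<bar>)"
  proof (cases "s < 1")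
    case True
    have "open {-1<..<1::real}" by simp
    with True assms have "\<forall>\<^sub>F t in nhds s. t \<in> {-1<..<1}"
      by (intro eventually_nhds_in_open) auto
    then show ?thesis by eventually_elim (use True assms in \<open>auto simp: sgn_if\<close>)
  next
    case False
    then have "\<forall>\<^sub>F t in nhds s. t \<in> {1<..}"
      using assms by (intro eventually_nhds_in_open) auto
    then show ?thesis by eventually_elim (use False assms in \<open>auto simp: sgn_if\<close>)
  qed
  show ?thesis
    by (rule iffD2[OF DERIV_cong_ev[OF refl _ refl] 1])
       (use ev in \<open>eventually_elim, simp add: well_root_def\<close>)
qed

section \<open>Behaviour of the potential and of its root at the well\<close>

lemma W'_near_one:
  obtains \<delta> m where "0 < \<delta>" "\<delta> \<le> 1" "0 < m"
    "\<And>s. \<bar>s - 1\<bar> \<le> \<delta> \<Longrightarrow> W' s * (s - 1) \<ge> m * (s - 1)\<^sup>2"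
    "\<And>s. \<bar>s - 1\<bar> \<le> \<delta> \<Longrightarrow> W s \<ge> m / 2 * (s - 1)\<^sup>2"
proof -
  \<comment> \<open>Half of the second derivative at the well: continuity of \<open>W''\<close> then
    keeps \<open>W''\<close> above \<open>m\<close> in a neighbourhood of 1.\<close>
  define m where "m = W'' 1 / 2"
  have m: "m > 0" using W_nondeg by (simp add: m_def)
  have "\<forall>\<^sub>F s in nhds 1. W'' s > m"
    using W''_cont[of 1] W_nondeg m_def
    by (intro order_tendstoD(1)[of _ "W'' 1"]) (auto simp: continuous_at tendsto_at_iff_tendsto_nhds)
  then obtain d where d: "d > 0" "\<And>s. dist s 1 < d \<Longrightarrow> W'' s > m"
    by (auto simp: eventually_nhds_metric)
  \<comment> \<open>The cap 1 keeps the neighbourhood in [0, 2], hence in every [0, B] considered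
    below.\<close>
  define \<delta> where "\<delta> = min 1 (d / 2)"
  have \<delta>: "0 < \<delta>" "\<delta> \<le> 1" "\<delta> < d" using d by (auto simp: \<delta>_def)
  have A: "W' s * (s - 1) \<ge> m * (s - 1)\<^sup>2" if "\<bar>s - 1\<bar> \<le> \<delta>" for s
  proof -
    consider "s = 1" | "s < 1" | "s > 1" by linarith
    then show ?thesis
    proof cases
      case 2
      obtain z where z: "s < z" "z < 1" "W' 1 - W' s = (1 - s) * W'' z"
        using MVT2[OF 2, of W' W''] W'_deriv by blast
      then have "W'' z \<ge> m" using d(2)[of z] that \<delta> 2 by (auto simp: dist_real_def intro: less_imp_le)
      then have "(1-s)^2 * m \<le> (1-s)^2 * W'' z" by (rule mult_left_mono) simp
      then show ?thesis using z W'_one by (simp add: power2_eq_square algebra_simps)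
    next
      case 3
      obtain z where z: "1 < z" "z < s" "W' s - W' 1 = (s - 1) * W'' z"
        using MVT2[OF 3, of W' W''] W'_deriv by blast
      then have "W'' z \<ge> m" using d(2)[of z] that \<delta> 3 by (auto simp: dist_real_def intro: less_imp_le)
      then have "(s-1)^2 * m \<le> (s-1)^2 * W'' z" by (rule mult_left_mono) simp
      moreover have "W' s * (s - 1) = (s-1)^2 * W'' z" using z W'_one by (simp add: power2_eq_square)
      ultimately show ?thesis by (simp add: mult.commute)
    qed auto
  qed
  have D: "((\<lambda>t. W t - m/2 * (t-1)\<^sup>2) has_real_derivative W' t - m * (t - 1)) (at t)" for t
    by (auto intro!: derivative_eq_intros W_deriv)
  have Bd: "W s \<ge> m / 2 * (s - 1)\<^sup>2" if "\<bar>s - 1\<bar> \<le> \<delta>" for s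
  proof (cases "s \<ge> 1")
    case True
    have "W 1 - m/2 * (1-1)\<^sup>2 \<le> W s - m/2 * (s-1)\<^sup>2"
    proof (rule DERIV_nonneg_imp_nondecreasing[OF True])
      fix t assume t: "1 \<le> t" "t \<le> s"
      have "m * (t - 1) \<le> W' t"
      proof (cases "t = 1")
        case False
        then have "m * (t-1) * (t-1) \<le> W' t * (t-1)" "t - 1 > 0"
          using A[of t] that t by (auto simp: power2_eq_square mult.assoc)
        then show ?thesis by simp
      qed (simp add: W'_one)
      then show "\<exists>y. ((\<lambda>t. W t - m/2 * (t-1)\<^sup>2) has_real_derivative y) (at t) \<and> 0 \<le> y"
        using D[of t] by (intro exI conjI) auto
    qed
    then show ?thesis using W_one by simp
  next
    case False
    have "W s - m/2 * (s-1)\<^sup>2 \<ge> W 1 - m/2 * (1-1)\<^sup>2"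
    proof (rule DERIV_nonpos_imp_nonincreasing[of s 1])
      fix t assume t: "s \<le> t" "t \<le> 1"
      have "m * (t - 1) \<ge> W' t"
      proof (cases "t = 1")
        case False
        then have *: "W' t * (t-1) \<ge> m * (t-1) * (t-1)" "t - 1 < 0"
          using A[of t] that t by (auto simp: power2_eq_square mult.assoc)
        then show ?thesis by (simp add: mult_le_cancel_right)
      qed (simp add: W'_one)
      then show "\<exists>y. ((\<lambda>t. W t - m/2 * (t-1)\<^sup>2) has_real_derivative y) (at t) \<and> y \<le> 0"
        using D[of t] by (intro exI conjI) auto
    qed (use False in simp)
    then show ?thesis using W_one by simp
  qed
  show ?thesis using that[OF \<delta>(1,2) m A Bd] by blast
qed

lemma W'_lipschitz:
  assumes "B \<ge> 2"
  obtains K where "K > 0" "\<And>s. 0 \<le> s \<Longrightarrow> s \<le> B \<Longrightarrow> \<bar>W' s\<bar> \<le> K * \<bar>s - 1\<bar>"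
    "\<And>s. 0 \<le> s \<Longrightarrow> s \<le> B \<Longrightarrow> W s \<le> K * (s - 1)\<^sup>2"
proof -
  have "compact (W'' ` {0..B})"
    using W''_cont by (intro compact_continuous_image continuous_at_imp_continuous_on) auto
  then obtain K where K: "K > 0" "\<And>s. s \<in> {0..B} \<Longrightarrow> \<bar>W'' s\<bar> \<le> K"
    using compact_imp_bounded bounded_pos by (metis imageI real_norm_def)
  have 1: "\<bar>W' s\<bar> \<le> K * \<bar>s - 1\<bar>" if "0 \<le> s" "s \<le> B" for s
  proof -
    have "norm (W' s - W' 1) \<le> K * norm (s - 1)"
      by (rule field_differentiable_bound[of "{0..B}" W' W''])
         (use that assms K in \<open>auto intro: DERIV_subset[OF W'_deriv]\<close>)
    then show ?thesis by (simp add: W'_one)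
  qed
  have 2: "W s \<le> K * (s - 1)\<^sup>2" if "0 \<le> s" "s \<le> B" for s
  proof -
    have "norm (W s - W 1) \<le> (K * \<bar>s - 1\<bar>) * norm (s - 1)"
    proof (rule field_differentiable_bound[of "closed_segment s 1" W W'])
      fix z assume z: "z \<in> closed_segment s 1"
      then have "0 \<le> z" "z \<le> B" "\<bar>z - 1\<bar> \<le> \<bar>s - 1\<bar>"
        using that assms by (auto simp: closed_segment_eq_real_ivl split: if_splits)
      with 1[of z] K(1) show "norm (W' z) \<le> K * \<bar>s - 1\<bar>"
        by (metis mult_le_cancel_left_pos order_trans real_norm_def)
    qed (use DERIV_subset[OF W_deriv] in auto)
    then show ?thesis using W_nonneg[of s] by (simp add: W_one power2_eq_square)
  qed
  show ?thesis using that[OF K(1) 1 2] .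
qed

text \<open>Near 1 nondegeneracy gives the quadratic bound. On the remaining compact part of [0, B]
  the minimum of W is positive while (s - 1)^2 <= B^2.\<close>

lemma W_coercive:
  assumes "B \<ge> 2"
  obtains c where "c > 0" "\<And>s. 0 \<le> s \<Longrightarrow> s \<le> B \<Longrightarrow> W s \<ge> c * (s - 1)\<^sup>2"
proof -
  obtain \<delta> m where \<delta>: "0 < \<delta>" "\<delta> \<le> 1" "0 < m"
    "\<And>s. \<bar>s - 1\<bar> \<le> \<delta> \<Longrightarrow> W' s * (s - 1) \<ge> m * (s - 1)\<^sup>2"
    "\<And>s. \<bar>s - 1\<bar> \<le> \<delta> \<Longrightarrow> W s \<ge> m / 2 * (s - 1)\<^sup>2"
    using W'_near_one by blast
  let ?S = "{0..1-\<delta>} \<union> {1+\<delta>..B}"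
  have "compact ?S" "?S \<noteq> {}" using \<delta> by auto
  then obtain z where z: "z \<in> ?S" "\<And>s. s \<in> ?S \<Longrightarrow> W z \<le> W s"
    using continuous_attains_inf[of ?S W] continuous_on_W by blast
  have Wz: "W z > 0" using z(1) \<delta> by (intro W_pos) auto
  define c where "c = min (m/2) (W z / B\<^sup>2)"
  have c: "c > 0" using Wz \<delta> assms by (simp add: c_def)
  have "W s \<ge> c * (s - 1)\<^sup>2" if s: "0 \<le> s" "s \<le> B" for s
  proof (cases "\<bar>s - 1\<bar> \<le> \<delta>")
    case True
    have "c \<le> m/2" unfolding c_def by linarith
    then have "c * (s-1)\<^sup>2 \<le> m/2 * (s-1)\<^sup>2" by (rule mult_right_mono) simp
    then show ?thesis using \<delta>(5)[OF True] by linarith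
  next
    case False
    then have 1: "W z \<le> W s" using s by (intro z(2)) auto
    have "(s-1)\<^sup>2 \<le> B\<^sup>2" using s assms by (intro power2_le_iff_abs_le[THEN iffD2]) auto
    then have "c * (s-1)\<^sup>2 \<le> (W z / B\<^sup>2) * B\<^sup>2"
      using Wz by (intro mult_mono) (auto simp: c_def)
    then show ?thesis using 1 assms by simp
  qed
  then show ?thesis using that c by blast
qed

lemma p_sign: 
  assumes "0 \<le> s" shows "s \<le> 1 \<Longrightarrow> p s \<ge> 0" "s \<ge> 1 \<Longrightarrow> p s \<le> 0"
  using assms W_nonneg[of s] by (auto simp: well_root_def sgn_if)

text \<open>Near 1 the derivative of W is O(|s - 1|) and |p| is at least a multiple of |s - 1|, so
  the quotient \<open>W' s / p s\<close>, the slope of p, stays bounded. The mean value theorem is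
  applied only to intervals without 1 in their interior; otherwise 1 is inserted as an intermediate
  point.\<close>

lemma p_bounds:
  assumes "B \<ge> 2"
  obtains c \<Lambda> where "c > 0" "\<Lambda> > 0"
    "\<And>s. 0 \<le> s \<Longrightarrow> s \<le> B \<Longrightarrow> c * \<bar>s - 1\<bar> \<le> \<bar>p s\<bar>"
    "\<And>s t. 0 \<le> s \<Longrightarrow> s \<le> B \<Longrightarrow> 0 \<le> t \<Longrightarrow> t \<le> B \<Longrightarrow> \<bar>p s - p t\<bar> \<le> \<Lambda> * \<bar>s - t\<bar>"
proof -
  obtain K where K: "K > 0" "\<And>s. 0 \<le> s \<Longrightarrow> s \<le> B \<Longrightarrow> \<bar>W' s\<bar> \<le> K * \<bar>s - 1\<bar>"
    using W'_lipschitz[OF assms] by metis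
  obtain c0 where c0: "c0 > 0" "\<And>s. 0 \<le> s \<Longrightarrow> s \<le> B \<Longrightarrow> W s \<ge> c0 * (s - 1)\<^sup>2"
    using W_coercive[OF assms] by metis
  define c where "c = sqrt (2 * c0)"
  have c: "c > 0" using c0 by (simp add: c_def)
  have low: "c * \<bar>s - 1\<bar> \<le> \<bar>p s\<bar>" if "0 \<le> s" "s \<le> B" for s
  proof -
    have "sqrt (2 * (c0 * (s-1)\<^sup>2)) \<le> sqrt (2 * W s)"
      using c0(2)[OF that] by simp
    then show ?thesis by (simp add: abs_p c_def real_sqrt_mult)
  qed
  define \<Lambda> where "\<Lambda> = K / c"
  have \<Lambda>: "\<Lambda> > 0" using K c by (simp add: \<Lambda>_def)
  have der: "\<bar>W' s / p s\<bar> \<le> \<Lambda>" if "0 \<le> s" "s \<le> B" "s \<noteq> 1" for s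
  proof -
    have "\<bar>p s\<bar> > 0" using low[OF that(1,2)] c that(3) 
      by (smt (verit) mult_pos_pos)
    moreover have "\<bar>W' s\<bar> * c \<le> K * \<bar>s - 1\<bar> * c" using K(2)[OF that(1,2)] c by (intro mult_right_mono) auto
    moreover have "K * (c * \<bar>s - 1\<bar>) \<le> K * \<bar>p s\<bar>" using low[OF that(1,2)] K by (intro mult_left_mono) auto
    ultimately have "\<bar>W' s\<bar> * c \<le> K * \<bar>p s\<bar>" "\<bar>p s\<bar> > 0" by (simp_all add: mult_ac)
    then show ?thesis using c by (simp add: \<Lambda>_def abs_divide divide_le_eq field_simps)
  qed
  have seg: "\<bar>p s - p t\<bar> \<le> \<Lambda> * \<bar>s - t\<bar>" 
    if "0 \<le> s" "s < t" "t \<le> B" "t \<le> 1 \<or> 1 \<le> s" for s t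
  proof -
    have d: "\<And>x. s < x \<Longrightarrow> x < t \<Longrightarrow> (p has_real_derivative W' x / p x) (at x)"
      using that by (intro p_deriv) auto
    obtain l z where z: "s < z" "z < t" "(p has_real_derivative l) (at z)" "p t - p s = (t - s) * l"
      using MVT[OF \<open>s < t\<close> continuous_on_p] d real_differentiable_def by blast
    have "l = W' z / p z" using d[OF z(1,2)] z(3) DERIV_unique by blast
    then have "\<bar>l\<bar> \<le> \<Lambda>" using der[of z] z that by auto
    then have "(t - s) * \<bar>l\<bar> \<le> (t - s) * \<Lambda>" using that by (intro mult_left_mono) auto
    then show ?thesis using z(4) that by (simp add: abs_minus_commute[of "p s"] abs_mult mult.commute)
  qed
  have ord: "\<bar>p s - p t\<bar> \<le> \<Lambda> * \<bar>s - t\<bar>" if "0 \<le> s" "s < t" "t \<le> B" for s t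
  proof (cases "t \<le> 1 \<or> 1 \<le> s")
    case True then show ?thesis using seg that by blast
  next
    case False
    then have "\<bar>p s - p 1\<bar> \<le> \<Lambda> * \<bar>s - 1\<bar>" "\<bar>p 1 - p t\<bar> \<le> \<Lambda> * \<bar>1 - t\<bar>"
      using seg[of s 1] seg[of 1 t] that by auto
    moreover have "\<Lambda> * \<bar>s - 1\<bar> + \<Lambda> * \<bar>1 - t\<bar> = \<Lambda> * \<bar>s - t\<bar>" using False
      by (simp add: algebra_simps abs_if)
    ultimately show ?thesis by linarith
  qed
  have lip: "\<bar>p s - p t\<bar> \<le> \<Lambda> * \<bar>s - t\<bar>" if "0 \<le> s" "s \<le> B" "0 \<le> t" "t \<le> B" for s t
  proof (cases s t rule: linorder_cases)
    case less then show ?thesis using ord that by blast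
  next
    case greater then show ?thesis using ord[of t s] that by (simp add: abs_minus_commute)
  qed simp
  show ?thesis using that[OF c \<Lambda> low lip] .
qed

text \<open>Close to the well the slope of p is at most -c2. If s is far from 1, the sign of p at s
  and |p(s)| >= c1 |s - 1| give contraction towards 1; moving the base point from 1 to t costs terms
  proportional to \<eta>.\<close>

lemma p_contracts_near_one:
  assumes "B \<ge> 2"
  obtains \<delta> c where "0 < \<delta>" "\<delta> \<le> 1" "0 < c"
    "\<And>s t. 0 \<le> s \<Longrightarrow> s \<le> B \<Longrightarrow> 1 - \<delta> \<le> t \<Longrightarrow> t \<le> 1 \<Longrightarrow> (p s - p t) * (s - t) \<le> - c * (s - t)\<^sup>2"
proof -
  obtain c1 \<Lambda> where c1: "c1 > 0" and \<Lambda>: "\<Lambda> > 0"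
    and low: "\<And>s. 0 \<le> s \<Longrightarrow> s \<le> B \<Longrightarrow> c1 * \<bar>s - 1\<bar> \<le> \<bar>p s\<bar>"
    and lip: "\<And>s t. 0 \<le> s \<Longrightarrow> s \<le> B \<Longrightarrow> 0 \<le> t \<Longrightarrow> t \<le> B \<Longrightarrow> \<bar>p s - p t\<bar> \<le> \<Lambda> * \<bar>s - t\<bar>"
    using p_bounds[OF assms] by blast
  obtain \<delta> m where \<delta>: "0 < \<delta>" "\<delta> \<le> 1" "0 < m"
    "\<And>s. \<bar>s - 1\<bar> \<le> \<delta> \<Longrightarrow> W' s * (s - 1) \<ge> m * (s - 1)\<^sup>2"
    using W'_near_one by metis
  define c2 where "c2 = m / \<Lambda>"
  have c2: "c2 > 0" using \<delta> \<Lambda> by (simp add: c2_def)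
  have der: "W' s / p s \<le> - c2" if "\<bar>s - 1\<bar> \<le> \<delta>" "s \<noteq> 1" for s
  proof -
    have s: "0 \<le> s" "s \<le> B" using that \<delta> assms by auto
    have pz: "\<bar>p s\<bar> > 0" using low[OF s] c1 that(2) by (smt (verit) mult_pos_pos)
    have up: "\<bar>p s\<bar> \<le> \<Lambda> * \<bar>s - 1\<bar>" using lip[OF s, of 1] assms by simp
    have W1: "m * \<bar>s - 1\<bar> \<le> W' s * sgn (s - 1)"
    proof -
      have "m * \<bar>s-1\<bar> * \<bar>s-1\<bar> \<le> (W' s * sgn (s-1)) * \<bar>s-1\<bar>"
        using \<delta>(4)[OF that(1)] that(2) by (auto simp: power2_eq_square sgn_if abs_if algebra_simps split: if_splits)
      then show ?thesis using that(2) by simp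
    qed
    have sg: "p s = - sgn (s - 1) * \<bar>p s\<bar>"
      using p_sign[OF s(1)] that(2) by (auto simp: sgn_if abs_if split: if_splits)
    have "m * \<bar>p s\<bar> \<le> m * (\<Lambda> * \<bar>s - 1\<bar>)" using up \<delta> by (intro mult_left_mono) auto
    also have "\<dots> = \<Lambda> * (m * \<bar>s - 1\<bar>)" by simp
    also have "\<dots> \<le> \<Lambda> * (W' s * sgn (s-1))" using W1 \<Lambda> by (intro mult_left_mono) auto
    finally have "c2 \<le> W' s * sgn (s-1) / \<bar>p s\<bar>"
      using pz \<Lambda> by (simp add: c2_def field_simps)
    moreover have "W' s * sgn (s-1) / \<bar>p s\<bar> = - (W' s / p s)"
      using sg that(2) pz by (auto simp: sgn_if abs_if split: if_splits)
    ultimately show ?thesis by linarith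
  qed
  have seg: "p t - p s \<le> - c2 * (t - s)"
    if "1 - \<delta> \<le> s" "s < t" "t \<le> 1 + \<delta>" "t \<le> 1 \<or> 1 \<le> s" for s t
  proof -
    have d: "\<And>x. s < x \<Longrightarrow> x < t \<Longrightarrow> (p has_real_derivative W' x / p x) (at x)"
      using that \<delta> by (intro p_deriv) auto
    obtain l z where z: "s < z" "z < t" "(p has_real_derivative l) (at z)" "p t - p s = (t - s) * l"
      using MVT[OF \<open>s < t\<close> continuous_on_p] d real_differentiable_def by blast
    have "l = W' z / p z" using d[OF z(1,2)] z(3) DERIV_unique by blast
    then have "l \<le> - c2" using der[of z] z that by auto
    then have "(t - s) * l \<le> (t - s) * (- c2)" using that by (intro mult_left_mono) auto
    then show ?thesis using z(4) by (simp add: mult.commute)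
  qed
  have ord: "p t - p s \<le> - c2 * (t - s)" if "1 - \<delta> \<le> s" "s < t" "t \<le> 1 + \<delta>" for s t
  proof (cases "t \<le> 1 \<or> 1 \<le> s")
    case True then show ?thesis using seg that by blast
  next
    case False
    then have "p 1 - p s \<le> - c2 * (1 - s)" "p t - p 1 \<le> - c2 * (t - 1)"
      using seg[of s 1] seg[of 1 t] that \<delta> by auto
    then show ?thesis by (simp add: algebra_simps)
  qed
  \<comment> \<open>Moving the base point costs at most 3 \<Lambda> \<eta> |s - 1|. Since |s - 1| >
    \<delta> in that case, this choice makes the cost at most half of c1 (s - 1)^2. The fraction c1
    / 8 in \<open>c\<close> is the remaining half divided by 4, because (s - t)^2 <= 4 (s -
    1)^2.\<close>
  define \<eta> where "\<eta> = min \<delta> (c1 * \<delta> / (6 * \<Lambda>))"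
  define c where "c = min c2 (c1 / 8)"
  have \<eta>: "0 < \<eta>" "\<eta> \<le> \<delta>" "\<eta> \<le> 1" "6 * \<Lambda> * \<eta> \<le> c1 * \<delta>"
  proof -
    have "\<eta> \<le> c1 * \<delta> / (6 * \<Lambda>)" by (simp add: \<eta>_def)
    then show "6 * \<Lambda> * \<eta> \<le> c1 * \<delta>" using \<Lambda> by (simp add: field_simps)
  qed (use \<delta> c1 \<Lambda> in \<open>auto simp: \<eta>_def\<close>)
  have c: "0 < c" "c \<le> c2" "c \<le> c1 / 8" using c1 c2 by (auto simp: c_def)
  have main: "(p s - p t) * (s - t) \<le> - c * (s - t)\<^sup>2" if s: "0 \<le> s" "s \<le> B" and t: "1 - \<eta> \<le> t" "t \<le> 1" for s t
  proof (cases "\<bar>s - 1\<bar> \<le> \<delta>")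
    case True
    have "(p s - p t) * (s - t) \<le> - c2 * (s - t)\<^sup>2"
    proof (cases s t rule: linorder_cases)
      case less
      then have "(p t - p s) * (t - s) \<le> (- c2 * (t - s)) * (t - s)"
        using ord[of s t] True t \<delta> \<eta> by (intro mult_right_mono) auto
      then show ?thesis by (simp add: power2_eq_square algebra_simps)
    next
      case greater
      then have "(p s - p t) * (s - t) \<le> (- c2 * (s - t)) * (s - t)"
        using ord[of t s] True t \<delta> \<eta> by (intro mult_right_mono) auto
      then show ?thesis by (simp add: power2_eq_square algebra_simps)
    qed simp
    also have "\<dots> \<le> - c * (s - t)\<^sup>2" using c by (intro mult_right_mono) auto
    finally show ?thesis .
  next
    case False
    let ?x = "\<bar>s - 1\<bar>"
    have ps: "p s * (s - 1) \<le> - c1 * ?x\<^sup>2"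
    proof -
      have "p s * (s - 1) = - \<bar>p s\<bar> * ?x"
        using p_sign[OF s(1)] by (cases "s \<le> 1") (auto simp: abs_if algebra_simps)
      moreover have "c1 * ?x * ?x \<le> \<bar>p s\<bar> * ?x" using low[OF s] by (intro mult_right_mono) auto
      ultimately show ?thesis by (simp add: power2_eq_square)
    qed
    have pt: "\<bar>p t\<bar> \<le> \<Lambda> * \<eta>"
    proof -
      have "\<bar>p t\<bar> \<le> \<Lambda> * \<bar>t - 1\<bar>" using lip[of t 1] t \<eta> assms by auto
      also have "\<dots> \<le> \<Lambda> * \<eta>" using t \<Lambda> by (intro mult_left_mono) auto
      finally show ?thesis .
    qed
    have ps2: "\<bar>p s\<bar> \<le> \<Lambda> * ?x" using lip[OF s, of 1] assms by simp
    have st: "\<bar>s - t\<bar> \<le> 2 * ?x" 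
    proof -
      have 1: "\<bar>s - t\<bar> \<le> ?x + (1 - t)" using t by auto
      have "1 - t \<le> \<eta>" using t by simp
      also have "\<eta> \<le> \<delta>" by (rule \<eta>(2))
      also have "\<delta> \<le> ?x" using False by simp
      finally show ?thesis using 1 by simp
    qed
    have a: "p s * (1 - t) \<le> \<Lambda> * ?x * \<eta>"
    proof -
      have "\<bar>p s\<bar> * \<bar>1 - t\<bar> \<le> (\<Lambda> * ?x) * \<eta>" using ps2 t \<Lambda> by (intro mult_mono) auto
      then show ?thesis by (metis abs_ge_self abs_mult order_trans)
    qed
    have b: "- p t * (s - t) \<le> (\<Lambda> * \<eta>) * (2 * ?x)"
    proof -
      have "\<bar>p t\<bar> * \<bar>s - t\<bar> \<le> (\<Lambda> * \<eta>) * (2 * ?x)" 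
        by (rule mult_mono[OF pt st]) (use \<Lambda> \<eta>(1) in simp_all)
      moreover have "- p t * (s - t) \<le> \<bar>p t\<bar> * \<bar>s - t\<bar>"
        by (metis abs_ge_minus_self abs_mult minus_mult_left)
      ultimately show ?thesis by (rule order_trans[rotated])
    qed
    have "(p s - p t) * (s - t) = p s * (s - 1) + p s * (1 - t) + - p t * (s - t)"
      by (simp add: algebra_simps)
    also have "\<dots> \<le> - c1 * ?x\<^sup>2 + 3 * \<Lambda> * \<eta> * ?x"
      using ps a b by (simp add: algebra_simps)
    also have "\<dots> \<le> - (c1 / 2) * ?x\<^sup>2"
    proof -
      have "6 * \<Lambda> * \<eta> * ?x \<le> c1 * \<delta> * ?x" using \<eta> by (intro mult_right_mono) auto
      also have "\<dots> \<le> c1 * ?x * ?x" using False c1 by (intro mult_right_mono mult_left_mono) auto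
      finally show ?thesis by (simp add: power2_eq_square)
    qed
    also have "\<dots> \<le> - c * (s - t)\<^sup>2"
    proof -
      have "(s - t)\<^sup>2 \<le> (2 * ?x)\<^sup>2" using power_mono[OF st, of 2] by simp
      then have "c * (s - t)\<^sup>2 \<le> (c1/8) * (4 * ?x\<^sup>2)" using c by (intro mult_mono) auto
      then show ?thesis by simp
    qed
    finally show ?thesis .
  qed
  show ?thesis using that[OF \<eta>(1,3) c(1) main] .
qed

text \<open>Far from the well only the Lipschitz bound survives. Its deficit is written as a
  multiple of 1 - t because p(t) >= c1 (1 - t) dominates that quantity; this is what lets an
  exponential weight absorb it.\<close>

lemma p_one_sided_lipschitz:
  assumes "B \<ge> 2"
  obtains c \<kappa> c1 \<Lambda> where "c > 0" "\<kappa> > 0" "c1 > 0" "\<Lambda> > 0"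
    "\<And>t. 0 \<le> t \<Longrightarrow> t \<le> 1 \<Longrightarrow> c1 * (1 - t) \<le> p t"
    "\<And>s t. 0 \<le> s \<Longrightarrow> s \<le> B \<Longrightarrow> 0 \<le> t \<Longrightarrow> t \<le> B \<Longrightarrow> \<bar>p s - p t\<bar> \<le> \<Lambda> * \<bar>s - t\<bar>"
    "\<And>s t. 0 \<le> s \<Longrightarrow> s \<le> B \<Longrightarrow> 0 \<le> t \<Longrightarrow> t \<le> 1 \<Longrightarrow>
       (p s - p t) * (s - t) \<le> (- c + \<kappa> * (1 - t)) * (s - t)\<^sup>2"
proof -
  obtain c1 \<Lambda> where c1: "c1 > 0" and \<Lambda>: "\<Lambda> > 0"
    and low: "\<And>s. 0 \<le> s \<Longrightarrow> s \<le> B \<Longrightarrow> c1 * \<bar>s - 1\<bar> \<le> \<bar>p s\<bar>"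
    and lip: "\<And>s t. 0 \<le> s \<Longrightarrow> s \<le> B \<Longrightarrow> 0 \<le> t \<Longrightarrow> t \<le> B \<Longrightarrow> \<bar>p s - p t\<bar> \<le> \<Lambda> * \<bar>s - t\<bar>"
    using p_bounds[OF assms] by blast
  obtain \<delta> c where \<delta>: "0 < \<delta>" "\<delta> \<le> 1" "0 < c"
    "\<And>s t. 0 \<le> s \<Longrightarrow> s \<le> B \<Longrightarrow> 1 - \<delta> \<le> t \<Longrightarrow> t \<le> 1 \<Longrightarrow> (p s - p t) * (s - t) \<le> - c * (s - t)\<^sup>2"
    using p_contracts_near_one[OF assms] by blast
  \<comment> \<open>For 1 - t > \<delta> this makes \<kappa> (1 - t) at least \<Lambda> + c, so the
    plain Lipschitz bound suffices.\<close>
  define \<kappa> where "\<kappa> = (\<Lambda> + c) / \<delta>"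
  have \<kappa>: "\<kappa> > 0" using \<delta> \<Lambda> by (simp add: \<kappa>_def)
  have 1: "c1 * (1 - t) \<le> p t" if "0 \<le> t" "t \<le> 1" for t
    using low[of t] p_sign(1)[of t] that assms by auto
  have 2: "(p s - p t) * (s - t) \<le> (- c + \<kappa> * (1 - t)) * (s - t)\<^sup>2"
    if s: "0 \<le> s" "s \<le> B" and t: "0 \<le> t" "t \<le> 1" for s t
  proof (cases "1 - \<delta> \<le> t")
    case True
    have "(p s - p t) * (s - t) \<le> - c * (s - t)\<^sup>2" using \<delta>(4) s t True by blast
    also have "\<dots> \<le> (- c + \<kappa> * (1 - t)) * (s - t)\<^sup>2" using \<kappa> t by (intro mult_right_mono) auto
    finally show ?thesis .
  next
    case False
    have "(p s - p t) * (s - t) \<le> \<bar>p s - p t\<bar> * \<bar>s - t\<bar>" by (metis abs_ge_self abs_mult)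
    also have "\<dots> \<le> (\<Lambda> * \<bar>s - t\<bar>) * \<bar>s - t\<bar>" using lip[of s t] s t assms by (intro mult_right_mono) auto
    also have "\<dots> = \<Lambda> * (s - t)\<^sup>2" by (simp add: power2_eq_square)
    also have "\<dots> \<le> (- c + \<kappa> * (1 - t)) * (s - t)\<^sup>2"
    proof (rule mult_right_mono)
      have "\<Lambda> + c = \<kappa> * \<delta>" using \<delta> by (simp add: \<kappa>_def)
      also have "\<dots> \<le> \<kappa> * (1 - t)" using False \<kappa> by (intro mult_left_mono) auto
      finally show "\<Lambda> \<le> - c + \<kappa> * (1 - t)" by simp
    qed simp
    finally show ?thesis .
  qed
  show ?thesis using that[OF \<delta>(3) \<kappa> c1 \<Lambda> 1 lip 2] .
qed

end

section \<open>The one-dimensional profile\<close>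

context double_well begin

context
  fixes v :: "real \<Rightarrow> real"
  assumes v1: "\<And>s. (v has_real_derivative deriv v s) (at s)"
    and v2: "\<And>s. (deriv v has_real_derivative W' (v s)) (at s)"
    and v_odd: "\<And>s. v (- s) = - v s"
    and v_lim: "(v \<longlongrightarrow> 1) at_top"
begin

lemma profile_zero: "v 0 = 0"
  using v_odd[of 0] by simp

text \<open>The energy (v')^2 - 2 W(v) is conserved, and its value is read off at infinity: as v
  converges, the mean value theorem on unit intervals gives points tending to infinity at which v'
  tends to 0, while W(v) tends to \<open>W 1\<close>.\<close>

lemma profile_energy: "(deriv v s)\<^sup>2 = 2 * W (v s)"
proof -
  let ?E = "\<lambda>s. (deriv v s)\<^sup>2 - 2 * W (v s)"
  have "(?E has_real_derivative 0) (at s)" for s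
  proof -
    have "((\<lambda>s. W (v s)) has_real_derivative W' (v s) * deriv v s) (at s)"
      by (rule DERIV_chain2[OF W_deriv v1])
    then show ?thesis by (auto intro!: derivative_eq_intros v2)
  qed
  then have const: "?E s = ?E t" for s t
    using DERIV_isconst_all[of ?E s t] by blast
  have W_lim: "((\<lambda>s. W (v s)) \<longlongrightarrow> 0) at_top"
    using isCont_tendsto_compose[OF isCont_W v_lim] by (simp add: W_one)
  have "\<forall>n::nat. \<exists>z. real n < z \<and> v (real n + 1) - v (real n) = deriv v z"
    using MVT2[of "real n" "real n + 1" v "deriv v" for n] v1 by fastforce
  then obtain z where z: "\<And>n::nat. real n < z n" "\<And>n::nat. v (real n + 1) - v (real n) = deriv v (z n)"
    by metis
  have zt: "filterlim z at_top sequentially"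
    by (rule filterlim_at_top_mono[OF filterlim_real_sequentially]) (simp add: z(1) less_imp_le)
  have t1: "filterlim (\<lambda>n. real n + 1) at_top sequentially"
    by (rule filterlim_at_top_mono[OF filterlim_real_sequentially]) simp
  have "(\<lambda>n. v (real n + 1) - v (real n)) \<longlonglongrightarrow> 1 - 1"
    by (intro tendsto_diff filterlim_compose[OF v_lim] t1 filterlim_real_sequentially)
  then have "(\<lambda>n. deriv v (z n)) \<longlonglongrightarrow> 0" by (simp add: z(2))
  then have "(\<lambda>n. ?E (z n)) \<longlonglongrightarrow> 0\<^sup>2 - 2 * 0"
    by (intro tendsto_intros filterlim_compose[OF W_lim zt])
  moreover have "(\<lambda>n. ?E (z n)) = (\<lambda>n. ?E s)" using const by blast
  ultimately have "(\<lambda>n::nat. ?E s) \<longlonglongrightarrow> 0" by simp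
  then show ?thesis by (simp add: LIMSEQ_const_iff)
qed

lemma profile_continuous: "continuous_on S v"
  using v1 DERIV_isCont continuous_at_imp_continuous_on by blast

text \<open>Near the wells the energy identity is a linear differential inequality for \<open>1 - v\<^sup>2\<close>,
  so the profile cannot reach them in finite time.\<close>
lemma profile_off_wells:
  assumes "b \<ge> 0" shows "(v b)\<^sup>2 \<noteq> 1"
proof
  assume b: "(v b)\<^sup>2 = 1"
  have "compact (v ` {0..b})"
    using profile_continuous by (intro compact_continuous_image) auto
  then obtain B0 where "\<And>y. y \<in> v ` {0..b} \<Longrightarrow> norm y \<le> B0"
    using compact_imp_bounded bounded_iff by metis
  then have B0: "\<And>t. t \<in> {0..b} \<Longrightarrow> \<bar>v t\<bar> \<le> B0" by auto
  define B where "B = max 2 B0"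
  have B: "B \<ge> 2" "\<And>t. t \<in> {0..b} \<Longrightarrow> \<bar>v t\<bar> \<le> B"
    using B0 by (auto simp: B_def le_max_iff_disj)
  obtain K where K: "K > 0" "\<And>s. 0 \<le> s \<Longrightarrow> s \<le> B \<Longrightarrow> W s \<le> K * (s - 1)\<^sup>2"
    using W'_lipschitz[OF B(1)] by metis
  define k where "k = sqrt (2 * K)"
  have k: "k > 0" using K by (simp add: k_def)
  have dv: "\<bar>deriv v t\<bar> \<le> k * \<bar>\<bar>v t\<bar> - 1\<bar>" if t: "t \<in> {0..b}" for t
  proof -
    have "W (v t) = W \<bar>v t\<bar>" by (simp add: abs_if W_even)
    then have "W (v t) \<le> K * (\<bar>v t\<bar> - 1)\<^sup>2" using K(2)[of "\<bar>v t\<bar>"] B(2)[OF t] by simp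
    then have "sqrt ((deriv v t)\<^sup>2) \<le> sqrt (2 * (K * (\<bar>v t\<bar> - 1)\<^sup>2))"
      unfolding profile_energy by simp
    then show ?thesis by (simp add: k_def real_sqrt_mult)
  qed
  let ?y = "\<lambda>t. 1 - (v t)\<^sup>2"
  \<comment> \<open>Integrating factor: the derivative of y^2 is -4 y v v', and |v v'| <= k |y|, so
    y^2 decays at most at rate 4 k. It equals 1 at time 0 and would have to be 0 at
    \<open>b\<close>.\<close>
  let ?g = "\<lambda>t. (?y t)\<^sup>2 * exp (4 * k * t)"
  have "?g 0 \<le> ?g b"
  proof (rule DERIV_nonneg_imp_nondecreasing[OF assms])
    fix t assume "0 \<le> t" "t \<le> b"
    then have d: "\<bar>deriv v t\<bar> \<le> k * \<bar>\<bar>v t\<bar> - 1\<bar>" using dv by auto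
    have "(?g has_real_derivative (4 * k * (?y t)\<^sup>2 - 4 * (?y t * (v t * deriv v t))) * exp (4 * k * t)) (at t)"
      by (auto intro!: derivative_eq_intros v1 simp: algebra_simps power2_eq_square)
    moreover have "4 * k * (?y t)\<^sup>2 - 4 * (?y t * (v t * deriv v t)) \<ge> 0"
    proof -
      have y: "\<bar>?y t\<bar> = \<bar>\<bar>v t\<bar> - 1\<bar> * (1 + \<bar>v t\<bar>)"
      proof -
        have "?y t = (1 - \<bar>v t\<bar>) * (1 + \<bar>v t\<bar>)" by (simp add: algebra_simps power2_eq_square)
        then show ?thesis by (simp add: abs_mult abs_minus_commute)
      qed
      have "\<bar>v t * deriv v t\<bar> \<le> (1 + \<bar>v t\<bar>) * (k * \<bar>\<bar>v t\<bar> - 1\<bar>)"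
        unfolding abs_mult using d by (intro mult_mono) auto
      also have "\<dots> = k * \<bar>?y t\<bar>" by (simp add: y)
      finally have "\<bar>?y t\<bar> * \<bar>v t * deriv v t\<bar> \<le> \<bar>?y t\<bar> * (k * \<bar>?y t\<bar>)"
        by (rule mult_left_mono) simp
      also have "\<dots> = k * (?y t)\<^sup>2" by (simp add: power2_eq_square abs_mult_self_eq mult.left_commute[of _ k])
      finally have "?y t * (v t * deriv v t) \<le> k * (?y t)\<^sup>2"
        by (metis abs_ge_self abs_mult order_trans)
      then show ?thesis by simp
    qed
    ultimately show "\<exists>y. (?g has_real_derivative y) (at t) \<and> 0 \<le> y"
      by (intro exI conjI) (assumption, simp)
  qed
  then show False using b profile_zero by simp
qed

lemma profile_abs_less_one: "\<bar>v s\<bar> < 1"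
proof -
  have *: "\<bar>v t\<bar> < 1" if t: "t \<ge> 0" for t
  proof (rule ccontr)
    assume "\<not> \<bar>v t\<bar> < 1"
    then have "\<exists>x\<ge>0. x \<le> t \<and> \<bar>v x\<bar> = 1"
      using IVT'[of "\<lambda>s. \<bar>v s\<bar>" 0 1 t] profile_zero t
      by (auto intro!: continuous_intros profile_continuous)
    then obtain x where "x \<ge> 0" "\<bar>v x\<bar> = 1" by blast
    then show False using profile_off_wells[of x] by (metis power2_abs one_power2)
  qed
  show ?thesis using *[of s] *[of "-s"] v_odd[of s] by (cases "s \<ge> 0") auto
qed

text \<open>By the energy identity v' vanishes only where W(v) does, which |v| < 1 excludes. So v'
  has one sign, and the negative one contradicts v(0) = 0 together with the limit 1.\<close>

lemma profile_deriv_pos: "deriv v s > 0"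
proof -
  have nz: "deriv v t \<noteq> 0" for t
  proof -
    have "W (v t) = W \<bar>v t\<bar>" by (simp add: abs_if W_even)
    then have "W (v t) > 0" using W_pos[of "\<bar>v t\<bar>"] profile_abs_less_one[of t] by auto
    then show ?thesis using profile_energy[of t] by auto
  qed
  have cont: "continuous_on S (deriv v)" for S
    using v2 DERIV_isCont continuous_at_imp_continuous_on by blast
  show ?thesis
  proof (rule ccontr)
    assume neg: "\<not> deriv v s > 0"
    have all_neg: "deriv v t < 0" for t
    proof (rule ccontr)
      assume "\<not> deriv v t < 0"
      then have "\<exists>x. deriv v x = 0"
        using IVT'[of "deriv v" s 0 t] IVT2'[of "deriv v" s 0 t] neg cont
        by (cases "s \<le> t") fastforce+
      then show False using nz by blast
    qed
    have "v t \<le> 0" if "t \<ge> 0" for t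
      using DERIV_nonpos_imp_nonincreasing[of 0 t v] that v1 all_neg profile_zero by (metis less_imp_le)
    then have "\<forall>\<^sub>F t in at_top. v t \<le> 0"
      by (intro eventually_at_top_linorderI[of 0])
    then have "1 \<le> (0::real)" by (rule tendsto_upperbound[OF v_lim]) simp
    then show False by simp
  qed
qed

lemma profile_ode: "deriv v s = p (v s)"
proof -
  have "p (v s) \<ge> 0"
    using profile_abs_less_one[of s] W_nonneg[of "v s"] by (auto simp: well_root_def)
  moreover have "(deriv v s)\<^sup>2 = (p (v s))\<^sup>2" by (simp add: profile_energy p_sq)
  ultimately show ?thesis using profile_deriv_pos[of s] by (metis less_imp_le power2_eq_imp_eq)
qed

lemma profile_nonneg: "s \<ge> 0 \<Longrightarrow> v s \<ge> 0"
  using DERIV_nonneg_imp_nondecreasing[of 0 s v] v1 profile_deriv_pos profile_zero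
  by (metis less_imp_le)

end
end

section \<open>Test functions and weak gradients\<close>

text \<open>Fubini and the fundamental theorem of calculus on each row. It serves twice: for
  integration by parts with test functions, and to show that the calibrating terms integrate to
  zero.\<close>

lemma integral_deriv_fst_zero:
  fixes g :: "real \<times> real \<Rightarrow> real"
  assumes cont: "continuous_on (cbox (a, c) (b, d)) g" and "a \<le> b"
    and der: "\<And>x y. a \<le> x \<Longrightarrow> x \<le> b \<Longrightarrow> c \<le> y \<Longrightarrow> y \<le> d \<Longrightarrow>
      ((\<lambda>t. f (t, y)) has_real_derivative g (x, y)) (at x within {a..b})"
    and eq: "\<And>y. c \<le> y \<Longrightarrow> y \<le> d \<Longrightarrow> f (a, y) = f (b, y)"
  shows "integral (cbox (a, c) (b, d)) g = 0"
proof -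
  have "integral (cbox (a, c) (b, d)) g = integral (cbox a b) (\<lambda>x. integral (cbox c d) (\<lambda>y. g (x, y)))"
    by (rule integral_prod_continuous[OF cont])
  also have "\<dots> = integral (cbox c d) (\<lambda>y. integral (cbox a b) (\<lambda>x. g (x, y)))"
    by (rule integral_swap_continuous) (use cont in simp)
  also have "\<dots> = integral (cbox c d) (\<lambda>y. 0)"
  proof (rule integral_cong)
    fix y assume "y \<in> cbox c d"
    then have y: "c \<le> y" "y \<le> d" by auto
    have "((\<lambda>x. g (x, y)) has_integral (f (b, y) - f (a, y))) {a..b}"
      using der[OF _ _ y] \<open>a \<le> b\<close>
      by (intro fundamental_theorem_of_calculus) (auto simp: has_real_derivative_iff_has_vector_derivative)
    then show "integral (cbox a b) (\<lambda>x. g (x, y)) = 0"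
      using eq[OF y] by (simp add: integral_unique)
  qed
  finally show ?thesis by simp
qed

lemma integral_deriv_snd_zero:
  fixes g :: "real \<times> real \<Rightarrow> real"
  assumes cont: "continuous_on (cbox (a, c) (b, d)) g" and "c \<le> d"
    and der: "\<And>x y. a \<le> x \<Longrightarrow> x \<le> b \<Longrightarrow> c \<le> y \<Longrightarrow> y \<le> d \<Longrightarrow>
      ((\<lambda>t. f (x, t)) has_real_derivative g (x, y)) (at y within {c..d})"
    and eq: "\<And>x. a \<le> x \<Longrightarrow> x \<le> b \<Longrightarrow> f (x, c) = f (x, d)"
  shows "integral (cbox (a, c) (b, d)) g = 0"
proof -
  have "integral (cbox (a, c) (b, d)) g = integral (cbox a b) (\<lambda>x. integral (cbox c d) (\<lambda>y. g (x, y)))"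
    by (rule integral_prod_continuous[OF cont])
  also have "\<dots> = integral (cbox a b) (\<lambda>x. 0)"
  proof (rule integral_cong)
    fix x assume "x \<in> cbox a b"
    then have x: "a \<le> x" "x \<le> b" by auto
    have "((\<lambda>y. g (x, y)) has_integral (f (x, d) - f (x, c))) {c..d}"
      using der[OF x] \<open>c \<le> d\<close>
      by (intro fundamental_theorem_of_calculus) (auto simp: has_real_derivative_iff_has_vector_derivative)
    then show "integral (cbox c d) (\<lambda>y. g (x, y)) = 0"
      using eq[OF x] by (simp add: integral_unique)
  qed
  finally show ?thesis by simp
qed

text \<open>Bridge between the two integrals in play: the Lebesgue integral over the domain, in
  which the variational notions are phrased, and the gauge integral over boxes, in which the
  calculus is done.\<close>

lemma lebesgue_on_compact_support:
  fixes h :: "pt \<Rightarrow> real"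
  assumes h: "continuous_on UNIV h" "\<And>x. x \<notin> K \<Longrightarrow> h x = 0"
    and K: "K \<subseteq> A" "K \<subseteq> cbox a b" and A: "A \<in> sets lebesgue"
  shows "integrable (lebesgue_on A) h" "integral\<^sup>L (lebesgue_on A) h = integral (cbox a b) h"
proof -
  have "continuous_on (cbox a b) h" using h(1) continuous_on_subset by blast
  then have abs: "set_integrable lebesgue (cbox a b) h" by (rule absolutely_integrable_continuous)
  have eq: "(\<lambda>x. indicat_real (cbox a b) x * h x) = h" "(\<lambda>x. indicat_real A x * h x) = h"
    using h(2) K by (auto simp: indicator_def fun_eq_iff)
  show "integrable (lebesgue_on A) h"
    using abs A by (simp add: set_integrable_def integrable_restrict_space eq)
  have "integral\<^sup>L (lebesgue_on A) h = integral\<^sup>L lebesgue h"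
    using A by (simp add: integral_restrict_space eq)
  also have "\<dots> = integral (cbox a b) h"
    using set_lebesgue_integral_eq_integral(2)[OF abs] by (simp add: set_lebesgue_integral_def eq)
  finally show "integral\<^sup>L (lebesgue_on A) h = integral (cbox a b) h" .
qed

lemma test_funD:
  assumes "test_fun A f"
  shows "C1_on UNIV f" "i \<in> {1, 2} \<Longrightarrow> continuous_on UNIV (pd f i)" "continuous_on UNIV f"
    "f differentiable (at x)"
proof -
  show *: "C1_on UNIV f" using assms by (simp add: test_fun_def)
  show "i \<in> {1, 2} \<Longrightarrow> continuous_on UNIV (pd f i)" by (rule C1_onD(2)[OF *])
  show "continuous_on UNIV f" by (rule C1_onD(3)[OF *])
  show "f differentiable (at x)" by (rule C1_onD(1)[OF *]) simp
qed

lemma test_fun_support: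
  assumes "test_fun A f"
  obtains K a b where "compact K" "K \<subseteq> A" "K \<subseteq> box a b" "\<And>x. x \<notin> K \<Longrightarrow> f x = 0"
    "\<And>x i. x \<notin> K \<Longrightarrow> pd f i x = 0"
proof -
  obtain K where K: "compact K" "K \<subseteq> A" "\<And>x. x \<notin> K \<Longrightarrow> f x = 0"
    using assms by (auto simp: test_fun_def)
  obtain a where "K \<subseteq> box (- a) a"
    using bounded_subset_box_symmetric[OF compact_imp_bounded[OF K(1)]] by blast
  then show ?thesis
    by (rule that[OF K(1,2) _ K(3) pd_zero_outside[OF compact_imp_closed[OF K(1)] K(3)]])
qed

lemma test_fun_integrable:
  assumes "test_fun A f" "A \<in> sets lebesgue"
  shows "integrable (lebesgue_on A) f" "i \<in> {1, 2} \<Longrightarrow> integrable (lebesgue_on A) (pd f i)"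
    "L2_on A f" "i \<in> {1, 2} \<Longrightarrow> L2_on A (pd f i)"
proof -
  obtain K a b where K: "compact K" "K \<subseteq> A" "K \<subseteq> box a b" "\<And>x. x \<notin> K \<Longrightarrow> f x = 0"
    "\<And>x i. x \<notin> K \<Longrightarrow> pd f i x = 0"
    using test_fun_support[OF assms(1)] by metis
  have Kc: "K \<subseteq> cbox a b" using K(3) box_subset_cbox by blast
  note * = lebesgue_on_compact_support(1)[OF _ _ K(2) Kc assms(2)]
  have sq: "L2_on A h" if "continuous_on UNIV h" "\<And>x. x \<notin> K \<Longrightarrow> h x = 0" for h
    unfolding L2_on_def using that
    by (auto intro!: * borel_measurable_integrable continuous_intros)
  show "integrable (lebesgue_on A) f" "L2_on A f"
    using * sq test_funD(3)[OF assms(1)] K(4) by auto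
  show "integrable (lebesgue_on A) (pd f i)" "L2_on A (pd f i)" if "i \<in> {1, 2}"
    using * sq test_funD(2)[OF assms(1) that] K(5) by auto
qed

lemma integral_pd_test_fun:
  assumes "test_fun A f" "A \<in> sets lebesgue" "i \<in> {1, 2}"
  shows "integral\<^sup>L (lebesgue_on A) (pd f i) = 0"
proof -
  obtain K u v where K: "compact K" "K \<subseteq> A" "K \<subseteq> box u v" "\<And>x. x \<notin> K \<Longrightarrow> f x = 0"
    "\<And>x i. x \<notin> K \<Longrightarrow> pd f i x = 0"
    using test_fun_support[OF assms(1)] by metis
  have Kc: "K \<subseteq> cbox u v" using K(3) box_subset_cbox by blast
  note cont = test_funD(2)[OF assms(1,3)]
  have 1: "integral\<^sup>L (lebesgue_on A) (pd f i) = integral (cbox u v) (pd f i)"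
    by (rule lebesgue_on_compact_support(2)[OF cont K(5) K(2) Kc assms(2)])
  obtain a c b d where uv: "u = (a, c)" "v = (b, d)" by fastforce
  note sl = pd_slice[OF test_funD(4)[OF assms(1)]]
  have bd: "f (x, y) = 0" if "\<not> (a < x \<and> x < b \<and> c < y \<and> y < d)" for x y
  proof (rule K(4))
    show "(x, y) \<notin> K" using that K(3) uv by (auto simp: box_prod)
  qed
  have "integral (cbox u v) (pd f i) = 0"
  proof (cases "a \<le> b \<and> c \<le> d")
    case False
    then have "cbox u v = {}" by (auto simp: uv cbox_Pair_eq)
    then show ?thesis by simp
  next
    case True
    have cont': "continuous_on (cbox (a, c) (b, d)) (pd f i)"
      using cont continuous_on_subset by blast
    show ?thesis
    proof (cases "i = 1")
      case i: True
      show ?thesis unfolding uv i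
      proof (rule integral_deriv_fst_zero[where f = f])
        show "((\<lambda>t. f (t, y)) has_real_derivative pd f 1 (x, y)) (at x within {a..b})" for x y
          by (rule has_field_derivative_at_within[OF sl(1)])
        show "f (a, y) = f (b, y)" for y using bd[of a y] bd[of b y] by simp
      qed (use True cont' i in simp_all)
    next
      case False
      then have i: "i = 2" using assms(3) by auto
      show ?thesis unfolding uv i
      proof (rule integral_deriv_snd_zero[where f = f])
        show "((\<lambda>t. f (x, t)) has_real_derivative pd f 2 (x, y)) (at y within {c..d})" for x y
          by (rule has_field_derivative_at_within[OF sl(2)])
        show "f (x, c) = f (x, d)" for x using bd[of x c] bd[of x d] by simp
      qed (use True cont' i in simp_all)
    qed
  qed
  with 1 show ?thesis by simp
qed

lemma test_fun_add: 
  assumes "test_fun A f" "test_fun A g" shows "test_fun A (\<lambda>x. f x + g x)"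
proof -
  obtain K L where K: "compact K" "K \<subseteq> A" "\<And>x. x \<notin> K \<Longrightarrow> f x = 0"
    and L: "compact L" "L \<subseteq> A" "\<And>x. x \<notin> L \<Longrightarrow> g x = 0"
    using assms by (auto simp: test_fun_def)
  have "compact (K \<union> L)" using K L by (simp add: compact_Un)
  moreover have "\<forall>x. x \<notin> K \<union> L \<longrightarrow> f x + g x = 0" using K L by simp
  moreover have "K \<union> L \<subseteq> A" using K L by simp
  ultimately show ?thesis
    using C1_on_add[OF test_funD(1)[OF assms(1)] test_funD(1)[OF assms(2)]] unfolding test_fun_def by blast
qed

lemma test_fun_mult:
  assumes "open A" "C1_on A u" "test_fun A f" shows "test_fun A (\<lambda>x. u x * f x)"
proof -
  obtain K where K: "compact K" "K \<subseteq> A" "\<And>x. x \<notin> K \<Longrightarrow> f x = 0"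
    using assms by (auto simp: test_fun_def)
  have "C1_on A (\<lambda>x. u x * f x)"
    using C1_on_mult[OF assms(2)] C1_on_subset[OF test_funD(1)[OF assms(3)]] by blast
  then have "C1_on UNIV (\<lambda>x. u x * f x)"
    by (rule C1_on_UNIV_zero_extension[OF assms(1) compact_imp_closed[OF K(1)] K(2)]) (simp add: K(3))
  then show ?thesis unfolding test_fun_def using K by auto
qed

text \<open>The product of u with a test function is a test function, so the integral of its
  derivative vanishes; the product rule then splits it.\<close>

lemma integration_by_parts_test_fun:
  assumes "open A" "C1_on A u" "test_fun A f" "i \<in> {1, 2}"
  shows "(\<integral>x. u x * pd f i x \<partial>lebesgue_on A) = - (\<integral>x. pd u i x * f x \<partial>lebesgue_on A)"
    "integrable (lebesgue_on A) (\<lambda>x. u x * pd f i x)" "integrable (lebesgue_on A) (\<lambda>x. pd u i x * f x)"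
proof -
  have A: "A \<in> sets lebesgue" using assms(1) by (simp add: lmeasurable_open)
  obtain K a b where K: "compact K" "K \<subseteq> A" "K \<subseteq> box a b" "\<And>x. x \<notin> K \<Longrightarrow> f x = 0"
    "\<And>x i. x \<notin> K \<Longrightarrow> pd f i x = 0"
    using test_fun_support[OF assms(3)] by metis
  have Kc: "K \<subseteq> cbox a b" using K(3) box_subset_cbox by blast
  \<comment> \<open>Continuity inside A and vanishing off the compact \<open>K\<close> give
    continuity on the plane, whatever u does near the boundary of A.\<close>
  have cont: "continuous_on UNIV h" if "continuous_on A h" "\<And>x. x \<notin> K \<Longrightarrow> h x = 0" for h :: "pt \<Rightarrow> real"
  proof -
    have "continuous_on (- K) h" by (rule continuous_on_eq[of _ "\<lambda>x. 0"]) (use that in auto)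
    then have "continuous_on (A \<union> - K) h"
      using that assms(1) K(1) by (intro continuous_on_open_Un) (auto simp: compact_imp_closed)
    moreover have "A \<union> - K = UNIV" using K(2) by auto
    ultimately show ?thesis by simp
  qed
  have int: "integrable (lebesgue_on A) h" if "continuous_on A h" "\<And>x. x \<notin> K \<Longrightarrow> h x = 0" for h :: "pt \<Rightarrow> real"
    by (rule lebesgue_on_compact_support(1)[OF cont[OF that] that(2) K(2) Kc A]) auto
  show i1: "integrable (lebesgue_on A) (\<lambda>x. u x * pd f i x)"
    using C1_onD(3)[OF assms(2)] test_funD(2)[OF assms(3,4)] K(5)
    by (intro int continuous_intros) (auto intro: continuous_on_subset)
  show i2: "integrable (lebesgue_on A) (\<lambda>x. pd u i x * f x)"
    using C1_onD(2)[OF assms(2,4)] test_funD(3)[OF assms(3)] K(4)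
    by (intro int continuous_intros) (auto intro: continuous_on_subset)
  have "0 = (\<integral>x. pd (\<lambda>x. u x * f x) i x \<partial>lebesgue_on A)"
    using integral_pd_test_fun[OF test_fun_mult[OF assms(1-3)] A assms(4)] by simp
  also have "\<dots> = (\<integral>x. u x * pd f i x + pd u i x * f x \<partial>lebesgue_on A)"
    by (rule Bochner_Integration.integral_cong[OF refl])
       (use assms in \<open>simp add: pd_mult C1_onD(1)[OF assms(2)] test_funD(4)[OF assms(3)]\<close>)
  also have "\<dots> = (\<integral>x. u x * pd f i x \<partial>lebesgue_on A) + (\<integral>x. pd u i x * f x \<partial>lebesgue_on A)"
    using i1 i2 by simp
  finally show "(\<integral>x. u x * pd f i x \<partial>lebesgue_on A) = - (\<integral>x. pd u i x * f x \<partial>lebesgue_on A)"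
    by simp
qed

lemma L2_on_mult_integrable:
  assumes "L2_on A f" "L2_on A g" shows "integrable (lebesgue_on A) (\<lambda>x. f x * g x)"
proof (rule Bochner_Integration.integrable_bound)
  show "integrable (lebesgue_on A) (\<lambda>x. (f x)\<^sup>2 + (g x)\<^sup>2)" using assms by (simp add: L2_on_def)
  show "(\<lambda>x. f x * g x) \<in> borel_measurable (lebesgue_on A)"
    using assms unfolding L2_on_def by (intro borel_measurable_times) blast+
  have "\<bar>a * b\<bar> \<le> a\<^sup>2 + b\<^sup>2" for a b :: real
  proof -
    have "2 * (\<bar>a\<bar> * \<bar>b\<bar>) \<le> a\<^sup>2 + b\<^sup>2"
      using sum_squares_bound[of "\<bar>a\<bar>" "\<bar>b\<bar>"] by simp
    moreover have "0 \<le> \<bar>a\<bar> * \<bar>b\<bar>" by simp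
    ultimately show ?thesis unfolding abs_mult by linarith
  qed
  then show "AE x in lebesgue_on A. norm (f x * g x) \<le> norm ((f x)\<^sup>2 + (g x)\<^sup>2)"
    by (auto intro!: AE_I2)
qed

lemma L2_on_add:
  assumes "L2_on A f" "L2_on A g" shows "L2_on A (\<lambda>x. f x + g x)"
proof -
  have "integrable (lebesgue_on A) (\<lambda>x. (f x)\<^sup>2 + (g x)\<^sup>2 + 2 * (f x * g x))"
    using assms L2_on_mult_integrable[OF assms] by (simp add: L2_on_def)
  then have "integrable (lebesgue_on A) (\<lambda>x. (f x + g x)\<^sup>2)" by (simp add: power2_sum mult.assoc)
  moreover have "(\<lambda>x. f x + g x) \<in> borel_measurable (lebesgue_on A)"
    using assms unfolding L2_on_def by (intro borel_measurable_add) blast+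
  ultimately show ?thesis by (simp add: L2_on_def)
qed

text \<open>Integration by parts makes the classical gradient of f a weak one; square integrability
  lets the integrals of the sums be split.\<close>

lemma weak_grad_add_test_fun:
  assumes A: "open A" and w: "weak_grad A w G1 G2" and f: "test_fun A f"
  shows "weak_grad A (\<lambda>x. w x + f x) (\<lambda>x. G1 x + pd f 1 x) (\<lambda>x. G2 x + pd f 2 x)"
proof -
  have sA: "A \<in> sets lebesgue" using A by (simp add: lmeasurable_open)
  have L2: "L2_on A w" "L2_on A G1" "L2_on A G2" using w by (auto simp: weak_grad_def)
  have f1: "C1_on A f" using C1_on_subset[OF test_funD(1)[OF f]] by simp
  have "(\<integral>x. (w x + f x) * pd h i x \<partial>lebesgue_on A) = - (\<integral>x. (G x + pd f i x) * h x \<partial>lebesgue_on A)"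
    if h: "test_fun A h" and i: "i \<in> {1, 2}" and G: "L2_on A G"
      and eq: "(\<integral>x. w x * pd h i x \<partial>lebesgue_on A) = - (\<integral>x. G x * h x \<partial>lebesgue_on A)" for h i G
  proof -
    note ibp = integration_by_parts_test_fun[OF A f1 h i]
    have 1: "integrable (lebesgue_on A) (\<lambda>x. w x * pd h i x)" "integrable (lebesgue_on A) (\<lambda>x. G x * h x)"
      using L2_on_mult_integrable test_fun_integrable(3,4)[OF h sA] i L2 G by blast+
    show ?thesis
      using ibp 1 eq by (simp add: ring_distribs)
  qed
  from this[of _ 1 G1] this[of _ 2 G2] show ?thesis
    using w L2 test_fun_integrable(3,4)[OF f sA] by (auto simp: weak_grad_def intro!: L2_on_add)
qed

section \<open>Minimality against compactly supported odd variations\<close>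

text \<open>Energy density of u + f minus that of u, with the squared gradient of u cancelled. It
  vanishes where f and its gradient do, so it can be integrated over a box alone.\<close>

definition energy_excess :: "(real \<Rightarrow> real) \<Rightarrow> (pt \<Rightarrow> real) \<Rightarrow> (pt \<Rightarrow> real) \<Rightarrow> pt \<Rightarrow> real" where
  "energy_excess W u f x = pd u 1 x * pd f 1 x + pd u 2 x * pd f 2 x + ((pd f 1 x)\<^sup>2 + (pd f 2 x)\<^sup>2) / 2
     + (W (u x + f x) - W (u x))"

text \<open>Shifting the approximating test functions by f leaves every difference in the
  convergence integral unchanged.\<close>

lemma W120_add_test_fun:
  assumes A: "open A" and w: "W120 A w" and f: "test_fun A f"
  shows "W120 A (\<lambda>x. w x + f x)"
proof -
  obtain G1 G2 h where G: "weak_grad A w G1 G2" "\<And>k. test_fun A (h k)"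
    "((\<lambda>k::nat. \<integral>x. (w x - h k x)\<^sup>2 + (G1 x - pd (h k) 1 x)\<^sup>2 + (G2 x - pd (h k) 2 x)\<^sup>2
          \<partial>lebesgue_on A) \<longlonglongrightarrow> 0)"
    using w by (auto simp: W120_def)
  have "pd (\<lambda>x. h k x + f x) i x = pd (h k) i x + pd f i x" for k i x
    by (rule pd_add[OF test_funD(4)[OF G(2)] test_funD(4)[OF f]])
  then have "((\<lambda>k. \<integral>x. (w x + f x - (h k x + f x))\<^sup>2 + (G1 x + pd f 1 x - pd (\<lambda>x. h k x + f x) 1 x)\<^sup>2
      + (G2 x + pd f 2 x - pd (\<lambda>x. h k x + f x) 2 x)\<^sup>2 \<partial>lebesgue_on A) \<longlonglongrightarrow> 0)"
    using G(3) by simp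
  then show ?thesis
    unfolding W120_def using weak_grad_add_test_fun[OF A G(1) f] test_fun_add[OF G(2) f]
    by (intro exI[of _ "\<lambda>x. G1 x + pd f 1 x"] exI[of _ "\<lambda>x. G2 x + pd f 2 x"]
        exI[of _ "\<lambda>k x. h k x + f x"] conjI allI)
qed

lemma admissible_add_test_fun:
  assumes "open A" "admissible A g u" "test_fun A f" "\<And>x. x \<in> A \<Longrightarrow> f (refl1 x) = - f x"
  shows "admissible A g (\<lambda>x. u x + f x)"
proof -
  obtain G1 G2 where "weak_grad A u G1 G2" using assms(2) by (auto simp: admissible_def W12_def)
  then have "W12 A (\<lambda>x. u x + f x)"
    using weak_grad_add_test_fun[OF assms(1) _ assms(3)] unfolding W12_def by blast
  moreover have "W120 A (\<lambda>x. (u x - g x) + f x)"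
    using W120_add_test_fun[OF assms(1) _ assms(3)] assms(2) by (simp add: admissible_def)
  then have "W120 A (\<lambda>x. u x + f x - g x)" by (simp add: algebra_simps)
  ultimately show ?thesis using assms(2,4) by (simp add: admissible_def)
qed

text \<open>For each weak gradient G of u, testing with the partial derivatives of f shows that G
  and the classical gradient have the same integral against grad f. Passing from u to u + f
  therefore changes the energy computed with any G by the same number \<open>?D\<close>, and taking
  the infimum over G gives J(u) <= J(u) + \<open>?D\<close>.\<close>

lemma minimizer_excess_nonneg:
  fixes W :: "real \<Rightarrow> real" and a b :: pt
  assumes W: "continuous_on UNIV W" "\<And>s. W s \<ge> 0"
    and A: "open A" "bounded A" and u: "bdd_minimizer W M A g u" "C1_on A u"
    and f: "C2_on UNIV f" "\<And>x. x \<notin> cbox a b \<Longrightarrow> f x = 0" "cbox a b \<subseteq> A"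
      "\<And>x. x \<in> A \<Longrightarrow> f (refl1 x) = - f x"
  shows "0 \<le> integral (cbox a b) (energy_excess W u f)"
proof -
  let ?L = "lebesgue_on A"
  have sA: "A \<in> sets lebesgue" using A by (simp add: lmeasurable_open)
  interpret finite_measure ?L
    by (rule finite_measure_lebesgue_on[OF bounded_set_imp_lmeasurable[OF A(2) sA]])
  have f0: "pd f i x = 0" if "x \<notin> cbox a b" for i x
    by (rule pd_zero_outside[OF closed_cbox f(2) that])
  have tf: "test_fun A f"
    unfolding test_fun_def using C2_onD(1)[OF f(1)] compact_cbox f(2,3) by blast
  \<comment> \<open>Here the second derivatives of f enter: its partial derivatives act as test
    functions against an arbitrary weak gradient.\<close>
  have tpf: "test_fun A (pd f i)" if "i \<in> {1, 2}" for i
    unfolding test_fun_def using C2_onD(2)[OF f(1) that] compact_cbox f(3) f0 by blast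
  have adm: "admissible A g u" using u(1) by (simp add: bdd_minimizer_def)
  have J_le: "J W A u \<le> J W A (\<lambda>x. u x + f x)"
    using u(1) admissible_add_test_fun[OF A(1) adm tf f(4)] by (simp add: bdd_minimizer_def)
  obtain B where B: "\<And>x. x \<in> A \<Longrightarrow> \<bar>u x\<bar> \<le> B" using u(1) by (auto simp: bdd_minimizer_def)
  have "compact (range f)"
  proof -
    have "range f \<subseteq> insert 0 (f ` cbox a b)" using f(2) by auto
    moreover have "range f = f ` cbox a b \<or> range f = insert 0 (f ` cbox a b)"
      using f(2) by (auto simp: image_def) metis+
    moreover have "compact (f ` cbox a b)"
      using C1_onD(3)[OF C2_onD(1)[OF f(1)]] by (intro compact_continuous_image) (auto intro: continuous_on_subset)
    ultimately show ?thesis by (metis compact_insert)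
  qed
  then obtain Bf where Bf: "\<And>x. \<bar>f x\<bar> \<le> Bf"
    using compact_imp_bounded bounded_iff by (metis rangeI real_norm_def)
  have "compact (W ` {- (B + Bf)..B + Bf})"
    using W(1) by (intro compact_continuous_image) (auto intro: continuous_on_subset)
  then obtain BW where BW: "\<And>s. \<bar>s\<bar> \<le> B + Bf \<Longrightarrow> \<bar>W s\<bar> \<le> BW"
    using compact_imp_bounded bounded_iff
    by (metis (no_types, lifting) abs_le_iff atLeastAtMost_iff imageI minus_le_iff real_norm_def)
  have Wm: "W \<in> borel_measurable borel" using W(1) by (rule borel_measurable_continuous_onI)
  have um: "u \<in> borel_measurable ?L" using adm by (auto simp: admissible_def W12_def weak_grad_def L2_on_def)
  have fm: "f \<in> borel_measurable ?L" using test_fun_integrable(1)[OF tf sA] by (rule borel_measurable_integrable)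
  have Wi: "integrable ?L (\<lambda>x. W (h x))" if "h \<in> borel_measurable ?L" "\<And>x. x \<in> A \<Longrightarrow> \<bar>h x\<bar> \<le> B + Bf" for h
  proof (rule integrable_const_bound[where B = BW])
    show "(\<lambda>x. W (h x)) \<in> borel_measurable ?L" by (rule measurable_compose[OF that(1) Wm])
    show "AE x in ?L. norm (W (h x)) \<le> BW" using BW that(2) by (intro AE_I2) simp
  qed
  have Wu: "integrable ?L (\<lambda>x. W (u x))"
    using B Bf by (intro Wi um) (smt (verit))
  have Wuf: "integrable ?L (\<lambda>x. W (u x + f x))"
    using B Bf by (intro Wi borel_measurable_add um fm) (smt (verit))
  let ?D = "integral\<^sup>L ?L (energy_excess W u f)"
  have u2: "integrable ?L (\<lambda>x. pd u i x * pd f i x)" if "i \<in> {1, 2}" for i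
    by (rule integration_by_parts_test_fun(3)[OF A(1) u(2) tpf[OF that] that])
  have f2: "integrable ?L (\<lambda>x. (pd f i x)\<^sup>2)" if "i \<in> {1, 2}" for i
    using test_fun_integrable(4)[OF tf sA that] by (simp add: L2_on_def)
  have D_int: "integrable ?L (energy_excess W u f)"
    using u2[of 1] u2[of 2] f2[of 1] f2[of 2] Wu Wuf unfolding energy_excess_def[abs_def] by simp
  let ?I = "\<lambda>w G. (\<integral>x. ((fst G x)\<^sup>2 + (snd G x)\<^sup>2) / 2 + W (w x) \<partial>?L)"
  have key: "J W A u \<le> ennreal (?I u (G1, G2) + ?D) \<and> 0 \<le> ?I u (G1, G2) \<and> 0 \<le> ?I u (G1, G2) + ?D
      \<and> (\<integral>\<^sup>+ x. ennreal ((G1 x)\<^sup>2 / 2 + (G2 x)\<^sup>2 / 2 + W (u x)) \<partial>?L) = ennreal (?I u (G1, G2))"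
    if G: "weak_grad A u G1 G2" for G1 G2
  proof -
    have G2: "integrable ?L (\<lambda>x. (G1 x)\<^sup>2)" "integrable ?L (\<lambda>x. (G2 x)\<^sup>2)"
      using G by (auto simp: weak_grad_def L2_on_def)
    have Gf: "integrable ?L (\<lambda>x. G1 x * pd f 1 x)" "integrable ?L (\<lambda>x. G2 x * pd f 2 x)"
      using G test_fun_integrable(4)[OF tf sA] by (auto simp: weak_grad_def intro!: L2_on_mult_integrable)
    have weak: "(\<integral>x. G1 x * pd f 1 x \<partial>?L) = (\<integral>x. pd u 1 x * pd f 1 x \<partial>?L)"
      "(\<integral>x. G2 x * pd f 2 x \<partial>?L) = (\<integral>x. pd u 2 x * pd f 2 x \<partial>?L)"
    proof -
      have "(\<integral>x. u x * pd (pd f 1) 1 x \<partial>?L) = - (\<integral>x. G1 x * pd f 1 x \<partial>?L)"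
        "(\<integral>x. u x * pd (pd f 2) 2 x \<partial>?L) = - (\<integral>x. G2 x * pd f 2 x \<partial>?L)"
        using G tpf by (simp_all add: weak_grad_def)
      then show "(\<integral>x. G1 x * pd f 1 x \<partial>?L) = (\<integral>x. pd u 1 x * pd f 1 x \<partial>?L)"
        "(\<integral>x. G2 x * pd f 2 x \<partial>?L) = (\<integral>x. pd u 2 x * pd f 2 x \<partial>?L)"
        using integration_by_parts_test_fun(1)[OF A(1) u(2) tpf, of 1 1]
          integration_by_parts_test_fun(1)[OF A(1) u(2) tpf, of 2 2] by simp_all
    qed
    have D: "?D = (\<integral>x. G1 x * pd f 1 x + G2 x * pd f 2 x + ((pd f 1 x)\<^sup>2 + (pd f 2 x)\<^sup>2) / 2
        + (W (u x + f x) - W (u x)) \<partial>?L)"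
      using weak u2[of 1] u2[of 2] f2[of 1] f2[of 2] Wu Wuf Gf unfolding energy_excess_def[abs_def] by simp
    have i0: "integrable ?L (\<lambda>x. ((G1 x)\<^sup>2 + (G2 x)\<^sup>2) / 2 + W (u x))" using G2 Wu by simp
    have iD: "integrable ?L (\<lambda>x. G1 x * pd f 1 x + G2 x * pd f 2 x + ((pd f 1 x)\<^sup>2 + (pd f 2 x)\<^sup>2) / 2
        + (W (u x + f x) - W (u x)))"
      using f2[of 1] f2[of 2] Wu Wuf Gf by simp
    let ?G = "(\<lambda>x. G1 x + pd f 1 x, \<lambda>x. G2 x + pd f 2 x)"
    have sum: "((G1 x + pd f 1 x)\<^sup>2 + (G2 x + pd f 2 x)\<^sup>2) / 2 + W (u x + f x)
       = (((G1 x)\<^sup>2 + (G2 x)\<^sup>2) / 2 + W (u x)) + (G1 x * pd f 1 x + G2 x * pd f 2 x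
        + ((pd f 1 x)\<^sup>2 + (pd f 2 x)\<^sup>2) / 2 + (W (u x + f x) - W (u x)))" for x
      by (simp add: power2_sum field_simps)
    have i1: "integrable ?L (\<lambda>x. ((G1 x + pd f 1 x)\<^sup>2 + (G2 x + pd f 2 x)\<^sup>2) / 2 + W (u x + f x))"
      unfolding sum by (rule Bochner_Integration.integrable_add[OF i0 iD])
    have I1: "(\<integral>x. ((G1 x + pd f 1 x)\<^sup>2 + (G2 x + pd f 2 x)\<^sup>2) / 2 + W (u x + f x) \<partial>?L) = ?I u (G1, G2) + ?D"
      unfolding sum D using Bochner_Integration.integral_add[OF i0 iD] by simp
    have "J W A (\<lambda>x. u x + f x) \<le> (\<integral>\<^sup>+ x. ennreal (((fst ?G x)\<^sup>2 + (snd ?G x)\<^sup>2) / 2 + W (u x + f x)) \<partial>?L)"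
      unfolding J_def using weak_grad_add_test_fun[OF A(1) G tf] by (intro INF_lower2[of ?G]) auto
    also have "\<dots> = ennreal (?I u (G1, G2) + ?D)"
      using nn_integral_eq_integral[OF i1] W(2) I1 by (simp add: AE_I2)
    finally have "J W A u \<le> ennreal (?I u (G1, G2) + ?D)" using J_le by (rule order_trans[rotated])
    moreover have "0 \<le> ?I u (G1, G2) + ?D"
      unfolding I1[symmetric] using W(2) by (intro integral_nonneg_AE AE_I2) simp
    moreover have "0 \<le> ?I u (G1, G2)" using W(2) by (intro integral_nonneg_AE AE_I2) simp
    moreover have "(\<integral>\<^sup>+ x. ennreal ((G1 x)\<^sup>2 / 2 + (G2 x)\<^sup>2 / 2 + W (u x)) \<partial>?L) = ennreal (?I u (G1, G2))"
      using nn_integral_eq_integral[OF i0] W(2) by (simp add: AE_I2 add_divide_distrib)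
    ultimately show ?thesis by blast
  qed
  \<comment> \<open>The infimum is an extended real and has to be finite before it can be cancelled.
    If \<open>?D\<close> were negative, a weak gradient of u with energy below J(u) -
    \<open>?D\<close> would give u + f an energy below J(u).\<close>
  have "0 \<le> ?D"
  proof (rule ccontr)
    assume neg: "\<not> 0 \<le> ?D"
    obtain G0 where "weak_grad A u (fst G0) (snd G0)" using adm by (auto simp: admissible_def W12_def)
    then have "J W A u \<noteq> top" using key[THEN conjunct1] neq_top_trans[OF ennreal_neq_top] by blast
    then obtain j where j: "J W A u = ennreal j" "0 \<le> j" by (cases "J W A u") auto
    have "J W A u < ennreal (j - ?D)" using neg j by (simp add: ennreal_less_iff)
    then obtain G where G: "weak_grad A u (fst G) (snd G)"
      "(\<integral>\<^sup>+ x. ennreal (((fst G x)\<^sup>2 + (snd G x)\<^sup>2) / 2 + W (u x)) \<partial>?L) < ennreal (j - ?D)"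
      unfolding J_def by (auto simp: INF_less_iff)
    note k = key[OF G(1)]
    have "ennreal (?I u G) < ennreal (j - ?D)" using k G(2) by (simp add: add_divide_distrib)
    then have "?I u G + ?D < j" using k by (simp add: ennreal_less_iff)
    moreover have "ennreal j \<le> ennreal (?I u G + ?D)" using k j by simp
    then have "j \<le> ?I u G + ?D" using k j(2) by (simp add: ennreal_le_iff)
    ultimately show False by simp
  qed
  also have "?D = integral (cbox a b) (energy_excess W u f)"
  proof -
    have ex0: "energy_excess W u f x = 0" if "x \<notin> cbox a b" for x
      using f(2)[OF that] f0[OF that] by (simp add: energy_excess_def)
    have "set_integrable lebesgue A (energy_excess W u f)"
      using D_int sA by (simp add: set_integrable_def integrable_restrict_space)
    then have "?D = integral A (energy_excess W u f)"
      using set_lebesgue_integral_eq_integral(2)[of A "energy_excess W u f"] sA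
      by (simp add: set_lebesgue_integral_def integral_restrict_space)
    also have "\<dots> = integral (cbox a b) (energy_excess W u f)"
    proof -
      have "integral A (energy_excess W u f) = integral A (\<lambda>x. if x \<in> cbox a b then energy_excess W u f x else 0)"
        by (rule integral_cong) (simp add: ex0)
      also have "\<dots> = integral (cbox a b) (energy_excess W u f)"
        by (simp add: integral_restrict_Int Int_absorb2[OF f(3)])
      finally show ?thesis .
    qed
    finally show ?thesis .
  qed
  finally show ?thesis .
qed

lemma continuous_on_energy_excess:
  assumes "continuous_on UNIV W" "C1_on A u" "C1_on UNIV f"
  shows "continuous_on A (energy_excess W u f)"
proof -
  have c: "continuous_on A (pd u 1)" "continuous_on A (pd u 2)" "continuous_on A u"
    using C1_onD[OF assms(2)] by auto
  have d: "continuous_on A (pd f 1)" "continuous_on A (pd f 2)" "continuous_on A f"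
    using C1_onD[OF C1_on_subset[OF assms(3), of A]] by auto
  have W: "continuous_on A (\<lambda>x. W (h x))" if "continuous_on A h" for h :: "pt \<Rightarrow> real"
    by (rule continuous_on_compose2[OF assms(1) that]) simp
  show ?thesis
    unfolding energy_excess_def[abs_def] by (intro continuous_intros c d W) simp
qed

section \<open>Passage to the limit along the exhausting domains\<close>

lemma compact_subset_incseq_open:
  fixes S :: "nat \<Rightarrow> 'a::topological_space set"
  assumes "compact K" "K \<subseteq> (\<Union>j. S j)" "\<And>j. open (S j)" "incseq S"
  obtains N where "\<And>j. N \<le> j \<Longrightarrow> K \<subseteq> S j"
proof -
  obtain C' where C': "finite C'" "K \<subseteq> (\<Union>c\<in>C'. S c)"
    using compactE_image[OF assms(1), of UNIV S] assms(2,3) by auto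
  obtain N where N: "\<And>c. c \<in> C' \<Longrightarrow> c \<le> N" using C'(1) finite_nat_set_iff_bounded_le by auto
  have "K \<subseteq> S j" if "N \<le> j" for j
  proof -
    have "S c \<subseteq> S j" if "c \<in> C'" for c
      using N[OF that] \<open>N \<le> j\<close> assms(4) by (meson incseq_def order_trans)
    then show ?thesis using C'(2) by blast
  qed
  then show ?thesis using that by blast
qed

lemma loc_C2_convD:
  assumes "loc_C2_conv S us u" "compact K" "K \<subseteq> S" "e > 0"
  obtains N where "\<And>j x. N \<le> j \<Longrightarrow> x \<in> K \<Longrightarrow> \<bar>us j x - u x\<bar> < e"
    "\<And>j x. N \<le> j \<Longrightarrow> x \<in> K \<Longrightarrow> \<bar>pd (us j) 1 x - pd u 1 x\<bar> < e"
    "\<And>j x. N \<le> j \<Longrightarrow> x \<in> K \<Longrightarrow> \<bar>pd (us j) 2 x - pd u 2 x\<bar> < e"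
proof -
  have "\<forall>\<^sub>F j in sequentially. \<forall>x\<in>K. \<bar>us j x - u x\<bar> < e \<and>
      (\<forall>i\<in>{1,2}. \<bar>pd (us j) i x - pd u i x\<bar> < e \<and>
         (\<forall>l\<in>{1,2}. \<bar>pd (pd (us j) i) l x - pd (pd u i) l x\<bar> < e))"
    using assms unfolding loc_C2_conv_def by blast
  then obtain N where "\<forall>j\<ge>N. \<forall>x\<in>K. \<bar>us j x - u x\<bar> < e \<and>
      (\<forall>i\<in>{1,2}. \<bar>pd (us j) i x - pd u i x\<bar> < e \<and>
         (\<forall>l\<in>{1,2}. \<bar>pd (pd (us j) i) l x - pd (pd u i) l x\<bar> < e))"
    unfolding eventually_sequentially by blast
  then show ?thesis by (intro that[of N]) auto
qed

lemma loc_C2_conv_tendsto: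
  assumes "loc_C2_conv S us u" "x \<in> S"
  shows "(\<lambda>j. us j x) \<longlonglongrightarrow> u x" "(\<lambda>j. pd (us j) 1 x) \<longlonglongrightarrow> pd u 1 x" "(\<lambda>j. pd (us j) 2 x) \<longlonglongrightarrow> pd u 2 x"
proof -
  have *: "\<exists>N. \<forall>j\<ge>N. \<bar>us j x - u x\<bar> < e \<and> \<bar>pd (us j) 1 x - pd u 1 x\<bar> < e \<and> \<bar>pd (us j) 2 x - pd u 2 x\<bar> < e"
    if "e > 0" for e
    using loc_C2_convD[OF assms(1), of "{x}" e] assms(2) that by (metis compact_sing empty_subsetI insert_subset singletonI)
  show "(\<lambda>j. us j x) \<longlonglongrightarrow> u x" "(\<lambda>j. pd (us j) 1 x) \<longlonglongrightarrow> pd u 1 x" "(\<lambda>j. pd (us j) 2 x) \<longlonglongrightarrow> pd u 2 x"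
    unfolding LIMSEQ_iff real_norm_def using * by blast+
qed

text \<open>Dominated convergence on the fixed box. Once values and first derivatives are within 1
  of those of u, a constant majorizes the integrand, which depends continuously on them.\<close>

lemma limit_excess_nonneg:
  fixes W :: "real \<Rightarrow> real" and a b :: pt
  assumes W: "continuous_on UNIV W" and S: "open S" "C1_on S u" and conv: "loc_C2_conv S us u"
    and f: "C1_on UNIV f" and Q: "cbox a b \<subseteq> S"
    and us: "\<And>j. j \<ge> N0 \<Longrightarrow> C1_on (cbox a b) (us j)"
      "\<And>j. j \<ge> N0 \<Longrightarrow> 0 \<le> integral (cbox a b) (energy_excess W (us j) f)"
  shows "0 \<le> integral (cbox a b) (energy_excess W u f)"
proof -
  let ?Q = "cbox a b"
  have bdd: "\<exists>B. \<forall>x\<in>?Q. \<bar>h x\<bar> \<le> B" if "continuous_on ?Q h" for h :: "pt \<Rightarrow> real"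
  proof -
    have "bounded (h ` ?Q)" using that compact_cbox compact_continuous_image compact_imp_bounded by blast
    then show ?thesis unfolding bounded_iff by auto
  qed
  have uQ: "C1_on ?Q u" by (rule C1_on_subset[OF S(2) Q])
  have fQ: "C1_on ?Q f" by (rule C1_on_subset[OF f]) simp
  obtain B where B: "\<And>x. x \<in> ?Q \<Longrightarrow> \<bar>u x\<bar> \<le> B" using bdd[OF C1_onD(3)[OF uQ]] by blast
  obtain B1 where B1: "\<And>x. x \<in> ?Q \<Longrightarrow> \<bar>pd u 1 x\<bar> \<le> B1" using bdd[OF C1_onD(2)[OF uQ, of 1]] by auto
  obtain B2 where B2: "\<And>x. x \<in> ?Q \<Longrightarrow> \<bar>pd u 2 x\<bar> \<le> B2" using bdd[OF C1_onD(2)[OF uQ, of 2]] by auto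
  obtain F where F: "\<And>x. x \<in> ?Q \<Longrightarrow> \<bar>f x\<bar> \<le> F" using bdd[OF C1_onD(3)[OF fQ]] by blast
  obtain F1 where F1: "\<And>x. x \<in> ?Q \<Longrightarrow> \<bar>pd f 1 x\<bar> \<le> F1" using bdd[OF C1_onD(2)[OF fQ, of 1]] by auto
  obtain F2 where F2: "\<And>x. x \<in> ?Q \<Longrightarrow> \<bar>pd f 2 x\<bar> \<le> F2" using bdd[OF C1_onD(2)[OF fQ, of 2]] by auto
  have "compact (W ` {- (B + 1 + F)..B + 1 + F})"
    using W by (intro compact_continuous_image) (auto intro: continuous_on_subset)
  then have "bounded (W ` {- (B + 1 + F)..B + 1 + F})" by (rule compact_imp_bounded)
  then obtain BW where "\<forall>s\<in>W ` {- (B + 1 + F)..B + 1 + F}. norm s \<le> BW"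
    unfolding bounded_iff by blast
  then have BW: "\<bar>W s\<bar> \<le> BW" if "\<bar>s\<bar> \<le> B + 1 + F" for s
  proof -
    have "s \<in> {- (B + 1 + F)..B + 1 + F}" using that by (auto simp: abs_le_iff)
    then have "norm (W s) \<le> BW" using \<open>\<forall>s\<in>W ` _. norm s \<le> BW\<close> by blast
    then show ?thesis by simp
  qed
  obtain N1 where N1: "\<And>j x. N1 \<le> j \<Longrightarrow> x \<in> ?Q \<Longrightarrow> \<bar>us j x - u x\<bar> < 1"
    "\<And>j x. N1 \<le> j \<Longrightarrow> x \<in> ?Q \<Longrightarrow> \<bar>pd (us j) 1 x - pd u 1 x\<bar> < 1"
    "\<And>j x. N1 \<le> j \<Longrightarrow> x \<in> ?Q \<Longrightarrow> \<bar>pd (us j) 2 x - pd u 2 x\<bar> < 1"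
    using loc_C2_convD[OF conv compact_cbox Q, of 1] by auto
  let ?N = "max N0 N1"
  let ?h = "\<lambda>j. energy_excess W (us (j + ?N)) f"
  let ?C = "(B1 + 1) * F1 + (B2 + 1) * F2 + (F1\<^sup>2 + F2\<^sup>2) / 2 + 2 * BW"
  have tri: "\<bar>s\<bar> \<le> c + 1" if "\<bar>s - t\<bar> < 1" "\<bar>t\<bar> \<le> c" for s t c :: real
    using that by linarith
  have lin: "\<bar>a + b + (c + d) / 2 + (s - r)\<bar> \<le> A + A' + (C + D) / 2 + 2 * E"
    if "\<bar>a\<bar> \<le> A" "\<bar>b\<bar> \<le> A'" "c \<le> C" "d \<le> D" "\<bar>r\<bar> \<le> E" "\<bar>s\<bar> \<le> E" "0 \<le> c" "0 \<le> d"
    for a b c d r s A A' C D E :: real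
    using that unfolding abs_le_iff add_divide_distrib by (intro conjI; linarith)
  have bound: "norm (?h j x) \<le> ?C" if x: "x \<in> ?Q" for j x
  proof -
    let ?v = "us (j + ?N)"
    have n: "\<bar>?v x - u x\<bar> < 1" "\<bar>pd ?v 1 x - pd u 1 x\<bar> < 1" "\<bar>pd ?v 2 x - pd u 2 x\<bar> < 1"
      using N1[of "j + ?N" x] x by simp_all
    have v: "\<bar>?v x\<bar> \<le> B + 1" "\<bar>pd ?v 1 x\<bar> \<le> B1 + 1" "\<bar>pd ?v 2 x\<bar> \<le> B2 + 1"
      using tri[OF n(1) B[OF x]] tri[OF n(2) B1[OF x]] tri[OF n(3) B2[OF x]] by blast+
    have F0: "0 \<le> F" by (rule order_trans[OF abs_ge_zero F[OF x]])
    have a: "\<bar>pd ?v 1 x * pd f 1 x\<bar> \<le> (B1 + 1) * F1"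
      unfolding abs_mult by (rule mult_mono[OF v(2) F1[OF x]]) (use order_trans[OF abs_ge_zero v(2)] in simp_all)
    have b: "\<bar>pd ?v 2 x * pd f 2 x\<bar> \<le> (B2 + 1) * F2"
      unfolding abs_mult by (rule mult_mono[OF v(3) F2[OF x]]) (use order_trans[OF abs_ge_zero v(3)] in simp_all)
    have c: "(pd f 1 x)\<^sup>2 \<le> F1\<^sup>2" "(pd f 2 x)\<^sup>2 \<le> F2\<^sup>2"
      using power_mono[OF F1[OF x], of 2] power_mono[OF F2[OF x], of 2] by simp_all
    have d: "\<bar>W (?v x)\<bar> \<le> BW" "\<bar>W (?v x + f x)\<bar> \<le> BW"
      using v(1) order_trans[OF abs_triangle_ineq add_mono[OF v(1) F[OF x]]] F0 by (intro BW; simp)+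
    have e: "0 \<le> (pd f 1 x)\<^sup>2" "0 \<le> (pd f 2 x)\<^sup>2" by simp_all
    show ?thesis unfolding energy_excess_def real_norm_def
      by (rule lin[OF a b c d e])
  qed
  have ptw: "(\<lambda>j. ?h j x) \<longlonglongrightarrow> energy_excess W u f x" if x: "x \<in> ?Q" for x
  proof -
    have xS: "x \<in> S" using x Q by blast
    have Wc: "isCont W s" for s using W by (simp add: continuous_on_eq_continuous_at)
    have "(\<lambda>j. energy_excess W (us j) f x) \<longlonglongrightarrow> energy_excess W u f x"
      unfolding energy_excess_def
      by (intro tendsto_intros loc_C2_conv_tendsto[OF conv xS] isCont_tendsto_compose[OF Wc]) simp
    then show ?thesis by (rule LIMSEQ_ignore_initial_segment)
  qed
  have "(\<lambda>j. integral ?Q (?h j)) \<longlonglongrightarrow> integral ?Q (energy_excess W u f)"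
  proof (rule dominated_convergence(2)[where h = "\<lambda>x. ?C"])
    show "?h j integrable_on ?Q" for j
      using continuous_on_energy_excess[OF W us(1) f] by (intro integrable_continuous) simp
    show "(\<lambda>x. ?C) integrable_on ?Q" by (rule integrable_const)
  qed (use bound ptw in blast)+
  then show ?thesis
    by (rule LIMSEQ_le_const) (use us(2) in simp)
qed

text \<open>Both cases of the construction are reduced to the same three facts. For an unbounded
  domain each of them concerns a compact set, which lies in the approximating domains from some
  index on, and each is preserved by the convergence.\<close>

lemma constructed_solution_props:
  fixes W :: "real \<Rightarrow> real"
  assumes W: "continuous_on UNIV W" "\<And>s. W s \<ge> 0"
    and S: "open S" and u: "constructed_solution W M \<alpha> S g u"
  shows "\<And>x. x \<in> S \<Longrightarrow> u (refl1 x) = - u x"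
    and "\<And>x. x \<in> plus_part S \<Longrightarrow> u x \<ge> 0"
    and "\<And>f a b. C2_on UNIV f \<Longrightarrow> (\<And>x. x \<notin> cbox a b \<Longrightarrow> f x = 0) \<Longrightarrow> cbox a b \<subseteq> S \<Longrightarrow>
      (\<And>x. x \<in> S \<Longrightarrow> f (refl1 x) = - f x) \<Longrightarrow> 0 \<le> integral (cbox a b) (energy_excess W u f)"
proof -
  have u2: "C2_on S u" using u by (simp add: constructed_solution_def)
  have sol: "(\<forall>x\<in>S. u (refl1 x) = - u x) \<and> (\<forall>x\<in>plus_part S. u x \<ge> 0) \<and>
    (\<forall>f a b. C2_on UNIV f \<longrightarrow> (\<forall>x. x \<notin> cbox a b \<longrightarrow> f x = 0) \<longrightarrow> cbox a b \<subseteq> S \<longrightarrow>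
      (\<forall>x\<in>S. f (refl1 x) = - f x) \<longrightarrow> 0 \<le> integral (cbox a b) (energy_excess W u f))"
  proof (cases "bounded S")
    case True
    then have m: "bdd_minimizer W M S g u" using u by (simp add: constructed_solution_def)
    then show ?thesis
      using minimizer_excess_nonneg[OF W S True m C2_onD(1)[OF u2]]
      by (auto simp: bdd_minimizer_def admissible_def)
  next
    case False
    then obtain Ss us \<sigma> \<rho> where
      *: "\<forall>j. domain (Ss j) \<and> bounded (Ss j) \<and> sym_set (Ss j) \<and>
                c2a_boundary \<alpha> (Ss j) \<and> interior_sphere \<rho> (Ss j) \<and>
                bdd_minimizer W M (Ss j) g (us j) \<and> C2_on (Ss j) (us j)"
      and mono: "incseq Ss" and un: "(\<Union>j. Ss j) = S" and \<sigma>: "strict_mono (\<sigma> :: nat \<Rightarrow> nat)"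
      and conv: "loc_C2_conv S (\<lambda>j. us (\<sigma> j)) u"
      using u unfolding constructed_solution_def if_not_P[OF False] by (elim conjE exE)
    have Ss: "\<And>j. domain (Ss j)" "\<And>j. bounded (Ss j)" "\<And>j. sym_set (Ss j)"
      and us: "\<And>j. bdd_minimizer W M (Ss j) g (us j)" "\<And>j. C2_on (Ss j) (us j)"
      using * by blast+
    have Sop: "open (Ss j)" for j using Ss(1) by (simp add: domain_def)
    have ex: "\<exists>N. \<forall>j\<ge>N. K \<subseteq> Ss (\<sigma> j)" if K: "compact K" "K \<subseteq> S" for K
    proof -
      obtain N where "\<And>j. N \<le> j \<Longrightarrow> K \<subseteq> Ss j"
        using compact_subset_incseq_open[OF K(1) _ Sop mono] K(2) un by blast
      then show ?thesis using seq_suble[OF \<sigma>] le_trans by blast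
    qed
    have odd: "u (refl1 x) = - u x" if x: "x \<in> S" for x
    proof -
      obtain N where N: "\<And>j. N \<le> j \<Longrightarrow> x \<in> Ss (\<sigma> j)" using ex[of "{x}"] x by auto
      have rx: "refl1 x \<in> S"
        using N[of N] Ss(3) un unfolding sym_set_def by blast
      have "\<forall>\<^sub>F j in sequentially. us (\<sigma> j) (refl1 x) = - us (\<sigma> j) x"
      proof -
        have "us j (refl1 y) = - us j y" if "y \<in> Ss j" for j y
          using us(1)[of j] that unfolding bdd_minimizer_def admissible_def by blast
        then show ?thesis unfolding eventually_sequentially using N by (intro exI[of _ N]) simp
      qed
      then have "(\<lambda>j. - us (\<sigma> j) x) \<longlonglongrightarrow> u (refl1 x)"
        by (rule tendsto_cong[THEN iffD1, OF _ loc_C2_conv_tendsto(1)[OF conv rx]])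
      then show ?thesis
        by (rule LIMSEQ_unique[OF _ tendsto_minus[OF loc_C2_conv_tendsto(1)[OF conv x]]])
    qed
    have nonneg: "u x \<ge> 0" if x: "x \<in> plus_part S" for x
    proof -
      have xS: "x \<in> S" "fst x > 0" using x by (auto simp: plus_part_def)
      obtain N where N: "\<And>j. N \<le> j \<Longrightarrow> x \<in> Ss (\<sigma> j)" using ex[of "{x}"] xS by auto
      have "\<forall>j\<ge>N. 0 \<le> us (\<sigma> j) x"
      proof -
        have "us j y \<ge> 0" if "y \<in> plus_part (Ss j)" for j y
          using us(1)[of j] that unfolding bdd_minimizer_def by blast
        moreover have "x \<in> plus_part (Ss (\<sigma> j))" if "N \<le> j" for j
          using N[OF that] xS by (simp add: plus_part_def)
        ultimately show ?thesis by blast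
      qed
      then show ?thesis by (intro LIMSEQ_le_const[OF loc_C2_conv_tendsto(1)[OF conv xS(1)]]) blast
    qed
    have exc: "0 \<le> integral (cbox a b) (energy_excess W u f)"
      if f: "C2_on UNIV f" "\<And>x. x \<notin> cbox a b \<Longrightarrow> f x = 0" "cbox a b \<subseteq> S"
        "\<And>x. x \<in> S \<Longrightarrow> f (refl1 x) = - f x" for f a b
    proof -
      obtain N where N: "\<And>j. N \<le> j \<Longrightarrow> cbox a b \<subseteq> Ss (\<sigma> j)" using ex[OF compact_cbox f(3)] by blast
      show ?thesis
      proof (rule limit_excess_nonneg[OF W(1) S C2_onD(1)[OF u2] conv C2_onD(1)[OF f(1)] f(3)])
        fix j assume j: "N \<le> j"
        show "C1_on (cbox a b) (us (\<sigma> j))" by (rule C1_on_subset[OF C2_onD(1)[OF us(2)] N[OF j]])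
        have "Ss (\<sigma> j) \<subseteq> S" using un by blast
        then show "0 \<le> integral (cbox a b) (energy_excess W (us (\<sigma> j)) f)"
          using minimizer_excess_nonneg[OF W Sop Ss(2) us(1) C2_onD(1)[OF us(2)] f(1,2) N[OF j]] f(4) by blast
      qed
    qed
    show ?thesis using odd nonneg exc by blast
  qed
  show "\<And>x. x \<in> S \<Longrightarrow> u (refl1 x) = - u x" "\<And>x. x \<in> plus_part S \<Longrightarrow> u x \<ge> 0"
    using sol by blast+
  show "\<And>f a b. C2_on UNIV f \<Longrightarrow> (\<And>x. x \<notin> cbox a b \<Longrightarrow> f x = 0) \<Longrightarrow> cbox a b \<subseteq> S \<Longrightarrow>
      (\<And>x. x \<in> S \<Longrightarrow> f (refl1 x) = - f x) \<Longrightarrow> 0 \<le> integral (cbox a b) (energy_excess W u f)"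
    using sol by blast
qed

section \<open>Cutoff functions and reflection\<close>

text \<open>The kink at 0 is the only critical point; there the difference quotient is
  \<open>max 0 h ^ n\<close>, which tends to 0 because n >= 1.\<close>

lemma DERIV_max_power:
  assumes "n \<ge> 1"
  shows "((\<lambda>t::real. max 0 t ^ Suc n) has_real_derivative real (Suc n) * max 0 t ^ n) (at t)"
proof -
  consider "t > 0" | "t < 0" | "t = 0" by linarith
  then show ?thesis
  proof cases
    case 1
    have "((\<lambda>t::real. t ^ Suc n) has_real_derivative real (Suc n) * t ^ n) (at t)"
      using DERIV_pow[of "Suc n" t] by simp
    moreover have "\<forall>\<^sub>F s in nhds t. max 0 s ^ Suc n = s ^ Suc n"
      using eventually_nhds_in_open[of "{0<..}" t] 1 by (auto elim!: eventually_mono)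
    ultimately show ?thesis using 1 DERIV_cong_ev[of t t] by (simp add: max_def)
  next
    case 2
    have "\<forall>\<^sub>F s in nhds t. max 0 s ^ Suc n = 0"
      using eventually_nhds_in_open[of "{..<0}" t] 2 by (auto elim!: eventually_mono)
    then have "((\<lambda>t::real. max 0 t ^ Suc n) has_real_derivative 0) (at t)"
      using DERIV_cong_ev[of t t "\<lambda>t. max 0 t ^ Suc n" "\<lambda>t. 0"] by simp
    then show ?thesis using 2 assms by (simp add: max_def zero_power)
  next
    case 3
    have eq: "(max 0 (0 + h) ^ Suc n - max 0 0 ^ Suc n) / h = max 0 h ^ n" if "h \<noteq> 0" for h :: real
      using that assms by (cases "h > 0") (auto simp: max_def zero_power)
    have "((\<lambda>h::real. max 0 h ^ n) \<longlongrightarrow> max 0 0 ^ n) (at 0)"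
      by (intro tendsto_intros)
    then have "((\<lambda>h::real. (max 0 (0 + h) ^ Suc n - max 0 0 ^ Suc n) / h) \<longlongrightarrow> 0) (at 0)"
      using assms eq by (subst tendsto_cong[where g = "\<lambda>h. max 0 h ^ n"]) (auto simp: eventually_at_filter zero_power)
    then show ?thesis using 3 assms by (simp add: DERIV_def zero_power)
  qed
qed

text \<open>The cube is the lowest integer power of a positive part that is C^2, the class needed
  for variations. The step rises from 0 to 1 on [0, 1], with slope 9 (1 - t^3)^2 t^2 there, hence at
  most 9.\<close>

definition smooth_step :: "real \<Rightarrow> real" where
  "smooth_step t = 1 - max 0 (1 - max 0 t ^ 3) ^ 3"

definition smooth_step' :: "real \<Rightarrow> real" where
  "smooth_step' t = 9 * max 0 (1 - max 0 t ^ 3) ^ 2 * max 0 t ^ 2"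

lemma smooth_step_deriv: "(smooth_step has_real_derivative smooth_step' t) (at t)"
proof -
  have c: "((\<lambda>t::real. max 0 t ^ 3) has_real_derivative 3 * max 0 t ^ 2) (at t)" for t
    using DERIV_max_power[of 2 t] by (simp add: numeral_3_eq_3 numeral_2_eq_2)
  have "((\<lambda>t. max 0 (1 - max 0 t ^ 3) ^ 3) has_real_derivative
      (3 * max 0 (1 - max 0 t ^ 3) ^ 2) * (0 - 3 * max 0 t ^ 2)) (at t)"
    by (rule DERIV_chain2[OF c DERIV_diff[OF DERIV_const c]])
  from DERIV_diff[OF DERIV_const this, of 1] show ?thesis
    unfolding smooth_step_def[abs_def] smooth_step'_def by (simp add: mult.assoc)
qed

lemma smooth_step'_deriv: "\<exists>d. continuous_on UNIV d \<and> (\<forall>t. (smooth_step' has_real_derivative d t) (at t))"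
proof -
  have c: "((\<lambda>t::real. max 0 t ^ 3) has_real_derivative 3 * max 0 t ^ 2) (at t)" for t
    using DERIV_max_power[of 2 t] by (simp add: numeral_3_eq_3 numeral_2_eq_2)
  have q: "((\<lambda>t::real. max 0 t ^ 2) has_real_derivative 2 * max 0 t) (at t)" for t
    using DERIV_max_power[of 1 t] by (simp add: numeral_2_eq_2)
  let ?d = "\<lambda>t::real. 9 * ((2 * max 0 (1 - max 0 t ^ 3)) * (0 - 3 * max 0 t ^ 2) * max 0 t ^ 2
      + (2 * max 0 t) * max 0 (1 - max 0 t ^ 3) ^ 2)"
  have "(smooth_step' has_real_derivative ?d t) (at t)" for t
  proof -
    have 1: "((\<lambda>t. max 0 (1 - max 0 t ^ 3) ^ 2) has_real_derivative
      (2 * max 0 (1 - max 0 t ^ 3)) * (0 - 3 * max 0 t ^ 2)) (at t)"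
      by (rule DERIV_chain2[OF q DERIV_diff[OF DERIV_const c]])
    have "((\<lambda>t. 9 * (max 0 (1 - max 0 t ^ 3) ^ 2 * max 0 t ^ 2)) has_real_derivative ?d t) (at t)"
      by (rule DERIV_cmult[OF DERIV_mult[OF 1 q]])
    then show ?thesis unfolding smooth_step'_def[abs_def] by (simp add: mult.assoc)
  qed
  moreover have "continuous_on UNIV ?d" by (intro continuous_intros)
  ultimately show ?thesis by blast
qed

lemma smooth_step_bounds: "0 \<le> smooth_step t" "smooth_step t \<le> 1"
proof -
  have "max 0 (1 - max 0 t ^ 3) ^ 3 \<le> 1" by (rule power_le_one) auto
  then show "0 \<le> smooth_step t" by (simp add: smooth_step_def)
  show "smooth_step t \<le> 1" by (simp add: smooth_step_def)
qed

lemma smooth_step_zero: "t \<le> 0 \<Longrightarrow> smooth_step t = 0"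
  by (simp add: smooth_step_def max_def)

lemma smooth_step_one: "1 \<le> t \<Longrightarrow> smooth_step t = 1"
proof -
  assume "1 \<le> t"
  then have "max 0 t = t" "max 0 (1 - t ^ 3) = 0" using one_le_power[of t 3] by simp_all
  then show ?thesis by (simp add: smooth_step_def)
qed

lemma smooth_step'_bound: "\<bar>smooth_step' t\<bar> \<le> 9"
proof (cases "t \<le> 1")
  case True
  have "max 0 (1 - max 0 t ^ 3) ^ 2 * max 0 t ^ 2 \<le> 1 * 1"
    by (rule mult_mono) (auto intro!: power_le_one simp: True)
  then show ?thesis by (simp add: smooth_step'_def mult.assoc abs_mult)
next
  case False
  then have "max 0 t = t" "max 0 (1 - t ^ 3) = 0" using one_le_power[of t 3] by simp_all
  then show ?thesis by (simp add: smooth_step'_def)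
qed

section \<open>Cutoffs with explicit gradient bounds\<close>

definition cutoff_bound :: "real \<Rightarrow> (pt \<Rightarrow> real) \<Rightarrow> bool" where
  "cutoff_bound k f \<longleftrightarrow> C2_on UNIV f \<and> (\<forall>x. 0 \<le> f x \<and> f x \<le> 1) \<and> (\<forall>x. \<forall>i\<in>{1, 2}. \<bar>pd f i x\<bar> \<le> k)"

lemma cutoff_boundD:
  assumes "cutoff_bound k f"
  shows "C2_on UNIV f" "0 \<le> f x" "f x \<le> 1" "i \<in> {1, 2} \<Longrightarrow> \<bar>pd f i x\<bar> \<le> k" "f differentiable (at x)"
proof -
  show C: "C2_on UNIV f" and "0 \<le> f x" "f x \<le> 1" "i \<in> {1, 2} \<Longrightarrow> \<bar>pd f i x\<bar> \<le> k"
    using assms unfolding cutoff_bound_def by blast+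
  show "f differentiable (at x)" by (rule C1_onD(1)[OF C2_onD(1)[OF C]]) simp
qed

lemma cutoff_bound_mult:
  assumes f: "cutoff_bound k f" and g: "cutoff_bound l g"
  shows "cutoff_bound (k + l) (\<lambda>x. f x * g x)"
  unfolding cutoff_bound_def
proof (intro conjI allI ballI)
  show "C2_on UNIV (\<lambda>x. f x * g x)"
    by (rule C2_on_mult[OF open_UNIV cutoff_boundD(1)[OF f] cutoff_boundD(1)[OF g]])
  fix x
  show "0 \<le> f x * g x" using cutoff_boundD(2)[OF f] cutoff_boundD(2)[OF g] by simp
  show "f x * g x \<le> 1" using cutoff_boundD(2,3)[OF f] cutoff_boundD(2,3)[OF g] by (simp add: mult_le_one)
  fix i :: nat assume i: "i \<in> {1, 2}"
  have "\<bar>pd (\<lambda>x. f x * g x) i x\<bar> \<le> \<bar>f x\<bar> * \<bar>pd g i x\<bar> + \<bar>pd f i x\<bar> * \<bar>g x\<bar>"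
    unfolding pd_mult[OF cutoff_boundD(5)[OF f] cutoff_boundD(5)[OF g]] abs_mult[symmetric]
    by (rule abs_triangle_ineq)
  also have "\<dots> \<le> 1 * l + k * 1"
    using cutoff_boundD(2,3)[OF f, of x] cutoff_boundD(2,3)[OF g, of x]
      cutoff_boundD(4)[OF f i, of x] cutoff_boundD(4)[OF g i, of x]
    by (intro add_mono mult_mono) (auto intro: order_trans[OF abs_ge_zero])
  finally show "\<bar>pd (\<lambda>x. f x * g x) i x\<bar> \<le> k + l" by simp
qed

lemma cutoff_bound_compl:
  assumes f: "cutoff_bound k f" shows "cutoff_bound k (\<lambda>x. 1 - f x)"
  unfolding cutoff_bound_def
proof (intro conjI allI ballI)
  show "C2_on UNIV (\<lambda>x. 1 - f x)"
    by (rule C2_on_diff[OF open_UNIV C2_on_const cutoff_boundD(1)[OF f]])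
  fix x
  show "0 \<le> 1 - f x" "1 - f x \<le> 1" using cutoff_boundD(2,3)[OF f, of x] by simp_all
  fix i :: nat assume i: "i \<in> {1, 2}"
  show "\<bar>pd (\<lambda>x. 1 - f x) i x\<bar> \<le> k"
    using cutoff_boundD(4)[OF f i] cutoff_boundD(5)[OF f] by (simp add: pd_diff)
qed

lemma cutoff_bound_step:
  assumes "C2_on UNIV f" "\<And>x i. i \<in> {1, 2} \<Longrightarrow> \<bar>pd f i x\<bar> \<le> 1"
  shows "cutoff_bound 9 (\<lambda>x. smooth_step (f x))"
  unfolding cutoff_bound_def
proof (intro conjI allI ballI)
  obtain d where d: "continuous_on UNIV d" "\<And>t. (smooth_step' has_real_derivative d t) (at t)"
    using smooth_step'_deriv by blast
  show "C2_on UNIV (\<lambda>x. smooth_step (f x))"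
    by (rule C2_on_compose[OF open_UNIV assms(1) smooth_step_deriv d(2,1)])
  fix x
  show "0 \<le> smooth_step (f x)" "smooth_step (f x) \<le> 1" using smooth_step_bounds by auto
  fix i :: nat assume i: "i \<in> {1, 2}"
  have "\<bar>smooth_step' (f x)\<bar> * \<bar>pd f i x\<bar> \<le> 9 * 1"
    using smooth_step'_bound[of "f x"] assms(2)[OF i, of x] by (intro mult_mono) auto
  then show "\<bar>pd (\<lambda>x. smooth_step (f x)) i x\<bar> \<le> 9"
    using pd_compose[of smooth_step "smooth_step' (f x)" f x i] smooth_step_deriv C1_onD(1)[OF C2_onD(1)[OF assms(1)]]
    by (simp add: abs_mult)
qed

text \<open>The values 0 and 1 are extremal for a cutoff. This covers the edge of a plateau too,
  where no neighbourhood of constancy is at hand.\<close>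

lemma cutoff_bound_pd_zero:
  assumes f: "cutoff_bound k f" and "f x = 0 \<or> f x = 1" and i: "i \<in> {1, 2}"
  shows "pd f i x = 0"
proof -
  obtain a b where x: "x = (a, b)" by fastforce
  have s1: "((\<lambda>t. f (t, b)) has_real_derivative pd f 1 (a, b)) (at a)"
    and s2: "((\<lambda>t. f (a, t)) has_real_derivative pd f 2 (a, b)) (at b)"
    by (rule pd_slice[OF cutoff_boundD(5)[OF f]])+
  note bd = cutoff_boundD(2,3)[OF f]
  have 1: "pd f 1 (a, b) = 0"
  proof (cases "f x = 0")
    case True
    show ?thesis by (rule DERIV_local_min[OF s1 zero_less_one]) (use True bd x in auto)
  next
    case False
    then have "f x = 1" using assms(2) by simp
    then show ?thesis by (intro DERIV_local_max[OF s1 zero_less_one]) (use bd x in auto)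
  qed
  have 2: "pd f 2 (a, b) = 0"
  proof (cases "f x = 0")
    case True
    show ?thesis by (rule DERIV_local_min[OF s2 zero_less_one]) (use True bd x in auto)
  next
    case False
    then have "f x = 1" using assms(2) by simp
    then show ?thesis by (intro DERIV_local_max[OF s2 zero_less_one]) (use bd x in auto)
  qed
  show ?thesis using 1 2 i x by auto
qed

text \<open>The window in the first coordinate is \<open>1 - (1 - bump (x - a)) (1 - bump (x + a))\<close>: even, and still
  smooth when the two bumps overlap on the axis.\<close>
lemma even_square_cutoff:
  assumes "0 \<le> r" "0 \<le> a"
  obtains Z where "cutoff_bound 54 Z" "\<And>x. Z (refl1 x) = Z x"
    "\<And>x. 0 \<le> fst x \<Longrightarrow> \<bar>fst x - a\<bar> \<le> r \<Longrightarrow> \<bar>snd x - y\<bar> \<le> r \<Longrightarrow> Z x = 1"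
    "\<And>x. 0 \<le> fst x \<Longrightarrow> r + 1 \<le> \<bar>fst x - a\<bar> \<or> r + 1 \<le> \<bar>snd x - y\<bar> \<Longrightarrow> Z x = 0"
proof -
  define bump where "bump = (\<lambda>s. smooth_step (r + 1 - s) * smooth_step (r + 1 + s))"
  have bump_even: "bump (- s) = bump s" for s by (simp add: bump_def mult.commute)
  have bump_one: "bump s = 1" if "\<bar>s\<bar> \<le> r" for s
    using that by (simp add: bump_def smooth_step_one)
  have bump_zero: "bump s = 0" if "r + 1 \<le> \<bar>s\<bar>" for s
    using that by (cases "s \<ge> 0") (simp_all add: bump_def smooth_step_zero)
  have aff: "cutoff_bound 18 (\<lambda>x. bump (f x + c))" if f: "f = fst \<or> f = snd" for f :: "pt \<Rightarrow> real" and c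
  proof -
    have C: "C2_on UNIV f" using f by auto
    have d: "f differentiable (at x)" for x by (rule C1_onD(1)[OF C2_onD(1)[OF C]]) simp
    have pf: "\<bar>pd f i x\<bar> \<le> 1" if "i \<in> {1, 2}" for i x
      using f that by (auto simp: pd_fst pd_snd)
    have m: "C2_on UNIV (\<lambda>x. r + 1 - (f x + c))" "C2_on UNIV (\<lambda>x. r + 1 + (f x + c))"
      by (intro C2_on_diff C2_on_add C open_UNIV C2_on_const)+
    have "pd (\<lambda>x. r + 1 - (f x + c)) i x = - pd f i x" "pd (\<lambda>x. r + 1 + (f x + c)) i x = pd f i x" for i x
      using d by (simp_all add: pd_diff pd_add)
    then have "cutoff_bound (9 + 9) (\<lambda>x. smooth_step (r + 1 - (f x + c)) * smooth_step (r + 1 + (f x + c)))"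
      using pf by (intro cutoff_bound_mult cutoff_bound_step m) simp_all
    then show ?thesis by (simp add: bump_def)
  qed
  let ?Z = "\<lambda>x::pt. (1 - (1 - bump (fst x + - a)) * (1 - bump (fst x + a))) * bump (snd x + - y)"
  \<comment> \<open>Each bump is a product of two steps of slope at most 9. Complements keep the
    bound 18, and the three factors add up.\<close>
  have "cutoff_bound ((18 + 18) + 18) ?Z"
    by (intro cutoff_bound_mult cutoff_bound_compl aff) auto
  then have 1: "cutoff_bound 54 ?Z" by simp
  have 2: "?Z (refl1 x) = ?Z x" for x
  proof -
    have "bump (- fst x + - a) = bump (fst x + a)" "bump (- fst x + a) = bump (fst x + - a)"
      using bump_even[of "fst x + a"] bump_even[of "fst x + - a"] by (simp_all add: algebra_simps)
    then show ?thesis by (simp add: refl1_def mult.commute)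
  qed
  have 3: "?Z x = 1" if "0 \<le> fst x" "\<bar>fst x - a\<bar> \<le> r" "\<bar>snd x - y\<bar> \<le> r" for x
    using bump_one[of "fst x + - a"] bump_one[of "snd x + - y"] that by simp
  have 4: "?Z x = 0" if "0 \<le> fst x" "r + 1 \<le> \<bar>fst x - a\<bar> \<or> r + 1 \<le> \<bar>snd x - y\<bar>" for x
  proof (cases "r + 1 \<le> \<bar>snd x - y\<bar>")
    case True
    then show ?thesis using bump_zero[of "snd x + - y"] by simp
  next
    case False
    then have *: "r + 1 \<le> \<bar>fst x - a\<bar>" using that by simp
    \<comment> \<open>With \<open>fst x\<close> and \<open>a\<close> nonnegative, the mirrored
      centre -a is at least as far away as a.\<close>
    then have "r + 1 \<le> \<bar>fst x + a\<bar>" using that(1) assms by linarith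
    then show ?thesis using bump_zero[of "fst x + - a"] bump_zero[of "fst x + a"] * by simp
  qed
  show ?thesis using that[of ?Z] 1 2 3 4 by blast
qed

lemma integral_even_fst:
  fixes h :: "real \<times> real \<Rightarrow> real"
  assumes cont: "continuous_on (cbox (- b, c) (b, d)) h" and "0 \<le> b"
    and even: "\<And>x y. 0 \<le> x \<Longrightarrow> x \<le> b \<Longrightarrow> c \<le> y \<Longrightarrow> y \<le> d \<Longrightarrow> h (- x, y) = h (x, y)"
  shows "integral (cbox (- b, c) (b, d)) h = 2 * integral (cbox (0, c) (b, d)) h"
proof -
  have "integral (cbox (- b, c) (b, d)) h = integral (cbox c d) (\<lambda>y. integral (cbox (- b) b) (\<lambda>x. h (x, y)))"
    using integral_prod_continuous[OF cont] integral_swap_continuous[of "- b" c b d "\<lambda>x y. h (x, y)"] cont by simp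
  also have "\<dots> = integral (cbox c d) (\<lambda>y. 2 * integral (cbox 0 b) (\<lambda>x. h (x, y)))"
  proof (rule integral_cong)
    fix y assume y: "y \<in> cbox c d"
    have "continuous_on {- b..b} (\<lambda>x. h (x, y))"
      by (rule continuous_on_compose2[OF cont]) (use y in \<open>auto intro!: continuous_intros simp: cbox_Pair_eq\<close>)
    then have i: "(\<lambda>x. h (x, y)) integrable_on {- b..b}" by (rule integrable_continuous_real)
    have "integral {- b..b} (\<lambda>x. h (x, y)) = integral {- b..0} (\<lambda>x. h (x, y)) + integral {0..b} (\<lambda>x. h (x, y))"
      using Henstock_Kurzweil_Integration.integral_combine[OF _ _ i, of 0] \<open>0 \<le> b\<close> by simp
    also have "integral {- b..0} (\<lambda>x. h (x, y)) = integral {0..b} (\<lambda>x. h (- x, y))"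
      using Henstock_Kurzweil_Integration.integral_reflect_real[of b 0 "\<lambda>x. h (- x, y)"] by simp
    also have "\<dots> = integral {0..b} (\<lambda>x. h (x, y))"
      by (rule integral_cong) (use even y in auto)
    finally show "integral (cbox (- b) b) (\<lambda>x. h (x, y)) = 2 * integral (cbox 0 b) (\<lambda>x. h (x, y))" by simp
  qed
  also have "\<dots> = 2 * integral (cbox c d) (\<lambda>y. integral (cbox 0 b) (\<lambda>x. h (x, y)))" by simp
  also have "integral (cbox c d) (\<lambda>y. integral (cbox 0 b) (\<lambda>x. h (x, y))) = integral (cbox (0, c) (b, d)) h"
  proof -
    have "continuous_on (cbox (0, c) (b, d)) h"
      by (rule continuous_on_subset[OF cont]) (use \<open>0 \<le> b\<close> in \<open>auto simp: cbox_Pair_eq\<close>)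
    then show ?thesis
      using integral_prod_continuous[of 0 c b d h] integral_swap_continuous[of 0 c b d "\<lambda>x y. h (x, y)"] by simp
  qed
  finally show ?thesis .
qed

text \<open>Differentiate f composed with the reflection, which equals -f near x: the reflection
  negates the first unit vector and fixes the second.\<close>

lemma pd_odd_reflection:
  assumes S: "open S" "x \<in> S" "refl1 x \<in> S" and f: "\<And>y. y \<in> S \<Longrightarrow> f differentiable (at y)"
    and odd: "\<And>y. y \<in> S \<Longrightarrow> f (refl1 y) = - f y"
  shows "pd f 1 (refl1 x) = pd f 1 x" "pd f 2 (refl1 x) = - pd f 2 x"
proof -
  let ?D = "frechet_derivative f (at (refl1 x))"
  have lin: "(refl1 has_derivative refl1) (at x)"
    unfolding refl1_def[abs_def] by (auto intro!: derivative_eq_intros)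
  have "((\<lambda>y. f (refl1 y)) has_derivative (\<lambda>h. ?D (refl1 h))) (at x)"
    by (rule has_derivative_compose[OF lin]) (rule has_derivative_frechet[OF f[OF S(3)]])
  then have "pd (\<lambda>y. f (refl1 y)) i x = ?D (refl1 (evec i))" for i by (rule pd_eq)
  moreover have "pd (\<lambda>y. f (refl1 y)) i x = pd (\<lambda>y. - f y) i x" for i
    by (rule pd_cong_open[OF S(1,2)]) (simp add: odd)
  moreover have "pd (\<lambda>y. - f y) i x = - pd f i x" for i
    using pd_eq[OF has_derivative_minus[OF has_derivative_frechet[OF f[OF S(2)]]]] by (simp add: pd_def)
  ultimately have e: "?D (refl1 (evec i)) = - pd f i x" for i by metis
  have D: "linear ?D"
    by (rule bounded_linear.linear[OF has_derivative_bounded_linear[OF has_derivative_frechet[OF f[OF S(3)]]]])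
  have "?D (refl1 (evec 1)) = - ?D (evec 1)"
    using linear_neg[OF D, of "evec 1"] by (simp add: refl1_def)
  then show "pd f 1 (refl1 x) = pd f 1 x" using e[of 1] by (simp add: pd_def)
  have "?D (refl1 (evec 2)) = ?D (evec 2)" by (simp add: refl1_def)
  then show "pd f 2 (refl1 x) = - pd f 2 x" using e[of 2] by (simp add: pd_def)
qed

section \<open>The calibrated energy density\<close>

text \<open>Here t stands for v(x_1), so p(t) is the slope of the profile, and w, w1, w2 stand for
  the deviation and its partial derivatives. The second square comes from (p(t) + w1)^2 / 2 + p(t +
  w)^2 / 2 - p(t + w) (p(t) + w1). The weighted bracket is the x_1-derivative of exp(-l v)
  w^2.\<close>

definition calibrated_density :: "(real \<Rightarrow> real) \<Rightarrow> real \<Rightarrow> real \<Rightarrow> real \<Rightarrow> real \<Rightarrow> real \<Rightarrow> real \<Rightarrow> real" where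
  "calibrated_density W c l t w w1 w2 =
     w2\<^sup>2 / 2 + (w1 - (well_root W (t + w) - well_root W t))\<^sup>2 / 2
     - c / 4 * exp (- l * t) * (2 * w * w1 - l * well_root W t * w\<^sup>2)"

context double_well begin

text \<open>Put f = w1 - (p(t + w) - p(t)). The one-sided bound for p and the weight give 2 w w1 - l
  p(t) w^2 <= 2 w f - 2 c w^2, and Young's inequality bounds this by f^2 / c - c w^2. With the
  factor c / 4 the added term uses up at most half of f^2 / 2 and leaves a positive multiple of w^2;
  w1 is recovered from f and the Lipschitz bound of p.\<close>

lemma calibrated_density_bounds:
  assumes "B \<ge> 2"
  obtains c l k0 K0 L where "0 < c" "0 < l" "0 < k0" "0 < K0" "0 < L"
    "\<And>t. 0 \<le> t \<Longrightarrow> t \<le> 1 \<Longrightarrow> \<bar>p t\<bar> \<le> L"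
    "\<And>t w w1 w2. 0 \<le> t \<Longrightarrow> t \<le> 1 \<Longrightarrow> 0 \<le> t + w \<Longrightarrow> t + w \<le> B \<Longrightarrow>
      k0 * (w\<^sup>2 + w1\<^sup>2 + w2\<^sup>2) \<le> calibrated_density W c l t w w1 w2"
    "\<And>t w w1 w2. 0 \<le> t \<Longrightarrow> t \<le> 1 \<Longrightarrow> 0 \<le> t + w \<Longrightarrow> t + w \<le> B \<Longrightarrow>
      calibrated_density W c l t w w1 w2 \<le> K0 * (w\<^sup>2 + w1\<^sup>2 + w2\<^sup>2)"
proof -
  obtain c \<kappa> c1 \<Lambda> where c: "c > 0" "\<kappa> > 0" "c1 > 0" "\<Lambda> > 0"
    and low: "\<And>t. 0 \<le> t \<Longrightarrow> t \<le> 1 \<Longrightarrow> c1 * (1 - t) \<le> p t"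
    and lip: "\<And>s t. 0 \<le> s \<Longrightarrow> s \<le> B \<Longrightarrow> 0 \<le> t \<Longrightarrow> t \<le> B \<Longrightarrow> \<bar>p s - p t\<bar> \<le> \<Lambda> * \<bar>s - t\<bar>"
    and one: "\<And>s t. 0 \<le> s \<Longrightarrow> s \<le> B \<Longrightarrow> 0 \<le> t \<Longrightarrow> t \<le> 1 \<Longrightarrow>
       (p s - p t) * (s - t) \<le> (- c + \<kappa> * (1 - t)) * (s - t)\<^sup>2"
    using p_one_sided_lipschitz[OF assms] by blast
  \<comment> \<open>Makes l p(t) >= 2 \<kappa> (1 - t), which cancels the deficit of the one-sided
    bound; the 2 is that of 2 w w1.\<close>
  define l where "l = 2 * \<kappa> / c1"
  define k where "k = c\<^sup>2 / 4 * exp (- l)"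
  \<comment> \<open>Since w1^2 <= 2 f^2 + 2 \<Lambda>^2 w^2, the bounds 2 k0 <= 1/4 and k0 (1 + 2
    \<Lambda>^2) <= \<open>k\<close> are what is required. The factor exp(-l) in \<open>k\<close> is
    the smallest weight for t <= 1.\<close>
  define k0 where "k0 = min (1/8) (k / (1 + 2 * \<Lambda>\<^sup>2))"
  define K0 where "K0 = 1 + \<Lambda>\<^sup>2 + c / 4 * (1 + l * \<Lambda>)"
  have l: "l > 0" "l * c1 = 2 * \<kappa>" using c by (auto simp: l_def)
  have k: "k > 0" using c by (simp add: k_def)
  have den: "1 + 2 * \<Lambda>\<^sup>2 > 0" by (rule add_pos_nonneg) auto
  have k0: "k0 > 0" "k0 \<le> 1/8" "k0 * (1 + 2 * \<Lambda>\<^sup>2) \<le> k"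
  proof -
    show "k0 > 0" using k den by (simp add: k0_def)
    show "k0 \<le> 1/8" unfolding k0_def by (rule min.cobounded1)
    have "k0 \<le> k / (1 + 2 * \<Lambda>\<^sup>2)" unfolding k0_def by (rule min.cobounded2)
    then show "k0 * (1 + 2 * \<Lambda>\<^sup>2) \<le> k" using den by (simp add: pos_le_divide_eq)
  qed
  have K0: "K0 > 0" using c l by (auto simp: K0_def intro!: add_pos_nonneg)
  have pt: "\<bar>p t\<bar> \<le> \<Lambda>" "0 \<le> p t" if "0 \<le> t" "t \<le> 1" for t
  proof -
    have "\<bar>p t\<bar> \<le> \<Lambda> * \<bar>t - 1\<bar>" using lip[of t 1] that assms by simp
    also have "\<dots> \<le> \<Lambda> * 1" using that c by (intro mult_left_mono) auto
    finally show "\<bar>p t\<bar> \<le> \<Lambda>" by simp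
    show "0 \<le> p t" by (rule p_sign(1)[OF that])
  qed
  have lower: "k0 * (w\<^sup>2 + w1\<^sup>2 + w2\<^sup>2) \<le> calibrated_density W c l t w w1 w2"
    if t: "0 \<le> t" "t \<le> 1" and tw: "0 \<le> t + w" "t + w \<le> B" for t w w1 w2
  proof -
    define D where "D = p (t + w) - p t"
    define f where "f = w1 - D"
    define m where "m = exp (- l * t)"
    have m: "0 < m" "m \<le> 1" "exp (- l) \<le> m"
      using l t by (auto simp: m_def mult_le_cancel_left1)
    have D1: "D * w \<le> (- c + \<kappa> * (1 - t)) * w\<^sup>2" using one[OF tw t] by (simp add: D_def)
    have D2: "D\<^sup>2 \<le> \<Lambda>\<^sup>2 * w\<^sup>2"
    proof -
      have "\<bar>D\<bar> \<le> \<Lambda> * \<bar>w\<bar>" using lip[OF tw t(1)] t assms by (simp add: D_def)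
      then have "\<bar>D\<bar>\<^sup>2 \<le> (\<Lambda> * \<bar>w\<bar>)\<^sup>2" by (rule power_mono) simp
      then show ?thesis by (simp add: power_mult_distrib)
    qed
    have "2 * \<kappa> * (1 - t) * w\<^sup>2 \<le> l * p t * w\<^sup>2"
    proof (rule mult_right_mono)
      have "2 * \<kappa> * (1 - t) = l * (c1 * (1 - t))" by (simp add: l(2)[symmetric] mult.assoc)
      also have "\<dots> \<le> l * p t" using low[OF t] l by (intro mult_left_mono) auto
      finally show "2 * \<kappa> * (1 - t) \<le> l * p t" .
    qed simp
    then have "2 * w * w1 - l * p t * w\<^sup>2 \<le> 2 * (w * f) - 2 * c * w\<^sup>2"
      using D1 by (simp add: f_def algebra_simps)
    moreover have "2 * (w * f) \<le> f\<^sup>2 / c + c * w\<^sup>2"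
    proof -
      have "0 \<le> (f - c * w)\<^sup>2 / c" using c by simp
      also have "\<dots> = f\<^sup>2 / c + c * w\<^sup>2 - 2 * (w * f)"
        using c by (simp add: power2_eq_square field_simps)
      finally show ?thesis by simp
    qed
    ultimately have "2 * w * w1 - l * p t * w\<^sup>2 \<le> f\<^sup>2 / c - c * w\<^sup>2" by linarith
    then have "c / 4 * m * (2 * w * w1 - l * p t * w\<^sup>2) \<le> c / 4 * m * (f\<^sup>2 / c - c * w\<^sup>2)"
      using c m by (intro mult_left_mono) auto
    also have "\<dots> = m * (f\<^sup>2 / 4) - m * (c\<^sup>2 / 4 * w\<^sup>2)"
      using c by (simp add: power2_eq_square field_simps)
    also have "\<dots> \<le> 1 * (f\<^sup>2 / 4) - exp (- l) * (c\<^sup>2 / 4 * w\<^sup>2)"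
      using m by (intro diff_mono mult_right_mono) auto
    finally have A: "c / 4 * m * (2 * w * w1 - l * p t * w\<^sup>2) \<le> f\<^sup>2 / 4 - k * w\<^sup>2"
      by (simp add: k_def mult_ac)
    have "calibrated_density W c l t w w1 w2
        = w2\<^sup>2 / 2 + f\<^sup>2 / 2 - c / 4 * m * (2 * w * w1 - l * p t * w\<^sup>2)"
      by (simp add: calibrated_density_def f_def D_def m_def)
    then have H: "w2\<^sup>2 / 2 + f\<^sup>2 / 4 + k * w\<^sup>2 \<le> calibrated_density W c l t w w1 w2" using A by linarith
    have w1: "w1\<^sup>2 \<le> 2 * f\<^sup>2 + 2 * D\<^sup>2"
      using zero_le_power2[of "f - D"] by (simp add: f_def power2_eq_square algebra_simps)
    have "k0 * (w\<^sup>2 + w1\<^sup>2 + w2\<^sup>2) \<le> k0 * ((1 + 2 * \<Lambda>\<^sup>2) * w\<^sup>2 + 2 * f\<^sup>2 + w2\<^sup>2)"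
      using w1 D2 k0 by (intro mult_left_mono) (auto simp: algebra_simps)
    also have "\<dots> = (k0 * (1 + 2 * \<Lambda>\<^sup>2)) * w\<^sup>2 + (2 * k0) * f\<^sup>2 + k0 * w2\<^sup>2"
      by (simp add: algebra_simps)
    also have "\<dots> \<le> k * w\<^sup>2 + (1/4) * f\<^sup>2 + (1/2) * w2\<^sup>2"
      using k0 by (intro add_mono mult_right_mono) auto
    finally show ?thesis using H by simp
  qed
  have upper: "calibrated_density W c l t w w1 w2 \<le> K0 * (w\<^sup>2 + w1\<^sup>2 + w2\<^sup>2)"
    if t: "0 \<le> t" "t \<le> 1" and tw: "0 \<le> t + w" "t + w \<le> B" for t w w1 w2
  proof -
    define D where "D = p (t + w) - p t"
    define m where "m = exp (- l * t)"
    have m: "0 < m" "m \<le> 1" using l t by (auto simp: m_def)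
    have D2: "D\<^sup>2 \<le> \<Lambda>\<^sup>2 * w\<^sup>2"
    proof -
      have "\<bar>D\<bar> \<le> \<Lambda> * \<bar>w\<bar>" using lip[OF tw t(1)] t assms by (simp add: D_def)
      then have "\<bar>D\<bar>\<^sup>2 \<le> (\<Lambda> * \<bar>w\<bar>)\<^sup>2" by (rule power_mono) simp
      then show ?thesis by (simp add: power_mult_distrib)
    qed
    have a: "(w1 - D)\<^sup>2 \<le> 2 * w1\<^sup>2 + 2 * (\<Lambda>\<^sup>2 * w\<^sup>2)"
      using zero_le_power2[of "w1 + D"] D2 by (simp add: power2_eq_square algebra_simps)
    have "l * p t * w\<^sup>2 \<le> l * \<Lambda> * w\<^sup>2"
      using pt[OF t] l by (intro mult_right_mono mult_left_mono) auto
    then have b: "- (2 * w * w1 - l * p t * w\<^sup>2) \<le> w\<^sup>2 + w1\<^sup>2 + l * \<Lambda> * w\<^sup>2"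
      using zero_le_power2[of "w + w1"] by (simp add: power2_eq_square algebra_simps)
    have nn: "0 \<le> w\<^sup>2 + w1\<^sup>2 + l * \<Lambda> * w\<^sup>2" using l c by simp
    have "m * - (2 * w * w1 - l * p t * w\<^sup>2) \<le> m * (w\<^sup>2 + w1\<^sup>2 + l * \<Lambda> * w\<^sup>2)"
      using m b by (intro mult_left_mono) auto
    also have "\<dots> \<le> 1 * (w\<^sup>2 + w1\<^sup>2 + l * \<Lambda> * w\<^sup>2)"
      using m nn by (intro mult_right_mono) auto
    finally have "c / 4 * (m * - (2 * w * w1 - l * p t * w\<^sup>2)) \<le> c / 4 * (w\<^sup>2 + w1\<^sup>2 + l * \<Lambda> * w\<^sup>2)"
      using c by (intro mult_left_mono) auto
    moreover have "calibrated_density W c l t w w1 w2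
        = w2\<^sup>2 / 2 + (w1 - D)\<^sup>2 / 2 + c / 4 * (m * - (2 * w * w1 - l * p t * w\<^sup>2))"
      unfolding calibrated_density_def D_def m_def mult.assoc mult_minus_right by (rule diff_conv_add_uminus)
    ultimately have "calibrated_density W c l t w w1 w2
        \<le> w2\<^sup>2 / 2 + (w1\<^sup>2 + \<Lambda>\<^sup>2 * w\<^sup>2) + c / 4 * (w\<^sup>2 + w1\<^sup>2 + l * \<Lambda> * w\<^sup>2)"
      using a by argo
    also have "\<dots> \<le> K0 * (w\<^sup>2 + w1\<^sup>2 + w2\<^sup>2)"
    proof -
      have "K0 * (w\<^sup>2 + w1\<^sup>2 + w2\<^sup>2)
          - (w2\<^sup>2 / 2 + (w1\<^sup>2 + \<Lambda>\<^sup>2 * w\<^sup>2) + c / 4 * (w\<^sup>2 + w1\<^sup>2 + l * \<Lambda> * w\<^sup>2))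
        = w\<^sup>2 + (\<Lambda>\<^sup>2 + c / 4 * (l * \<Lambda>)) * w1\<^sup>2 + (1/2 + \<Lambda>\<^sup>2 + c / 4 * (1 + l * \<Lambda>)) * w2\<^sup>2"
        by (simp add: K0_def field_simps)
      also have "\<dots> \<ge> 0" using c l by (intro add_nonneg_nonneg mult_nonneg_nonneg) auto
      finally show ?thesis by simp
    qed
    finally show ?thesis .
  qed
  show ?thesis by (rule that[OF c(1) l(1) k0(1) K0 c(4) pt(1) lower upper])
qed

lemma calibrated_density_zero [simp]: "calibrated_density W c l t 0 0 0 = 0"
  by (simp add: calibrated_density_def)

lemma energy_calibration:
  "(p t + w1)\<^sup>2 / 2 + w2\<^sup>2 / 2 + W (t + w) = calibrated_density W c l t w w1 w2 + p (t + w) * (p t + w1)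
     + c / 4 * exp (- l * t) * (2 * w * w1 - l * p t * w\<^sup>2)"
proof -
  have "W (t + w) = (p (t + w))\<^sup>2 / 2" by (simp add: p_sq)
  then show ?thesis by (simp add: calibrated_density_def power2_eq_square field_simps)
qed

end

section \<open>Hole filling\<close>

context double_well begin

lemma p_antiderivative: "\<exists>G. \<forall>s. (G has_real_derivative p s) (at s)"
proof -
  define G where "G = (\<lambda>s. integral {0..s} p - integral {s..0} p)"
  have "(G has_real_derivative p s) (at s)" for s
  proof -
    define b where "b = \<bar>s\<bar> + 1"
    have int: "p integrable_on {x..y}" for x y
      by (rule integrable_continuous_real[OF continuous_on_p])
    \<comment> \<open>A lower limit below both 0 and s turns the signed integral from 0 into one
      with a fixed lower limit, up to a constant, on both sides of 0.\<close>
    have eq: "G x = integral {- b..x} p - integral {- b..0} p" if "- b \<le> x" for x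
    proof (cases "0 \<le> x")
      case True
      have "integral {- b..0} p + integral {0..x} p = integral {- b..x} p"
        by (rule Henstock_Kurzweil_Integration.integral_combine[OF _ True int]) (simp add: b_def)
      moreover have "integral {x..0} p = 0" using True by (cases "x = 0") auto
      ultimately show ?thesis by (simp add: G_def)
    next
      case False
      have "integral {- b..x} p + integral {x..0} p = integral {- b..0} p"
        by (rule Henstock_Kurzweil_Integration.integral_combine[OF that _ int]) (use False in simp)
      moreover have "integral {0..x} p = 0" using False by simp
      ultimately show ?thesis by (simp add: G_def)
    qed
    have sb: "- b < s" "s < b" by (auto simp: b_def)
    have "((\<lambda>x. integral {- b..x} p) has_real_derivative p s) (at s within {- b..b})"
      by (rule integral_has_real_derivative[OF continuous_on_p]) (use sb in auto)
    then have "((\<lambda>x. integral {- b..x} p - integral {- b..0} p) has_real_derivative p s - 0) (at s within {- b..b})"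
      by (intro DERIV_diff DERIV_const)
    then have "((\<lambda>x. integral {- b..x} p - integral {- b..0} p) has_real_derivative p s) (at s)"
      using at_within_interior[of s "{- b..b}"] sb by simp
    moreover have "\<forall>\<^sub>F x in nhds s. x \<in> {- b<..}"
      using sb by (intro eventually_nhds_in_open) auto
    then have "\<forall>\<^sub>F x in nhds s. G x = integral {- b..x} p - integral {- b..0} p"
      by eventually_elim (simp add: eq)
    ultimately show ?thesis by (rule iffD2[OF DERIV_cong_ev[OF refl _ refl], rotated])
  qed
  then show ?thesis by blast
qed

end

text \<open>Minimality enters as nonnegativity of the energy excess over boxes, the form that
  survives the limit. The constants are parameters fixed in advance, so the decay rate is expressed
  through them alone.\<close>

locale odd_minimizer = double_well +
  fixes v :: "real \<Rightarrow> real" and u :: "pt \<Rightarrow> real" and S :: "pt set" and B c l k0 K0 L :: real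
  assumes v1: "(v has_real_derivative deriv v s) (at s)"
    and v2: "(deriv v has_real_derivative W' (v s)) (at s)"
    and v_odd: "v (- s) = - v s" and v_lim: "(v \<longlongrightarrow> 1) at_top"
    and B: "2 \<le> B" and k: "0 < k0" "0 < K0" "0 < L"
    and p_bound: "0 \<le> t \<Longrightarrow> t \<le> 1 \<Longrightarrow> \<bar>p t\<bar> \<le> L"
    and cal_lower: "0 \<le> t \<Longrightarrow> t \<le> 1 \<Longrightarrow> 0 \<le> t + z \<Longrightarrow> t + z \<le> B \<Longrightarrow>
      k0 * (z\<^sup>2 + z1\<^sup>2 + z2\<^sup>2) \<le> calibrated_density W c l t z z1 z2"
    and cal_upper: "0 \<le> t \<Longrightarrow> t \<le> 1 \<Longrightarrow> 0 \<le> t + z \<Longrightarrow> t + z \<le> B \<Longrightarrow>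
      calibrated_density W c l t z z1 z2 \<le> K0 * (z\<^sup>2 + z1\<^sup>2 + z2\<^sup>2)"
    and S: "open S" "sym_set S" "convex_in_x1 S"
    and u: "C2_on S u" "x \<in> S \<Longrightarrow> u (refl1 x) = - u x" "x \<in> plus_part S \<Longrightarrow> 0 \<le> u x"
      "x \<in> S \<Longrightarrow> \<bar>u x\<bar> \<le> B"
    and u_grad: "x \<in> S \<Longrightarrow> \<bar>pd u 1 x\<bar> \<le> B" "x \<in> S \<Longrightarrow> \<bar>pd u 2 x\<bar> \<le> B"
    and min: "C2_on UNIV f \<Longrightarrow> (\<And>x. x \<notin> cbox a b \<Longrightarrow> f x = 0) \<Longrightarrow> cbox a b \<subseteq> S \<Longrightarrow>
      (\<And>x. x \<in> S \<Longrightarrow> f (refl1 x) = - f x) \<Longrightarrow> 0 \<le> integral (cbox a b) (energy_excess W u f)"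
begin

definition w :: "pt \<Rightarrow> real" where "w x = u x - v (fst x)"

definition N :: "pt \<Rightarrow> real" where "N x = (w x)\<^sup>2 + (pd w 1 x)\<^sup>2 + (pd w 2 x)\<^sup>2"

text \<open>A square clipped at the axis, because the density is controlled only for x_1 >=
  0.\<close>

definition P :: "pt \<Rightarrow> real \<Rightarrow> pt set" where
  "P x s = cbox (max 0 (fst x - s), snd x - s) (fst x + s, snd x + s)"

lemmas profile = profile_ode[OF v1 v2 v_odd v_lim] profile_nonneg[OF v1 v2 v_odd v_lim]
  profile_abs_less_one[OF v1 v2 v_odd v_lim]

lemma C2_profile: "C2_on S (\<lambda>x. v (fst x))"
proof (rule C2_on_compose[OF S(1) C2_on_fst v1 v2])
  show "continuous_on UNIV (\<lambda>s. W' (v s))"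
    by (rule continuous_on_compose2[OF continuous_on_W'[of UNIV] profile_continuous[OF v1 v2 v_odd v_lim]]) simp
qed

lemma C2_w: "C2_on S w" 
  unfolding w_def[abs_def] by (rule C2_on_diff[OF S(1) u(1) C2_profile])

lemma pd_profile: "pd (\<lambda>x. v (fst x)) 1 x = p (v (fst x))" "pd (\<lambda>x. v (fst x)) 2 x = 0"
proof -
  have "fst differentiable (at x)" by (rule C1_onD(1)[OF C2_onD(1)[OF C2_on_fst[of UNIV]]]) simp
  then show "pd (\<lambda>x. v (fst x)) 1 x = p (v (fst x))" "pd (\<lambda>x. v (fst x)) 2 x = 0"
    using pd_compose[where F = v and f = fst and x = x and i = 1, OF v1]
      pd_compose[where F = v and f = fst and x = x and i = 2, OF v1]
    by (simp_all add: pd_fst profile(1))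
qed

lemma differentiable_in_S:
  assumes "x \<in> S"
  shows "u differentiable (at x)" "(\<lambda>x. v (fst x)) differentiable (at x)" "w differentiable (at x)"
  using C1_onD(1)[OF C2_onD(1) assms] u(1) C2_profile C2_w by blast+

lemma pd_u_eq:
  assumes "x \<in> S" shows "pd u 1 x = p (v (fst x)) + pd w 1 x" "pd u 2 x = pd w 2 x"
  unfolding w_def[abs_def] using differentiable_in_S[OF assms] by (simp_all add: pd_diff pd_profile del: One_nat_def)

lemma w_odd:
  assumes "x \<in> S" shows "w (refl1 x) = - w x"
  using u(2)[OF assms] v_odd[of "fst x"] by (simp add: w_def) (simp add: refl1_def)

text \<open>The calibrated densities of \<open>u\<close> and of its competitor differ from the energy densities by the
  \<open>x\<^sub>1\<close>-derivative of a function that vanishes on the axis and on the outer boundary. The constant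
  is \<open>1 + 4 * 54\<^sup>2\<close>, where 54 bounds the gradient of the cutoff.\<close>
lemma hole_filling:
  assumes r: "0 \<le> r" "0 \<le> a"
    and Q: "cbox (- (a + r + 1), y - (r + 1)) (a + r + 1, y + (r + 1)) \<subseteq> S"
  shows "(11665 * K0 + k0) * integral (P (a, y) r) N \<le> 11665 * K0 * integral (P (a, y) (r + 1)) N"
proof -
  let ?L = "a + r + 1"
  let ?P = "P (a, y)"
  let ?Q = "cbox (- ?L, y - (r + 1)) (?L, y + (r + 1))"
  let ?H = "cbox (0, y - (r + 1)) (?L, y + (r + 1))"
  have v01: "0 \<le> v s" "v s \<le> 1" if "0 \<le> s" for s
    using profile(2)[OF that] profile(3)[of s] by auto
  have HQ: "?H \<subseteq> ?Q" using r by (auto simp: cbox_Pair_eq)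
  have HS: "?H \<subseteq> S" using HQ Q by blast
  have uH: "0 \<le> u x" "u x \<le> B" if "x \<in> ?H" for x
  proof -
    have x: "0 \<le> fst x" "x \<in> S" using that HS by (auto simp: cbox_Pair_eq)
    show "u x \<le> B" using u(4)[OF x(2)] by simp
    \<comment> \<open>The sign of u is given for x_1 > 0; on the axis oddness makes u zero.\<close>
    show "0 \<le> u x"
    proof (cases "fst x = 0")
      case True
      then have "refl1 x = x" by (simp add: refl1_def prod_eq_iff)
      then show ?thesis using u(2)[OF x(2)] by simp
    next
      case False
      then show ?thesis using x u(3) by (simp add: plus_part_def)
    qed
  qed
  note C2v = C2_profile and C2w = C2_w and dS = differentiable_in_S and pdu = pd_u_eq
  have uw: "u x = v (fst x) + w x" for x by (simp add: w_def)
  obtain Z where Z: "cutoff_bound 54 Z" "\<And>x. Z (refl1 x) = Z x"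
    "\<And>x. 0 \<le> fst x \<Longrightarrow> \<bar>fst x - a\<bar> \<le> r \<Longrightarrow> \<bar>snd x - y\<bar> \<le> r \<Longrightarrow> Z x = 1"
    "\<And>x. 0 \<le> fst x \<Longrightarrow> r + 1 \<le> \<bar>fst x - a\<bar> \<or> r + 1 \<le> \<bar>snd x - y\<bar> \<Longrightarrow> Z x = 0"
    using even_square_cutoff[OF r] by blast
  have Zd: "Z differentiable (at x)" for x by (rule cutoff_boundD(5)[OF Z(1)])
  have Z_off: "Z x = 0" if "?L \<le> \<bar>fst x\<bar> \<or> r + 1 \<le> \<bar>snd x - y\<bar>" for x
  proof (cases "0 \<le> fst x")
    case True
    then show ?thesis using that r by (intro Z(4)) auto
  next
    case False
    then have "Z (refl1 x) = 0" using that r by (intro Z(4)) (auto simp: refl1_def)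
    then show ?thesis by (simp add: Z(2))
  qed
  \<comment> \<open>Then u + f = (1 - Z) u + Z v: the profile on the inner window and u outside the
    larger one. Since Z is even and w odd, f is odd.\<close>
  define f where "f = (\<lambda>x. (0 - Z x) * w x)"
  have f_off: "f x = 0" if "?L \<le> \<bar>fst x\<bar> \<or> r + 1 \<le> \<bar>snd x - y\<bar>" for x
    using Z_off[OF that] by (simp add: f_def)
  have f_offQ: "f x = 0" if "x \<notin> ?Q" for x
    by (rule f_off) (use that in \<open>cases x; auto simp: cbox_Pair_eq\<close>)
  have C2fS: "C2_on S f"
    unfolding f_def
    by (intro C2_on_mult C2_on_diff S(1) C2w C2_on_const C2_on_subset[OF cutoff_boundD(1)[OF Z(1)]]) simp
  \<comment> \<open>Regularity of w is known only in S, but f vanishes off the closed box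
    \<open>?Q\<close> contained in S.\<close>
  have C2f: "C2_on UNIV f"
    by (rule C2_on_UNIV_zero_extension[OF S(1) closed_cbox Q C2fS f_offQ])
  have f_odd: "f (refl1 x) = - f x" if "x \<in> S" for x
    using w_odd[OF that] Z(2) by (simp add: f_def)
  have fd: "f differentiable (at x)" for x by (rule C1_onD(1)[OF C2_onD(1)[OF C2f]]) simp
  have pdf: "pd f i x = - (Z x * pd w i x + pd Z i x * w x)" if "x \<in> S" "i \<in> {1, 2}" for i x
    unfolding f_def using dS(3)[OF that(1)] Zd[of x]
    by (subst pd_mult) (auto intro: differentiable_diff simp: pd_minus algebra_simps)
  let ?E = "energy_excess W u f"
  have E_cont: "continuous_on S ?E"
    by (rule continuous_on_energy_excess[OF continuous_on_W C2_onD(1)[OF u(1)] C2_onD(1)[OF C2f]])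
  have E_even: "?E (- s, t) = ?E (s, t)" if "(s, t) \<in> S" for s t
  proof -
    have rS: "refl1 (s, t) \<in> S" using S(2) that by (simp add: sym_set_def)
    have eq: "refl1 (s, t) = (- s, t)" by (simp add: refl1_def)
    note pu = pd_odd_reflection[OF S(1) that rS dS(1) u(2)]
    note pf = pd_odd_reflection[OF S(1) that rS fd f_odd]
    have "W (u (refl1 (s, t)) + f (refl1 (s, t))) = W (u (s, t) + f (s, t))"
      using W_even[of "u (s, t) + f (s, t)"] u(2)[OF that] f_odd[OF that] by simp
    moreover have "W (u (refl1 (s, t))) = W (u (s, t))" using u(2)[OF that] W_even by simp
    ultimately show ?thesis unfolding eq[symmetric] energy_excess_def by (simp add: pu pf del: One_nat_def)
  qed
  have "0 \<le> integral ?Q ?E"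
    by (rule min[OF C2f f_offQ Q f_odd])
  \<comment> \<open>Evenness of the integrand moves the inequality from the symmetric box to its
    right half, where u lies in [0, B].\<close>
  also have "integral ?Q ?E = 2 * integral ?H ?E"
  proof (rule integral_even_fst)
    show "continuous_on ?Q ?E" by (rule continuous_on_subset[OF E_cont Q])
    show "0 \<le> ?L" using r by simp
    fix s t assume "0 \<le> s" "s \<le> ?L" "y - (r + 1) \<le> t" "t \<le> y + (r + 1)"
    then have "(s, t) \<in> ?H" by (simp add: cbox_Pair_eq)
    then show "?E (- s, t) = ?E (s, t)" using HS E_even by blast
  qed
  finally have pos: "0 \<le> integral ?H ?E" by simp
  obtain G where G: "\<And>s. (G has_real_derivative p s) (at s)" using p_antiderivative by blast
  define m where "m = (\<lambda>x::pt. exp (- l * v (fst x)))"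
  \<comment> \<open>Difference of the calibrating potentials of u + f and u, up to sign. It vanishes
    wherever f does, and \<open>g\<close> below is its x_1-derivative.\<close>
  define \<psi> where "\<psi> = (\<lambda>x. G (u x + f x) - G (u x) + c / 4 * (m x * ((w x + f x)\<^sup>2 - (w x)\<^sup>2)))"
  define g where "g = (\<lambda>x. p (u x + f x) * (pd u 1 x + pd f 1 x) - p (u x) * pd u 1 x
      + c / 4 * (m x * (2 * (w x + f x) * (pd w 1 x + pd f 1 x) - l * p (v (fst x)) * (w x + f x)\<^sup>2
        - (2 * w x * pd w 1 x - l * p (v (fst x)) * (w x)\<^sup>2))))"
  have contH: "continuous_on ?H u" "continuous_on ?H w" "continuous_on ?H f"
    "continuous_on ?H (pd u 1)" "continuous_on ?H (pd w 1)" "continuous_on ?H (pd f 1)"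
    "continuous_on ?H (pd w 2)" "continuous_on ?H (\<lambda>x. v (fst x))"
    using C1_onD(2,3)[OF C1_on_subset[OF C2_onD(1)[OF u(1)] HS]]
      C1_onD(2,3)[OF C1_on_subset[OF C2_onD(1)[OF C2w] HS]]
      C1_onD(2,3)[OF C1_on_subset[OF C2_onD(1)[OF C2fS] HS]]
      C1_onD(2,3)[OF C1_on_subset[OF C2_onD(1)[OF C2v] HS]] by auto
  have p_cont: "continuous_on ?H (\<lambda>x. p (h x))" if "continuous_on ?H h" for h
    by (rule continuous_on_compose2[OF continuous_on_p[of UNIV] that]) simp
  have g_cont: "continuous_on ?H g"
    unfolding g_def m_def by (intro continuous_intros p_cont contH)
  have g_zero: "integral ?H g = 0"
  proof (rule integral_deriv_fst_zero[where f = \<psi>])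
    show "continuous_on ?H g" by (rule g_cont)
    show "0 \<le> ?L" using r by simp
    show "\<psi> (0, t) = \<psi> (?L, t)" if "y - (r + 1) \<le> t" "t \<le> y + (r + 1)" for t
    proof -
      \<comment> \<open>Points of the axis are fixed by the reflection, so w and f vanish there;
        this removes the boundary term on the axis.\<close>
      have "(0, t) \<in> S" using that r HS by (auto simp: cbox_Pair_eq)
      then have "w (0, t) = 0" using w_odd[of "(0, t)"] by (simp add: refl1_def)
      then have "f (0, t) = 0" by (simp add: f_def)
      moreover have "f (?L, t) = 0" by (rule f_off) (use r in auto)
      ultimately show ?thesis by (simp add: \<psi>_def)
    qed
    fix s t assume "0 \<le> s" "s \<le> ?L" "y - (r + 1) \<le> t" "t \<le> y + (r + 1)"
    then have "(s, t) \<in> ?H" by (simp add: cbox_Pair_eq)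
    then have st: "(s, t) \<in> S" using HS by blast
    have du: "((\<lambda>s. u (s, t)) has_real_derivative pd u 1 (s, t)) (at s)"
      and dw: "((\<lambda>s. w (s, t)) has_real_derivative pd w 1 (s, t)) (at s)"
      and df: "((\<lambda>s. f (s, t)) has_real_derivative pd f 1 (s, t)) (at s)"
      using pd_slice(1) dS[OF st] fd by blast+
    have dv: "(v has_real_derivative p (v s)) (at s)" using v1[of s] by (simp add: profile(1))
    have dm: "((\<lambda>s. m (s, t)) has_real_derivative m (s, t) * (- l * p (v s))) (at s)"
      unfolding m_def fst_conv by (rule DERIV_fun_exp[OF DERIV_cmult[OF dv]])
    have 1: "((\<lambda>s. G (u (s, t) + f (s, t))) has_real_derivative
        p (u (s, t) + f (s, t)) * (pd u 1 (s, t) + pd f 1 (s, t))) (at s)"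
      by (rule DERIV_chain2[OF G DERIV_add[OF du df]])
    have 2: "((\<lambda>s. G (u (s, t))) has_real_derivative p (u (s, t)) * pd u 1 (s, t)) (at s)"
      by (rule DERIV_chain2[OF G du])
    have sq: "((\<lambda>s. (h s)\<^sup>2) has_real_derivative 2 * h s * h') (at s)"
      if "(h has_real_derivative h') (at s)" for h h'
      using DERIV_power[OF that, of 2] by (simp add: mult_ac)
    have "((\<lambda>s. \<psi> (s, t)) has_real_derivative g (s, t)) (at s)"
      unfolding \<psi>_def g_def
      by (rule DERIV_cong[OF DERIV_add[OF DERIV_diff[OF 1 2]
            DERIV_cmult[OF DERIV_mult[OF dm DERIV_diff[OF sq[OF DERIV_add[OF dw df]] sq[OF dw]]]]]])
         (simp add: algebra_simps)
    then show "((\<lambda>s. \<psi> (s, t)) has_real_derivative g (s, t)) (at s within {0..?L})"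
      by (rule has_field_derivative_at_within)
  qed
  let ?K = "11665 * K0"
  \<comment> \<open>Three regional bounds in one formula: -k0 N on the inner window, where the
    competitor has zero density, K N in the layer, and 0 outside. Integrating it gives the
    hole-filling inequality directly.\<close>
  let ?R = "\<lambda>x. ?K * (if x \<in> ?P (r + 1) then N x else 0) - (?K + k0) * (if x \<in> ?P r then N x else 0)"
  have N_cont: "continuous_on ?H N" unfolding N_def[abs_def] by (intro continuous_intros contH)
  have PH: "?P (r + 1) \<subseteq> ?H" "?P r \<subseteq> ?H" using r by (auto simp: P_def cbox_Pair_eq)
  have N_int: "N integrable_on ?P s" if "?P s \<subseteq> ?H" for s
    unfolding P_def by (rule integrable_continuous) (use N_cont that in \<open>auto intro: continuous_on_subset simp: P_def\<close>)
  have restr: "(\<lambda>x. if x \<in> ?P s then N x else 0) integrable_on ?H"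
    "integral ?H (\<lambda>x. if x \<in> ?P s then N x else 0) = integral (?P s) N" if "?P s \<subseteq> ?H" for s
    using N_int[OF that] that by (simp_all add: integrable_restrict_Int integral_restrict_Int Int_absorb2)
  have pointwise: "?E x - g x \<le> ?R x" if x: "x \<in> ?H" for x
  proof -
    let ?t = "v (fst x)"
    have xS: "x \<in> S" using x HS by blast
    have x0: "0 \<le> fst x" using x by (cases x) (auto simp: cbox_Pair_eq)
    define w1 where "w1 = pd w 1 x"
    define w2 where "w2 = pd w 2 x"
    define f1 where "f1 = pd f 1 x"
    define f2 where "f2 = pd f 2 x"
    have t: "0 \<le> ?t" "?t \<le> 1" using v01[OF x0] by auto
    have Z01: "0 \<le> Z x" "Z x \<le> 1" using cutoff_boundD(2,3)[OF Z(1)] by auto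
    have rng: "0 \<le> ?t + w x" "?t + w x \<le> B" using uH[OF x] by (simp_all add: w_def)
    have wf: "w x + f x = (1 - Z x) * w x" by (simp add: f_def algebra_simps)
    \<comment> \<open>The competitor is a convex combination of u and v, so it stays in [0, B], the
      range in which the density bounds hold.\<close>
    have conv: "?t + (w x + f x) = Z x * ?t + (1 - Z x) * (?t + w x)"
      unfolding wf by (simp add: algebra_simps)
    have tB: "?t \<le> B" using t B by simp
    have rng': "0 \<le> ?t + (w x + f x)" "?t + (w x + f x) \<le> B"
    proof -
      show "0 \<le> ?t + (w x + f x)" unfolding conv using Z01 t rng by simp
      have "Z x * ?t + (1 - Z x) * (?t + w x) \<le> Z x * B + (1 - Z x) * B"
        using Z01 tB rng by (intro add_mono mult_left_mono) auto
      then show "?t + (w x + f x) \<le> B" unfolding conv by (simp add: algebra_simps)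
    qed
    let ?h = "calibrated_density W c l ?t (w x) w1 w2"
    let ?h' = "calibrated_density W c l ?t (w x + f x) (w1 + f1) (w2 + f2)"
    have diff: "?E x - g x = ?h' - ?h"
    proof -
      have alg: "a1 * b1 + a2 * b2 + (b1\<^sup>2 + b2\<^sup>2) / 2 + (X - Y)
          = ((a1 + b1)\<^sup>2 / 2 + (a2 + b2)\<^sup>2 / 2 + X) - (a1\<^sup>2 / 2 + a2\<^sup>2 / 2 + Y)"
        for a1 a2 b1 b2 X Y :: real
        by (simp add: power2_sum field_simps)
      have u1: "pd u 1 x = p ?t + w1" "pd u 2 x = w2" by (simp_all only: pdu[OF xS] w1_def w2_def)
      have "?E x = ((p ?t + (w1 + f1))\<^sup>2 / 2 + (w2 + f2)\<^sup>2 / 2 + W (?t + (w x + f x)))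
          - ((p ?t + w1)\<^sup>2 / 2 + w2\<^sup>2 / 2 + W (?t + w x))"
        unfolding energy_excess_def u1 uw[of x] f1_def[symmetric] f2_def[symmetric] alg
        by (simp add: add.assoc)
      then show ?thesis
        unfolding energy_calibration[of ?t _ _ _ c l] g_def u1 uw[of x] w1_def[symmetric] f1_def[symmetric] m_def
        by (simp add: algebra_simps)
    qed
    have low: "k0 * N x \<le> ?h" unfolding N_def w1_def w2_def by (rule cal_lower[OF t rng])
    have Nn: "0 \<le> N x" by (simp add: N_def)
    consider "x \<in> ?P r" | "x \<notin> ?P r" "x \<in> ?P (r + 1)" | "x \<notin> ?P (r + 1)" by blast
    then show ?thesis
    proof cases
      case 1
      then have x1: "x \<in> ?P (r + 1)" by (auto simp: P_def cbox_Pair_eq)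
      have "Z x = 1" by (rule Z(3)) (use 1 x0 in \<open>cases x; auto simp: P_def cbox_Pair_eq abs_le_iff\<close>)+
      moreover from this have "pd Z 1 x = 0" "pd Z 2 x = 0"
        using cutoff_bound_pd_zero[OF Z(1)] by auto
      ultimately have "w x + f x = 0" "w1 + f1 = 0" "w2 + f2 = 0"
        using wf pdf[OF xS, of 1] pdf[OF xS, of 2] by (simp_all add: w1_def w2_def f1_def f2_def)
      then have "?h' = 0" by simp
      then show ?thesis using 1 x1 diff low by (simp add: algebra_simps)
    next
      case 2
      have sq: "((1 - Z x) * b - z * w x)\<^sup>2 \<le> 2 * b\<^sup>2 + 5832 * (w x)\<^sup>2" if "\<bar>z\<bar> \<le> 54" for b z
      proof -
        have "((1 - Z x) * b - z * w x)\<^sup>2 \<le> 2 * ((1 - Z x) * b)\<^sup>2 + 2 * (z * w x)\<^sup>2"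
          using zero_le_power2[of "(1 - Z x) * b + z * w x"] by (simp add: power2_eq_square algebra_simps)
        moreover have "((1 - Z x) * b)\<^sup>2 \<le> b\<^sup>2"
        proof -
          have "(1 - Z x)\<^sup>2 \<le> 1" using Z01 by (intro power_le_one) auto
          then have "(1 - Z x)\<^sup>2 * b\<^sup>2 \<le> 1 * b\<^sup>2" by (intro mult_right_mono) auto
          then show ?thesis by (simp add: power_mult_distrib)
        qed
        moreover have "(z * w x)\<^sup>2 \<le> 2916 * (w x)\<^sup>2"
        proof -
          have "\<bar>z\<bar>\<^sup>2 \<le> 54\<^sup>2" using that by (intro power_mono) auto
          then have "z\<^sup>2 * (w x)\<^sup>2 \<le> 2916 * (w x)\<^sup>2" by (intro mult_right_mono) auto
          then show ?thesis by (simp add: power_mult_distrib)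
        qed
        ultimately show ?thesis by linarith
      qed
      have e: "w1 + f1 = (1 - Z x) * w1 - pd Z 1 x * w x" "w2 + f2 = (1 - Z x) * w2 - pd Z 2 x * w x"
        using pdf[OF xS, of 1] pdf[OF xS, of 2] by (simp_all add: w1_def w2_def f1_def f2_def algebra_simps)
      have s1: "(w1 + f1)\<^sup>2 \<le> 2 * w1\<^sup>2 + 5832 * (w x)\<^sup>2" "(w2 + f2)\<^sup>2 \<le> 2 * w2\<^sup>2 + 5832 * (w x)\<^sup>2"
        unfolding e by (intro sq cutoff_boundD(4)[OF Z(1)]; simp)+
      have s0: "(w x + f x)\<^sup>2 \<le> (w x)\<^sup>2"
      proof -
        have "(1 - Z x)\<^sup>2 \<le> 1" using Z01 by (intro power_le_one) auto
        then have "(1 - Z x)\<^sup>2 * (w x)\<^sup>2 \<le> 1 * (w x)\<^sup>2" by (intro mult_right_mono) auto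
        then show ?thesis unfolding wf by (simp add: power_mult_distrib)
      qed
      have "(w x + f x)\<^sup>2 + (w1 + f1)\<^sup>2 + (w2 + f2)\<^sup>2 \<le> 11665 * N x"
        using s0 s1 zero_le_power2[of w1] zero_le_power2[of w2] unfolding N_def w1_def[symmetric] w2_def[symmetric]
        unfolding distrib_left by linarith
      then have "K0 * ((w x + f x)\<^sup>2 + (w1 + f1)\<^sup>2 + (w2 + f2)\<^sup>2) \<le> K0 * (11665 * N x)"
        using k by (intro mult_left_mono) auto
      moreover have "?h' \<le> K0 * ((w x + f x)\<^sup>2 + (w1 + f1)\<^sup>2 + (w2 + f2)\<^sup>2)"
        by (rule cal_upper[OF t rng'])
      \<comment> \<open>In the layer the density of u helps by its sign and is dropped.\<close>
      moreover have "0 \<le> ?h" using low Nn k by (smt (verit) mult_nonneg_nonneg)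
      ultimately have "?h' - ?h \<le> ?K * N x" by linarith
      then show ?thesis using 2 diff by simp
    next
      case 3
      have "r + 1 \<le> \<bar>fst x - a\<bar> \<or> r + 1 \<le> \<bar>snd x - y\<bar>"
      proof (rule ccontr)
        assume "\<not> ?thesis"
        then show False using 3 x0 by (cases x) (auto simp: P_def cbox_Pair_eq abs_le_iff)
      qed
      then have Z0: "Z x = 0" by (rule Z(4)[OF x0])
      then have "pd Z 1 x = 0" "pd Z 2 x = 0"
        using cutoff_bound_pd_zero[OF Z(1)] by auto
      then have "f x = 0" "f1 = 0" "f2 = 0"
        using Z0 pdf[OF xS, of 1] pdf[OF xS, of 2] by (simp_all add: f_def f1_def f2_def)
      moreover have "x \<notin> ?P r" using 3 by (auto simp: P_def cbox_Pair_eq)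
      ultimately show ?thesis using 3 diff by simp
    qed
  qed
  have E_int: "?E integrable_on ?H"
    by (rule integrable_continuous) (rule continuous_on_subset[OF E_cont HS])
  have g_int: "g integrable_on ?H" by (rule integrable_continuous[OF g_cont])
  have ri: "(\<lambda>x. k * (if x \<in> ?P s then N x else 0)) integrable_on ?H" if "?P s \<subseteq> ?H" for k s
    using integrable_cmul[OF restr(1)[OF that], of k] unfolding real_scaleR_def .
  have "0 \<le> integral ?H (\<lambda>x. ?E x - g x)"
    using pos g_zero by (simp add: Henstock_Kurzweil_Integration.integral_diff[OF E_int g_int])
  also have "\<dots> \<le> integral ?H ?R"
    by (intro integral_le integrable_diff E_int g_int ri PH pointwise)
  also have "\<dots> = ?K * integral (?P (r + 1)) N - (?K + k0) * integral (?P r) N"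
    unfolding Henstock_Kurzweil_Integration.integral_diff[OF ri[OF PH(1)] ri[OF PH(2)]]
      Henstock_Kurzweil_Integration.integral_mult_right restr(2)[OF PH(1)] restr(2)[OF PH(2)] ..
  finally show ?thesis by simp
qed

end

section \<open>Decay\<close>

context odd_minimizer begin

text \<open>In each row only the point with first coordinate a + R / 2 has to lie in the ball, and
  it does: two legs of length at most R / 2 span a distance below R. Convexity in x_1 supplies the
  rest of the row, including the part across the axis.\<close>

lemma window_in_domain:
  assumes ball: "ball (a, y) R \<subseteq> S" and "0 \<le> a" "0 < R" "s \<le> R / 2"
  shows "cbox (- (a + s), y - s) (a + s, y + s) \<subseteq> S"
proof
  fix z assume z: "z \<in> cbox (- (a + s), y - s) (a + s, y + s)"
  obtain z1 z2 where z12: "z = (z1, z2)" by fastforce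
  have b1: "\<bar>z1\<bar> \<le> a + R / 2" and b2: "\<bar>y - z2\<bar> \<le> R / 2"
    using z assms(4) unfolding z12 cbox_Pair_eq abs_le_iff by auto
  have "dist (a, y) (a + R / 2, z2) < R"
  proof -
    have "(R / 2)\<^sup>2 + (y - z2)\<^sup>2 \<le> (R / 2)\<^sup>2 + (R / 2)\<^sup>2"
      using power_mono[OF b2, of 2] by simp
    also have "\<dots> < R\<^sup>2" using assms(3) by (simp add: power2_eq_square)
    finally have "sqrt ((R / 2)\<^sup>2 + (y - z2)\<^sup>2) < sqrt (R\<^sup>2)" by (rule real_sqrt_less_mono)
    then show ?thesis using assms(3) by (simp add: dist_Pair_Pair dist_real_def power_divide)
  qed
  then have "(a + R / 2, z2) \<in> S" using ball by auto
  moreover have pos: "0 < a + R / 2" using assms by simp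
  moreover have "\<bar>z1 / (a + R / 2)\<bar> \<le> 1" using b1 pos by (simp add: abs_divide)
  ultimately have "(z1 / (a + R / 2) * (a + R / 2), z2) \<in> S"
    using S(3) unfolding convex_in_x1_def by blast
  then show "z \<in> S" using pos z12 by simp
qed

lemma window_subset:
  assumes "0 \<le> a" shows "P (a, y) s \<subseteq> cbox (- (a + s), y - s) (a + s, y + s)"
  using assms by (auto simp: P_def cbox_Pair_eq)

lemma continuous_on_N: "continuous_on S N"
  unfolding N_def[abs_def] using C1_onD(2,3)[OF C2_onD(1)[OF C2_w]] by (intro continuous_intros) auto

lemma N_nonneg: "0 \<le> N x"
  by (simp add: N_def)

lemma N_integrable: "P x s \<subseteq> S \<Longrightarrow> N integrable_on P x s"
  unfolding P_def by (rule integrable_continuous[OF continuous_on_subset[OF continuous_on_N]])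

lemma w_bounds:
  assumes "x \<in> S"
  shows "\<bar>w x\<bar> \<le> B + 1" "0 \<le> fst x \<Longrightarrow> \<bar>pd w 1 x\<bar> \<le> B + L" "\<bar>pd w 2 x\<bar> \<le> B"
proof -
  show "\<bar>w x\<bar> \<le> B + 1"
    using u(4)[OF assms] profile(3)[of "fst x"] abs_triangle_ineq4[of "u x" "v (fst x)"] by (simp add: w_def)
  show "\<bar>pd w 2 x\<bar> \<le> B" using u_grad(2)[OF assms] pd_u_eq(2)[OF assms] by simp
  assume "0 \<le> fst x"
  then have "\<bar>p (v (fst x))\<bar> \<le> L" using profile(2,3)[of "fst x"] by (intro p_bound) auto
  moreover have "pd w 1 x = pd u 1 x - p (v (fst x))" using pd_u_eq(1)[OF assms] by simp
  ultimately show "\<bar>pd w 1 x\<bar> \<le> B + L"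
    using u_grad(1)[OF assms] abs_triangle_ineq4[of "pd u 1 x" "p (v (fst x))"] by linarith
qed

lemma window_upper:
  assumes "0 \<le> a" "0 \<le> s" "P (a, y) s \<subseteq> S"
  shows "integral (P (a, y) s) N \<le> (2 * s)\<^sup>2 * ((B + 1)\<^sup>2 + (B + L)\<^sup>2 + B\<^sup>2)"
proof -
  let ?M = "(B + 1)\<^sup>2 + (B + L)\<^sup>2 + B\<^sup>2"
  have "integral (P (a, y) s) N \<le> integral (P (a, y) s) (\<lambda>x. ?M)"
  proof (rule integral_le[OF N_integrable[OF assms(3)]])
    show "(\<lambda>x. ?M) integrable_on P (a, y) s" unfolding P_def by (rule integrable_const)
    fix x assume x: "x \<in> P (a, y) s"
    then have xS: "x \<in> S" and x0: "0 \<le> fst x" using assms(3) by (auto simp: P_def cbox_Pair_eq)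
    note b = w_bounds(1)[OF xS] w_bounds(2)[OF xS x0] w_bounds(3)[OF xS]
    show "N x \<le> ?M"
      unfolding N_def using power_mono[OF b(1), of 2] power_mono[OF b(2), of 2] power_mono[OF b(3), of 2]
      by (simp del: One_nat_def)
  qed
  also have "\<dots> = ((a + s - max 0 (a - s)) * (2 * s)) * ?M"
    unfolding P_def using assms(1,2) by (simp add: content_Pair)
  also have "\<dots> \<le> ((2 * s) * (2 * s)) * ?M"
    using assms(1,2) by (intro mult_right_mono) auto
  finally show ?thesis by (simp add: power2_eq_square)
qed

text \<open>One move in x_1 and one in x_2, so the gradient bounds B + L and B add up. The square
  extends up and to the right of its base point and thus stays in x_1 >= 0.\<close>

lemma w_lipschitz:
  assumes sub: "cbox (a, b) (a + d, b + d) \<subseteq> S" and "0 \<le> a" "(s, t) \<in> cbox (a, b) (a + d, b + d)"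
  shows "\<bar>w (s, t) - w (a, b)\<bar> \<le> (2 * B + L) * d"
proof -
  have st: "a \<le> s" "s \<le> a + d" "b \<le> t" "t \<le> b + d" using assms(3) by (auto simp: cbox_Pair_eq)
  have in_S: "(s', t') \<in> S" if "a \<le> s'" "s' \<le> s" "b \<le> t'" "t' \<le> t" for s' t'
    using that st sub by (auto simp: cbox_Pair_eq)
  have "norm (w (s, b) - w (a, b)) \<le> (B + L) * norm (s - a)"
  proof (rule field_differentiable_bound[of "{a..s}" "\<lambda>z. w (z, b)" "\<lambda>z. pd w 1 (z, b)"])
    fix z assume z: "z \<in> {a..s}"
    then have zS: "(z, b) \<in> S" using st by (intro in_S) auto
    show "((\<lambda>z. w (z, b)) has_field_derivative pd w 1 (z, b)) (at z within {a..s})"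
      by (rule has_field_derivative_at_within[OF pd_slice(1)[OF differentiable_in_S(3)[OF zS]]])
    show "norm (pd w 1 (z, b)) \<le> B + L"
      using w_bounds(2)[OF zS] z assms(2) by simp
  qed (use st in auto)
  moreover have "norm (w (s, t) - w (s, b)) \<le> B * norm (t - b)"
  proof (rule field_differentiable_bound[of "{b..t}" "\<lambda>z. w (s, z)" "\<lambda>z. pd w 2 (s, z)"])
    fix z assume z: "z \<in> {b..t}"
    then have zS: "(s, z) \<in> S" using st by (intro in_S) auto
    show "((\<lambda>z. w (s, z)) has_field_derivative pd w 2 (s, z)) (at z within {b..t})"
      by (rule has_field_derivative_at_within[OF pd_slice(2)[OF differentiable_in_S(3)[OF zS]]])
    show "norm (pd w 2 (s, z)) \<le> B" using w_bounds(3)[OF zS] by simp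
  qed (use st in auto)
  moreover have "(B + L) * norm (s - a) \<le> (B + L) * d" "B * norm (t - b) \<le> B * d"
    using st B k by (intro mult_left_mono; simp)+
  moreover have "(2 * B + L) * d = (B + L) * d + B * d" by (simp add: algebra_simps)
  ultimately show ?thesis unfolding real_norm_def by linarith
qed

text \<open>If |w| = e at the base point, then |w| >= e / 2 on a square of side e / (2 E), where E =
  2 B + L. Its contribution e^4 / (16 E^2) to the integral explains the fourth power.\<close>

lemma window_lower:
  assumes "0 \<le> a" and sub: "P (a, b) 1 \<subseteq> S"
  shows "(w (a, b)) ^ 4 \<le> 16 * (2 * B + L)\<^sup>2 * integral (P (a, b) 1) N"
proof -
  let ?E = "2 * B + L"
  define e where "e = \<bar>w (a, b)\<bar>"
  define d where "d = e / (2 * ?E)"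
  have E: "0 < ?E" using B k by simp
  have abS: "(a, b) \<in> S" using sub assms(1) by (auto simp: P_def cbox_Pair_eq)
  have d: "0 \<le> d" "d \<le> 1" "2 * (?E * d) = e"
  proof -
    show "0 \<le> d" using E by (simp add: d_def e_def)
    \<comment> \<open>The a priori bound for w makes the square fit into the window of radius
      1.\<close>
    have "e \<le> B + 1" unfolding e_def by (rule w_bounds(1)[OF abS])
    then have "e \<le> 2 * ?E" using B k by simp
    then show "d \<le> 1" using E by (simp add: d_def)
    have "2 * (z * (e / (2 * z))) = e" if "0 < z" for z using that by simp
    then show "2 * (?E * d) = e" unfolding d_def using E by blast
  qed
  let ?Q = "cbox (a, b) (a + d, b + d)"
  have QP: "?Q \<subseteq> P (a, b) 1" using d assms(1) by (auto simp: P_def cbox_Pair_eq)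
  then have QS: "?Q \<subseteq> S" using sub by blast
  have N_low: "e\<^sup>2 / 4 \<le> N x" if x: "x \<in> ?Q" for x
  proof -
    obtain s t where st: "x = (s, t)" by fastforce
    have "\<bar>w x - w (a, b)\<bar> \<le> ?E * d" unfolding st by (rule w_lipschitz[OF QS assms(1)]) (use x st in simp)
    then have "e / 2 \<le> \<bar>w x\<bar>" using d(3) unfolding e_def by linarith
    then have "(e / 2)\<^sup>2 \<le> \<bar>w x\<bar>\<^sup>2" by (rule power_mono) (simp add: e_def)
    then have "e\<^sup>2 / 4 \<le> (w x)\<^sup>2" by (simp add: power_divide)
    then show ?thesis unfolding N_def by (simp add: add_increasing2)
  qed
  have "d\<^sup>2 * (e\<^sup>2 / 4) = integral ?Q (\<lambda>x. e\<^sup>2 / 4)"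
    using d(1) by (simp add: content_Pair power2_eq_square)
  also have "\<dots> \<le> integral ?Q N"
    by (rule integral_le[OF integrable_const _ N_low])
       (rule integrable_continuous[OF continuous_on_subset[OF continuous_on_N QS]])
  also have "\<dots> \<le> integral (P (a, b) 1) N"
    by (rule integral_subset_le[OF QP])
       (use N_nonneg N_integrable[OF sub] integrable_continuous[OF continuous_on_subset[OF continuous_on_N QS]] in auto)
  finally have "d\<^sup>2 * (e\<^sup>2 / 4) \<le> integral (P (a, b) 1) N" .
  then have "16 * ?E\<^sup>2 * (d\<^sup>2 * (e\<^sup>2 / 4)) \<le> 16 * ?E\<^sup>2 * integral (P (a, b) 1) N"
    by (rule mult_left_mono) simp
  moreover have "16 * ?E\<^sup>2 * (d\<^sup>2 * (e\<^sup>2 / 4)) = (2 * (?E * d))\<^sup>2 * e\<^sup>2" by (simp add: power_mult_distrib)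
  moreover have "(2 * (?E * d))\<^sup>2 * e\<^sup>2 = (w (a, b)) ^ 4" unfolding d(3) by (simp add: e_def power_add[symmetric])
  ultimately show ?thesis by (simp only:)
qed

text \<open>Hole filling from radius 1 to radius n yields n - 1 factors, and the crude bound at
  radius n contributes the area of the window. The restriction on n keeps the reflected windows in
  S.\<close>

lemma deviation_decay:
  assumes ball: "ball (a, y) R \<subseteq> S" and a: "0 \<le> a" and n: "1 \<le> n" "real n \<le> R / 2"
  shows "(w (a, y)) ^ 4 \<le> 16 * (2 * B + L)\<^sup>2 * ((11665 * K0 / (11665 * K0 + k0)) ^ (n - 1)
    * ((2 * real n)\<^sup>2 * ((B + 1)\<^sup>2 + (B + L)\<^sup>2 + B\<^sup>2)))"
proof -
  let ?K = "11665 * K0"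
  let ?I = "\<lambda>s. integral (P (a, y) s) N"
  define \<theta> where "\<theta> = ?K / (?K + k0)"
  have Kk: "0 < ?K + k0" "0 \<le> \<theta>" using k by (auto simp: \<theta>_def)
  have R: "0 < R" using n by simp
  have PS: "P (a, y) s \<subseteq> S" if "s \<le> R / 2" for s
    using window_subset[OF a] window_in_domain[OF ball a R that] by blast
  have step: "?I (real j) \<le> \<theta> * ?I (real j + 1)" if "j + 1 \<le> n" for j
  proof -
    have "real j + 1 \<le> R / 2" using that n by linarith
    then have "cbox (- (a + (real j + 1)), y - (real j + 1)) (a + (real j + 1), y + (real j + 1)) \<subseteq> S"
      by (rule window_in_domain[OF ball a R])
    then have "(?K + k0) * ?I (real j) \<le> ?K * ?I (real j + 1)"
      using hole_filling[of "real j" a y] a by (simp add: add.assoc)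
    then show ?thesis using Kk(1) by (simp add: \<theta>_def field_simps)
  qed
  have iter: "?I 1 \<le> \<theta> ^ m * ?I (real (m + 1))" if "m + 1 \<le> n" for m
    using that
  proof (induction m)
    case (Suc m)
    have "?I 1 \<le> \<theta> ^ m * ?I (real (m + 1))" using Suc by simp
    also have "\<dots> \<le> \<theta> ^ m * (\<theta> * ?I (real (m + 1) + 1))"
      using Suc.prems Kk(2) by (intro mult_left_mono step) auto
    finally show ?case by (simp add: mult_ac add_ac)
  qed simp
  have "?I 1 \<le> \<theta> ^ (n - 1) * ?I (real n)" using iter[of "n - 1"] n(1) by simp
  also have "\<dots> \<le> \<theta> ^ (n - 1) * ((2 * real n)\<^sup>2 * ((B + 1)\<^sup>2 + (B + L)\<^sup>2 + B\<^sup>2))"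
    using Kk(2) by (intro mult_left_mono window_upper a PS n) auto
  finally have 1: "?I 1 \<le> \<theta> ^ (n - 1) * ((2 * real n)\<^sup>2 * ((B + 1)\<^sup>2 + (B + L)\<^sup>2 + B\<^sup>2))" .
  have "(w (a, y)) ^ 4 \<le> 16 * (2 * B + L)\<^sup>2 * ?I 1"
    using n by (intro window_lower a PS) auto
  also have "\<dots> \<le> 16 * (2 * B + L)\<^sup>2 * (\<theta> ^ (n - 1) * ((2 * real n)\<^sup>2 * ((B + 1)\<^sup>2 + (B + L)\<^sup>2 + B\<^sup>2)))"
    using 1 by (rule mult_left_mono) simp
  finally show ?thesis by (simp add: \<theta>_def)
qed

end

section \<open>From geometric decay to an exponential rate in the distance\<close>

lemma power_times_square_le_exp:
  fixes \<theta> D E :: real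
  assumes "0 < \<theta>" "\<theta> < 1" "0 \<le> D" "0 \<le> E"
  obtains A k where "0 < A" "0 < k"
    "\<And>R z. 0 < R \<Longrightarrow> z \<le> E \<Longrightarrow> (\<And>n. 1 \<le> n \<Longrightarrow> real n \<le> R / 2 \<Longrightarrow> z \<le> D * (\<theta> ^ (n - 1) * (real n)\<^sup>2)) \<Longrightarrow>
      z \<le> A * exp (- k * R)"
proof -
  \<comment> \<open>Half of the decay exp(-4 k n) absorbs n^2, because n exp(-k n) is bounded; the
    other half gives the rate, with n about R / 2.\<close>
  define k where "k = - ln \<theta> / 4"
  have k: "0 < k" using assms(1,2) by (simp add: k_def)
  have th: "\<theta> = exp (- 4 * k)" using assms(1) by (simp add: k_def)
  have "(\<lambda>n. real n * exp (- k) ^ n) \<longlonglongrightarrow> 0"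
    using powser_times_n_limit_0[of "exp (- k)"] k by simp
  then have "Bseq (\<lambda>n. real n * exp (- k) ^ n)" by (intro convergent_imp_Bseq convergentI)
  then obtain b where b: "0 < b" "\<And>n. norm (real n * exp (- k) ^ n) \<le> b" by (auto elim: BseqE)
  \<comment> \<open>The term \<open>E\<close> covers R < 2, where no n >= 1 is available; exp(2 k)
    pays for rounding R / 2 down, and the 1 makes \<open>A\<close> positive.\<close>
  define A where "A = (D * b\<^sup>2 * exp (4 * k) + E + 1) * exp (2 * k)"
  have "0 \<le> D * b\<^sup>2 * exp (4 * k)" using assms by simp
  then have "0 < D * b\<^sup>2 * exp (4 * k) + E + 1" using assms by linarith
  then have A: "0 < A" by (simp add: A_def)
  have "z \<le> A * exp (- k * R)"
    if R: "0 < R" and E: "z \<le> E"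
      and z: "\<And>n. 1 \<le> n \<Longrightarrow> real n \<le> R / 2 \<Longrightarrow> z \<le> D * (\<theta> ^ (n - 1) * (real n)\<^sup>2)" for R z
  proof -
    define n where "n = nat \<lfloor>R / 2\<rfloor>"
    have n: "real n \<le> R / 2" "R / 2 < real n + 1"
      using R of_int_floor_le[of "R / 2"] by (simp_all add: n_def)
    have zn: "z \<le> (D * b\<^sup>2 * exp (4 * k) + E + 1) * exp (- 2 * k * real n)"
    proof (cases "n = 0")
      case True
      then show ?thesis using E \<open>0 \<le> D * b\<^sup>2 * exp (4 * k)\<close> by simp
    next
      case False
      then have "z \<le> D * (\<theta> ^ (n - 1) * (real n)\<^sup>2)" using n by (intro z) auto
      also have "\<theta> ^ (n - 1) = exp (4 * k) * exp (- 2 * k * real n) * (exp (- k) ^ n)\<^sup>2"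
      proof -
        have "\<theta> ^ (n - 1) = exp (- 4 * k * (real n - 1))"
          using False by (simp add: th exp_of_nat_mult[symmetric] of_nat_diff mult_ac)
        moreover have "(exp (- k) ^ n)\<^sup>2 = exp (- 2 * k * real n)"
          by (simp add: exp_of_nat_mult[symmetric] power2_eq_square exp_add[symmetric] mult_ac)
        ultimately show ?thesis by (simp add: exp_add[symmetric] algebra_simps)
      qed
      also have "D * (exp (4 * k) * exp (- 2 * k * real n) * (exp (- k) ^ n)\<^sup>2 * (real n)\<^sup>2)
        = D * exp (4 * k) * exp (- 2 * k * real n) * (real n * exp (- k) ^ n)\<^sup>2"
        by (simp add: power_mult_distrib)
      also have "\<dots> \<le> D * exp (4 * k) * exp (- 2 * k * real n) * b\<^sup>2"
        using power_mono[OF b(2)[of n], of 2] assms by (intro mult_left_mono) auto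
      also have "\<dots> = (D * b\<^sup>2 * exp (4 * k)) * exp (- 2 * k * real n)" by simp
      also have "\<dots> \<le> (D * b\<^sup>2 * exp (4 * k) + E + 1) * exp (- 2 * k * real n)"
        using assms by (intro mult_right_mono) auto
      finally show ?thesis .
    qed
    also have "\<dots> \<le> (D * b\<^sup>2 * exp (4 * k) + E + 1) * (exp (2 * k) * exp (- k * R))"
    proof (rule mult_left_mono)
      have "k * (R / 2) \<le> k * (real n + 1)" using n k by (intro mult_left_mono) auto
      then have "- 2 * k * real n \<le> 2 * k + - k * R" by (simp add: algebra_simps)
      then show "exp (- 2 * k * real n) \<le> exp (2 * k) * exp (- k * R)"
        unfolding exp_add[symmetric] exp_le_cancel_iff .
    qed (use assms \<open>0 \<le> D * b\<^sup>2 * exp (4 * k)\<close> in simp)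
    finally show ?thesis by (simp add: A_def mult.assoc)
  qed
  then show ?thesis using that[OF A k] by blast
qed

text \<open>A ball about x that leaves S is connected and meets both S and its complement, hence
  meets the frontier, which cannot happen below the distance to it.\<close>

lemma ball_infdist_frontier_subset:
  fixes S :: "'a::euclidean_space set"
  assumes "open S" "x \<in> S" "frontier S \<noteq> {}"
  shows "ball x (infdist x (frontier S)) \<subseteq> S" "0 < infdist x (frontier S)"
proof -
  have nf: "x \<notin> frontier S" using assms by (simp add: frontier_def interior_open)
  then show pos: "0 < infdist x (frontier S)"
    using infdist_pos_not_in_closed[OF frontier_closed assms(3)] by blast
  show "ball x (infdist x (frontier S)) \<subseteq> S"
  proof (rule ccontr)
    assume "\<not> ball x (infdist x (frontier S)) \<subseteq> S"
    then have "ball x (infdist x (frontier S)) - S \<noteq> {}" by blast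
    moreover have "x \<in> ball x (infdist x (frontier S)) \<inter> S" using pos assms(2) by simp
    then have "ball x (infdist x (frontier S)) \<inter> S \<noteq> {}" by blast
    ultimately obtain z where "z \<in> ball x (infdist x (frontier S))" "z \<in> frontier S"
      using connected_Int_frontier[OF connected_ball] by blast
    then show False using infdist_le[of z "frontier S" x] by simp
  qed
qed

theorem theorem2:
  fixes W :: "real \<Rightarrow> real" and M C :: real
  assumes W_C3: "C3_real W"
    and W_even: "\<forall>s. W (- s) = W s"
    and W_one: "W 1 = 0"
    and W_pos: "\<forall>s\<ge>0. s \<noteq> 1 \<longrightarrow> W s > 0"
    and W_nondeg: "deriv (deriv W) 1 > 0"
    and M_pos: "M > 0"
    and W_M: "\<forall>s\<ge>M. deriv W s \<ge> 0"
  shows "\<exists>q :: real \<Rightarrow> real.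
           continuous_on {0<..} q \<and> antimono_on {0<..} q \<and> (q \<longlongrightarrow> 0) at_top \<and>
           (\<forall>(\<Omega> :: (real \<times> real) set) \<alpha> g u ubar.
              domain \<Omega> \<and> frontier \<Omega> \<noteq> {} \<and> sym_set \<Omega> \<and> convex_in_x1 \<Omega> \<and>
              0 < \<alpha> \<and> \<alpha> < 1 \<and> c2a_boundary \<alpha> \<Omega> \<and>
              (\<not> bounded \<Omega> \<longrightarrow> uniform_c2a_boundary \<alpha> \<Omega> \<and> (\<exists>\<rho>. interior_sphere \<rho> \<Omega>)) \<and>
              C2a_bounded_on \<alpha> \<Omega> g \<and> (\<forall>x\<in>closure \<Omega>. g (refl1 x) = - g x) \<and>
              (\<forall>x\<in>plus_part (frontier \<Omega>). g x \<ge> 0) \<and>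
              constructed_solution W M \<alpha> \<Omega> g u \<and>
              (\<forall>x\<in>\<Omega>. \<bar>u x\<bar> \<le> C \<and> \<bar>pd u 1 x\<bar> \<le> C \<and> \<bar>pd u 2 x\<bar> \<le> C) \<and>
              (\<forall>s. (ubar has_real_derivative deriv ubar s) (at s)) \<and>
              (\<forall>s. (deriv ubar has_real_derivative deriv W (ubar s)) (at s)) \<and>
              (\<forall>s. ubar (- s) = - ubar s) \<and> (ubar \<longlongrightarrow> 1) at_top
              \<longrightarrow> (\<forall>x\<in>\<Omega>. \<bar>u x - ubar (fst x)\<bar> \<le> q (infdist x (frontier \<Omega>))))"
proof -
  interpret double_well W
    using assms by unfold_locales auto
  \<comment> \<open>All constants up to \<open>q\<close> are chosen from W and C, before any domain
    or solution is given. The maximum with 2 leaves room on both sides of the well in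
    [0, B].\<close>
  define B where "B = max 2 C"
  have B: "2 \<le> B" "C \<le> B" by (auto simp: B_def)
  obtain c l k0 K0 L where k: "0 < c" "0 < l" "0 < k0" "0 < K0" "0 < L"
    and pL: "\<And>t. 0 \<le> t \<Longrightarrow> t \<le> 1 \<Longrightarrow> \<bar>p t\<bar> \<le> L"
    and cal: "\<And>t z z1 z2. 0 \<le> t \<Longrightarrow> t \<le> 1 \<Longrightarrow> 0 \<le> t + z \<Longrightarrow> t + z \<le> B \<Longrightarrow>
      k0 * (z\<^sup>2 + z1\<^sup>2 + z2\<^sup>2) \<le> calibrated_density W c l t z z1 z2"
    "\<And>t z z1 z2. 0 \<le> t \<Longrightarrow> t \<le> 1 \<Longrightarrow> 0 \<le> t + z \<Longrightarrow> t + z \<le> B \<Longrightarrow>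
      calibrated_density W c l t z z1 z2 \<le> K0 * (z\<^sup>2 + z1\<^sup>2 + z2\<^sup>2)"
    using calibrated_density_bounds[OF B(1)] by blast
  define \<theta> where "\<theta> = 11665 * K0 / (11665 * K0 + k0)"
  \<comment> \<open>64 is the 16 of the pointwise bound times the 4 in (2 n)^2.\<close>
  define D where "D = 64 * (2 * B + L)\<^sup>2 * ((B + 1)\<^sup>2 + (B + L)\<^sup>2 + B\<^sup>2)"
  have "0 < \<theta>" "\<theta> < 1" "0 \<le> D" using k by (auto simp: \<theta>_def D_def)
  moreover have "0 \<le> (B + 1) ^ 4" using B by simp
  ultimately obtain A \<kappa> where A: "0 < A" "0 < \<kappa>" and decay:
    "\<And>R z. 0 < R \<Longrightarrow> z \<le> (B + 1) ^ 4 \<Longrightarrow>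
      (\<And>n. 1 \<le> n \<Longrightarrow> real n \<le> R / 2 \<Longrightarrow> z \<le> D * (\<theta> ^ (n - 1) * (real n)\<^sup>2)) \<Longrightarrow> z \<le> A * exp (- \<kappa> * R)"
    by (rule power_times_square_le_exp) blast
  \<comment> \<open>A fourth root, as the decay is obtained for the fourth power of w.\<close>
  define q where "q = (\<lambda>R. sqrt (sqrt (A * exp (- \<kappa> * R))))"
  have bound: "\<bar>u x - v (fst x)\<bar> \<le> q (infdist x (frontier S))"
    if dom: "domain S" "frontier S \<noteq> {}" "sym_set S" "convex_in_x1 S"
      and sol: "constructed_solution W M \<alpha> S g u"
        "\<forall>x\<in>S. \<bar>u x\<bar> \<le> C \<and> \<bar>pd u 1 x\<bar> \<le> C \<and> \<bar>pd u 2 x\<bar> \<le> C"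
      and prof: "\<forall>s. (v has_real_derivative deriv v s) (at s)"
        "\<forall>s. (deriv v has_real_derivative W' (v s)) (at s)" "\<forall>s. v (- s) = - v s" "(v \<longlongrightarrow> 1) at_top"
      and x: "x \<in> S" for S \<alpha> g u v x
  proof -
    have op: "open S" using dom(1) by (simp add: domain_def)
    note props = constructed_solution_props[OF continuous_on_W W_nonneg op sol(1)]
    interpret odd_minimizer W v u S B c l k0 K0 L
    proof
      show "C2_on S u" using sol(1) by (simp add: constructed_solution_def)
      show "\<bar>u x\<bar> \<le> B" "\<bar>pd u 1 x\<bar> \<le> B" "\<bar>pd u 2 x\<bar> \<le> B" if "x \<in> S" for x
        using sol(2) that B(2) by (meson order_trans)+
    qed (use prof B(1) k pL cal op dom(3,4) props in auto)
    let ?R = "infdist x (frontier S)"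
    have ball: "ball x ?R \<subseteq> S" and R: "0 < ?R"
      using ball_infdist_frontier_subset[OF op x dom(2)] by auto
    have main: "(w (a, y)) ^ 4 \<le> A * exp (- \<kappa> * ?R)" if a: "0 \<le> a" and b: "ball (a, y) ?R \<subseteq> S" for a y
    proof (rule decay[OF R])
      have "(a, y) \<in> S" using b R by auto
      then have "\<bar>w (a, y)\<bar> ^ 4 \<le> (B + 1) ^ 4" by (intro power_mono w_bounds) auto
      then show "(w (a, y)) ^ 4 \<le> (B + 1) ^ 4" by simp
      fix n assume n: "1 \<le> n" "real n \<le> ?R / 2"
      show "(w (a, y)) ^ 4 \<le> D * (\<theta> ^ (n - 1) * (real n)\<^sup>2)"
        using deviation_decay[OF b a n] unfolding D_def \<theta>_def by (simp add: power_mult_distrib mult_ac)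
    qed
    have "(w x) ^ 4 \<le> A * exp (- \<kappa> * ?R)"
    proof (cases "0 \<le> fst x")
      case True
      then show ?thesis using main[of "fst x" "snd x"] ball by simp
    next
      case False
      \<comment> \<open>A point left of the axis is treated through its mirror image: symmetry of S
        carries the ball over with the same radius, and w is odd.\<close>
      have "ball (refl1 x) ?R \<subseteq> S"
      proof
        fix z assume "z \<in> ball (refl1 x) ?R"
        then have "refl1 z \<in> ball x ?R"
          by (cases x; cases z) (simp add: refl1_def dist_Pair_Pair dist_real_def abs_minus_commute add.commute)
        then have "refl1 (refl1 z) \<in> S" using ball dom(3) by (auto simp: sym_set_def)
        then show "z \<in> S" by (simp add: refl1_def)
      qed
      then have "(w (refl1 x)) ^ 4 \<le> A * exp (- \<kappa> * ?R)"
        using main[of "- fst x" "snd x"] False by (simp add: refl1_def)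
      then show ?thesis using w_odd[OF x] by simp
    qed
    moreover have "\<bar>w x\<bar> = sqrt (sqrt ((w x) ^ 4))"
    proof -
      have "sqrt ((w x) ^ 4) = (w x)\<^sup>2" using real_sqrt_abs[of "(w x)\<^sup>2"] by simp
      then show ?thesis by simp
    qed
    ultimately have "\<bar>w x\<bar> \<le> q ?R" unfolding q_def by simp
    then show ?thesis by (simp add: w_def)
  qed
  have "continuous_on {0<..} q" unfolding q_def by (intro continuous_intros)
  moreover have "antimono_on {0<..} q"
    unfolding q_def using A by (intro monotone_onI) simp
  moreover have "(q \<longlongrightarrow> 0) at_top"
  proof -
    have "filterlim (\<lambda>R. \<kappa> * R) at_top at_top"
      using A(2) by (intro filterlim_tendsto_pos_mult_at_top[OF tendsto_const] filterlim_ident)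
    then have "filterlim (\<lambda>R. - \<kappa> * R) at_bot at_top" by (simp add: filterlim_uminus_at_bot)
    then have "((\<lambda>R. exp (- \<kappa> * R)) \<longlongrightarrow> 0) at_top" by (rule filterlim_compose[OF exp_at_bot])
    then have "((\<lambda>R. sqrt (sqrt (A * exp (- \<kappa> * R)))) \<longlongrightarrow> sqrt (sqrt (A * 0))) at_top"
      by (intro tendsto_intros)
    then show ?thesis by (simp add: q_def)
  qed
  ultimately show ?thesis using bound by (intro exI[of _ q] conjI allI impI ballI) (assumption | blast)+
qed

end
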